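(* Let $n\ge1$ be an integer, $Q=2n+2$, $\alpha>Q$ and $p_\alpha=\frac{2Q}{Q+\alpha}$, and let $$N_{Q,\alpha}=\inf_{f,g}\ \frac{\int_{\mathbb{S}^{2n+1}}\int_{\mathbb{S}^{2n+1}} f(\xi)g(\eta)\,|1-\xi\cdot\bar\eta|^{(\alpha-Q)/2}\,d\xi\,d\eta}{\|f\|_{L^{p_\alpha}(\mathbb{S}^{2n+1})}\,\|g\|_{L^{p_\alpha}(\mathbb{S}^{2n+1})}},$$ the infimum being over nonnegative $f,g\in L^{p_\alpha}(\mathbb{S}^{2n+1})\setminus\{0\}$. Then $$0<\frac{(8|B_1|)^{\frac{Q-\alpha}{Q}}}{2^{1+n\frac{\alpha-Q}{Q}}\,p_\alpha^2}\ \leq\ N_{Q,\alpha}\ \leq\ \Bigl(\frac{2\pi^{n+1}}{n!}\Bigr)^{(Q-\alpha)/Q}\frac{n!\,\Gamma(\alpha/2)}{\Gamma^2((Q+\alpha)/4)},$$ where $$\Bigl(\frac{2\pi^{n+1}}{n!}\Bigr)^{(Q-\alpha)/Q}\frac{n!\,\Gamma(\alpha/2)}{\Gamma^2((Q+\alpha)/4)}=|\mathbb{S}^{2n+1}|^{1-\frac{2}{p_\alpha}}\int_{\mathbb{S}^{2n+1}}|1-\xi\cdot\bar\eta|^{\frac{\alpha-Q}{2}}\,d\eta$$ for every $\xi\in\mathbb{S}^{2n+1}$.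
   Context: $\mathbb{S}^{2n+1}=\{\xi=(\xi_1,\dots,\xi_{n+1})\in\mathbb{C}^{n+1}:\|\xi\|=1\}$ is the unit sphere, $\xi\cdot\bar\eta=\sum_{j=1}^{n+1}\xi_j\overline{\eta_j}$, $d\xi$ is the Euclidean volume (surface) element of $\mathbb{S}^{2n+1}$ and $|\mathbb{S}^{2n+1}|$ its total volume. For $0<p<1$, $L^p(\mathbb{S}^{2n+1})$ is the set of measurable functions with $\|f\|_{L^p(\mathbb{S}^{2n+1})}=\left(\int_{\mathbb{S}^{2n+1}}|f|^p\,d\xi\right)^{1/p}<\infty$ (a quasi-norm); $p_\alpha\in(0,1)$ because $\alpha>Q$. Integrals of nonnegative functions take values in $[0,+\infty]$. $|B_1|$ is the Lebesgue measure of $B_1=\{(z,t)\in\mathbb{C}^n\times\mathbb{R}: |z|^4+t^2<1\}$, the unit ball of the Heisenberg group $\mathbb{H}^n=\mathbb{C}^n\times\mathbb{R}$. *)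

theory Defs
  imports "HOL-Analysis.Analysis"
begin

text \<open>
  For a Borel set A of the unit sphere of a Euclidean space of dimension d, the surface
  area of A is d times the Lebesgue measure of the cone {r x | 0 < r < 1, x in A}, that is,
  of the preimage of A under x |-> sgn x = x / |x| on the punctured unit ball.
  The completion makes all Lebesgue measurable functions on the sphere measurable.
\<close>

definition sphere_measure :: "'a::euclidean_space measure" where
  "sphere_measure = completion (scale_measure (ennreal (real DIM('a)))
     (distr (restrict_space lborel (ball 0 1 - {0})) (restrict_space borel (sphere 0 1)) sgn))"

lemma space_sphere_measure: "space (sphere_measure :: 'a::euclidean_space measure) = sphere 0 1"
  unfolding sphere_measure_def by (simp add: space_restrict_space space_scale_measure)

lemma measurable_sgn_sphere:
  "sgn \<in> measurable (restrict_space lborel (ball 0 1 - {0}))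
           (restrict_space borel (sphere (0::'a::euclidean_space) 1))"
proof (rule measurable_restrict_space2)
  show "sgn \<in> space (restrict_space lborel (ball 0 1 - {0})) \<rightarrow> sphere (0::'a) 1"
    by (auto simp: space_restrict_space norm_sgn)
  show "(sgn :: 'a \<Rightarrow> 'a) \<in> borel_measurable (restrict_space lborel (ball 0 1 - {0}))"
    by (rule measurable_restrict_space1) (unfold sgn_div_norm, measurable)
qed

lemma emeasure_sphere_measure:
  fixes A :: "'a::euclidean_space set"
  assumes A: "A \<in> sets borel" "A \<subseteq> sphere 0 1"
  shows "emeasure sphere_measure A
           = ennreal (real DIM('a)) * emeasure lborel {x \<in> ball 0 1 - {0}. sgn x \<in> A}"
proof -
  have s: "A \<in> sets (restrict_space borel (sphere (0::'a) 1))"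
    using A by (subst sets_restrict_space_iff) auto
  have eq: "sgn -` A \<inter> (ball 0 1 - {0}) = {x \<in> ball 0 1 - {0}. sgn x \<in> A}" by auto
  have "emeasure sphere_measure A
          = ennreal (real DIM('a)) * emeasure (restrict_space lborel (ball 0 1 - {0})) (sgn -` A \<inter> (ball 0 1 - {0}))"
    unfolding sphere_measure_def using s
    by (simp add: emeasure_completion emeasure_distr[OF measurable_sgn_sphere s] space_restrict_space)
  then show ?thesis
    unfolding eq by (subst (asm) emeasure_restrict_space) auto
qed

lemma emeasure_sphere_measure_sphere:
  "emeasure sphere_measure (sphere (0::'a::euclidean_space) 1)
     = ennreal (real DIM('a) * unit_ball_vol (real DIM('a)))"
proof -
  have "{x \<in> ball 0 1 - {0}. sgn x \<in> sphere 0 1} = ball 0 1 - {0::'a}" by (auto simp: norm_sgn)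
  moreover have "emeasure lborel (ball 0 1 - {0::'a}) = emeasure lborel (ball (0::'a) 1)"
    by (rule emeasure_Diff_null_set) auto
  ultimately show ?thesis
    by (subst emeasure_sphere_measure) (auto simp: emeasure_ball ennreal_mult)
qed

definition cdot :: "complex ^ 'm \<Rightarrow> complex ^ 'm \<Rightarrow> complex" where
  "cdot \<xi> \<eta> = (\<Sum>j\<in>UNIV. \<xi> $ j * cnj (\<eta> $ j))"

definition Lp_space :: "'a measure \<Rightarrow> real \<Rightarrow> ('a \<Rightarrow> real) set" where
  "Lp_space M p = {f \<in> borel_measurable M. integrable M (\<lambda>x. \<bar>f x\<bar> powr p)}"

definition Lp_norm :: "'a measure \<Rightarrow> real \<Rightarrow> ('a \<Rightarrow> real) \<Rightarrow> real" where
  "Lp_norm M p f = (\<integral>x. \<bar>f x\<bar> powr p \<partial>M) powr (1 / p)"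

text \<open>Removing 0 from the space means removing all functions that vanish almost everywhere.\<close>

definition Lp_nonneg_nonzero :: "'a measure \<Rightarrow> real \<Rightarrow> ('a \<Rightarrow> real) set" where
  "Lp_nonneg_nonzero M p =
     {f \<in> Lp_space M p. (\<forall>x\<in>space M. 0 \<le> f x) \<and> \<not> (AE x in M. f x = 0)}"

text \<open>
  With n = CARD('n), the space \<open>complex ^ ('n option)\<close> is n+1-dimensional complex space.
  The numerator may be infinite, so the infimum is taken in the extended nonnegative reals.
\<close>

definition sphere_HLS_inf :: "'n::finite itself \<Rightarrow> real \<Rightarrow> real \<Rightarrow> ennreal" where
  "sphere_HLS_inf _ \<gamma> p =
     (let \<sigma> = (sphere_measure :: (complex ^ ('n option)) measure) in
      INF (f, g) \<in> Lp_nonneg_nonzero \<sigma> p \<times> Lp_nonneg_nonzero \<sigma> p.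
        (\<integral>\<^sup>+\<xi>. (\<integral>\<^sup>+\<eta>. ennreal (f \<xi> * g \<eta> * cmod (1 - cdot \<xi> \<eta>) powr \<gamma>) \<partial>\<sigma>) \<partial>\<sigma>)
        / ennreal (Lp_norm \<sigma> p f * Lp_norm \<sigma> p g))"

definition heisenberg_unit_ball :: "((complex ^ 'n::finite) \<times> real) set" where
  "heisenberg_unit_ball = {(z, t). norm z ^ 4 + t\<^sup>2 < 1}"

end

theory Submission
  imports Defs
begin

text \<open>
  Put mu = (alpha - Q) / Q.  Then 1 / p = 1 + mu / 2, and the exponent of the kernel is
  (alpha - Q) / 2 = mu * (n + 1).

  The upper bound is the value of the quotient for two constant functions.  Up to a power of the
  total area this is the integral of |1 - w| powr (mu * (n + 1)) against the image of the surface
  measure under eta to w = cdot xi eta.  For every xi this image has the density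
  const * (1 - |w|^2)^(n - 1) on the unit disc (nn_integral_sphere_eq_disc), and in
  coordinates centred at the boundary point w = 1 the integral is a product of two beta integrals
  (nn_integral_disc_powr).

  The lower bound rests on the smallness of the caps |1 - cdot xi eta| < r on which the kernel is
  small: with C = 2^n |B_1|, their area is at most C r^(n + 1), since 1 - |w|^2 <= 2 Re (1 - w) on
  the disc (nn_integral_sphere_le_radial).  Hence a function u with values in [0, 1] cannot be hidden
  where the kernel is small, and its potential is everywhere at least
  (2 C)^(-mu) X^(1 + mu) / (p (1 + mu)), where X is the integral of u powr p
  (capped_potential_lower_bound).

  For nonnegative f and g let P and R be the integrals of f powr p and g powr p.  By homogeneity both
  functions may be scaled so that their parts below height 1 carry P / 2 and R / 2 (median_level).
  The part of f below height 1 is tested against what remains of g, and conversely; half of the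
  lower part is left in the remainder, as a product of two lower parts may be divided between the
  two tests.  By convexity the remainder of g then has integral at least
  (1 + mu) 2^(-mu) (R / 2) / p (rest_lower_bound).  So the energy is at least
  (4 C)^(-mu) p^(-2) ((P / 2)^(1 + mu) (R / 2) + (R / 2)^(1 + mu) (P / 2)), and the inequality of
  the arithmetic and geometric mean bounds this below by (8 C)^(-mu) (P R)^(1 / p) / (2 p^2)
  (energy_lower_bound), which is the asserted constant times the product of the two norms.
\<close>

section \<open>Lebesgue measure under isometries and substitutions\<close>

lemma nn_integral_lborel_affine:
  fixes f :: "'a::euclidean_space \<Rightarrow> ennreal"
  assumes [measurable]: "f \<in> borel_measurable borel" and "c \<noteq> 0"
  shows "(\<integral>\<^sup>+x. f x \<partial>lborel) = ennreal (\<bar>c\<bar> ^ DIM('a)) * (\<integral>\<^sup>+x. f (t + c *\<^sub>R x) \<partial>lborel)"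
  by (subst lborel_affine[OF assms(2), of t])
     (simp add: nn_integral_density nn_integral_distr nn_integral_cmult)

text \<open>
  The image of Lebesgue measure under T is translation invariant because T is onto.  Two translation
  invariant measures are proportional: with I the indicator of the unit ball, integrate
  G (T x) * I y over all (x, y), shift y by T x, exchange the integrals, shift x, and exchange again;
  this gives vol(ball) * integral of G (T x) = vol(ball) * integral of G, and the two balls have the
  same volume because T is norm preserving between spaces of equal dimension.
\<close>

lemma nn_integral_lborel_isometry:
  fixes T :: "'a::euclidean_space \<Rightarrow> 'b::euclidean_space"
  assumes T: "linear T" "\<And>x. norm (T x) = norm x" "surj T"
    and G[measurable]: "G \<in> borel_measurable borel"
  shows "(\<integral>\<^sup>+x. G (T x) \<partial>lborel) = (\<integral>\<^sup>+y. G y \<partial>lborel)"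
proof -
  let ?B = "ball 0 1 :: 'b set"
  let ?I = "indicator ?B :: 'b \<Rightarrow> ennreal"
  let ?l = "lborel :: 'a measure" and ?m = "lborel :: 'b measure"
  have B[measurable]: "?B \<in> sets borel" by simp
  have inj: "inj T"
    using T by (intro linear_injective_0[THEN iffD2] allI impI) (auto, metis norm_eq_zero)
  have dim: "DIM('a) = DIM('b)"
    using dim_image_eq[OF T(1), of UNIV] inj T(3) by simp
  have Tm[measurable]: "T \<in> borel_measurable borel"
    using T(1) by (intro borel_measurable_continuous_onI linear_continuous_on linear_conv_bounded_linear[THEN iffD1])
  have shift_b: "(\<integral>\<^sup>+y. f (y + a) \<partial>?m) = (\<integral>\<^sup>+y. f y \<partial>?m)"
    if "f \<in> borel_measurable borel" for f :: "'b \<Rightarrow> ennreal" and a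
    using nn_integral_lborel_affine[OF that, of 1 a] by (simp add: add.commute)
  have shift_a: "(\<integral>\<^sup>+y. f (y + a) \<partial>?l) = (\<integral>\<^sup>+y. f y \<partial>?l)"
    if "f \<in> borel_measurable borel" for f :: "'a \<Rightarrow> ennreal" and a
    using nn_integral_lborel_affine[OF that, of 1 a] by (simp add: add.commute)
  have refl_b: "(\<integral>\<^sup>+y. f (a - y) \<partial>?m) = (\<integral>\<^sup>+y. f y \<partial>?m)"
    if "f \<in> borel_measurable borel" for f :: "'b \<Rightarrow> ennreal" and a
    using nn_integral_lborel_affine[OF that, of "-1" a] by simp
  have "(\<integral>\<^sup>+x. G (T x) \<partial>?l) * emeasure ?m ?B = (\<integral>\<^sup>+x. \<integral>\<^sup>+y. G (T x) * ?I y \<partial>?m \<partial>?l)"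
    by (subst nn_integral_multc[symmetric]) (auto simp: nn_integral_cmult_indicator)
  also have "\<dots> = (\<integral>\<^sup>+x. \<integral>\<^sup>+y. G (T x) * ?I (y + T x) \<partial>?m \<partial>?l)"
  proof (rule nn_integral_cong)
    fix x
    show "(\<integral>\<^sup>+y. G (T x) * ?I y \<partial>?m) = (\<integral>\<^sup>+y. G (T x) * ?I (y + T x) \<partial>?m)"
      by (rule shift_b[of "\<lambda>y. G (T x) * ?I y" "T x", symmetric]) measurable
  qed
  also have "\<dots> = (\<integral>\<^sup>+y. \<integral>\<^sup>+x. G (T x) * ?I (y + T x) \<partial>?l \<partial>?m)"
    by (rule lborel_pair.Fubini'[symmetric]) measurable
  also have "\<dots> = (\<integral>\<^sup>+y. \<integral>\<^sup>+x. G (T x - y) * ?I (T x) \<partial>?l \<partial>?m)"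
  proof (rule nn_integral_cong)
    fix y
    obtain a where a: "y = T a" using T(3) by auto
    have "(\<integral>\<^sup>+x. G (T x) * ?I (y + T x) \<partial>?l) = (\<integral>\<^sup>+x. G (T (x + a) - y) * ?I (T (x + a)) \<partial>?l)"
      by (simp add: a linear_add[OF T(1)] add.commute)
    also have "\<dots> = (\<integral>\<^sup>+x. G (T x - y) * ?I (T x) \<partial>?l)"
      by (rule shift_a) measurable
    finally show "(\<integral>\<^sup>+x. G (T x) * ?I (y + T x) \<partial>?l) = (\<integral>\<^sup>+x. G (T x - y) * ?I (T x) \<partial>?l)" .
  qed
  also have "\<dots> = (\<integral>\<^sup>+x. \<integral>\<^sup>+y. G (T x - y) * ?I (T x) \<partial>?m \<partial>?l)"
    by (rule lborel_pair.Fubini') measurable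
  also have "\<dots> = (\<integral>\<^sup>+x. (\<integral>\<^sup>+y. G y \<partial>?m) * indicator (ball 0 1) x \<partial>?l)"
    using T(2) by (simp add: nn_integral_multc refl_b indicator_def)
  also have "\<dots> = (\<integral>\<^sup>+y. G y \<partial>?m) * emeasure ?l (ball 0 1)"
    by (simp add: nn_integral_cmult_indicator)
  finally have eq: "emeasure ?m ?B * (\<integral>\<^sup>+x. G (T x) \<partial>?l) = emeasure ?l (ball 0 1) * (\<integral>\<^sup>+y. G y \<partial>?m)"
    by (simp add: mult.commute)
  moreover have "emeasure ?m ?B = emeasure ?l (ball 0 1)"
    by (simp add: emeasure_ball dim)
  moreover have "emeasure ?l (ball 0 1) \<noteq> 0" "emeasure ?l (ball 0 1) \<noteq> \<infinity>"
    using unit_ball_vol_pos[of "real DIM('a)"] by (auto simp: emeasure_ball simp del: unit_ball_vol_pos)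
  ultimately show ?thesis
    by (metis ennreal_mult_cancel_left infinity_ennreal_def)
qed

text \<open>
  The substitution a = x / sqrt (1 + x^2), which is central projection of a line onto an arc.
  Over compact intervals it is the usual substitution rule; exhausting the real line by [-k, k]
  gives it for indicator functions, that is, as an identity of measures, and hence for every G.
\<close>

lemma nn_integral_unit_interval_eq_real_line:
  fixes G :: "real \<Rightarrow> ennreal"
  assumes [measurable]: "G \<in> borel_measurable borel"
  shows "(\<integral>\<^sup>+x. G (x / sqrt (1 + x\<^sup>2)) * ennreal ((1 + x\<^sup>2) powr (-3/2)) \<partial>lborel)
       = (\<integral>\<^sup>+a. G a * indicator {-1<..<1} a \<partial>lborel)"
proof -
  let ?g = "\<lambda>x::real. x / sqrt (1 + x\<^sup>2)"
  let ?g' = "\<lambda>x::real. (1 + x\<^sup>2) powr (-3/2)"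
  have pos: "1 + x\<^sup>2 > 0" for x :: real by (simp add: add_pos_nonneg)
  have der: "(?g has_real_derivative ?g' x) (at x)" for x
  proof -
    have s: "sqrt (1 + x\<^sup>2) > 0" using pos by simp
    have *: "(?g has_real_derivative ((1 * sqrt (1 + x\<^sup>2) - x * (x / sqrt (1 + x\<^sup>2))) / (sqrt (1 + x\<^sup>2) * sqrt (1 + x\<^sup>2)))) (at x)"
      using s pos[of x] by (auto intro!: derivative_eq_intros simp: divide_simps)
    have "(1 + x\<^sup>2) powr (-3/2) = 1 / (sqrt (1 + x\<^sup>2) * (1 + x\<^sup>2))"
      using powr_add[of "1 + x\<^sup>2" "-1/2" "-1"] pos[of x]
      by (simp add: powr_minus powr_half_sqrt divide_simps powr_minus_divide)
    moreover have "(1 * sqrt (1 + x\<^sup>2) - x * (x / sqrt (1 + x\<^sup>2))) / (sqrt (1 + x\<^sup>2) * sqrt (1 + x\<^sup>2)) = 1 / (sqrt (1 + x\<^sup>2) * (1 + x\<^sup>2))"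
      using s pos[of x] by (simp add: divide_simps power2_eq_square)
    ultimately show ?thesis using * by simp
  qed
  have cont: "continuous_on S ?g'" for S
    using pos by (intro continuous_intros) (auto simp: less_imp_neq[symmetric] add_nonneg_eq_0_iff)
  have bd: "?g x \<in> {-1<..<1}" for x
    using real_sqrt_less_mono[of "x\<^sup>2" "1 + x\<^sup>2"] pos[of x] by (simp add: divide_simps abs_less_iff)
  have interval: "(\<integral>\<^sup>+x. indicator A (?g x) * ennreal (?g' x) * indicator {-real k..real k} x \<partial>lborel)
      = (\<integral>\<^sup>+a. indicator A a * indicator {?g (-real k)..?g (real k)} a \<partial>lborel)"
    if [measurable]: "A \<in> sets borel" for A :: "real set" and k
    using nn_integral_substitution[of ?g "-real k" "real k" "indicator A" ?g', OF _ der cont]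
    by (simp add: set_borel_measurable_def ennreal_indicator ennreal_mult'' mult.assoc flip: ennreal_indicator)
  have sets_eq: "(\<integral>\<^sup>+x. indicator A (?g x) * ennreal (?g' x) \<partial>lborel) = (\<integral>\<^sup>+a. indicator A a * indicator {-1<..<1} a \<partial>lborel)"
    if [measurable]: "A \<in> sets borel" for A :: "real set"
  proof -
    have "incseq (\<lambda>k::nat. {-real k..real k})" by (auto simp: incseq_def)
    then have 1: "incseq (\<lambda>k x. indicator A (?g x) * ennreal (?g' x) * indicator {-real k..real k} x)"
      by (auto simp: incseq_def le_fun_def indicator_def)
    have gmono: "?g x \<le> ?g y" if "x \<le> y" for x y
      by (rule DERIV_nonneg_imp_nondecreasing[OF that]) (use der in fastforce)
    have 2: "incseq (\<lambda>(k::nat) a. indicator A a * indicator {?g (-real k)..?g (real k)} a :: ennreal)"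
    proof (rule incseq_SucI, rule le_funI)
      fix k :: nat and a
      show "indicator A a * indicator {?g (-real k)..?g (real k)} a \<le> (indicator A a * indicator {?g (-real (Suc k))..?g (real (Suc k))} a :: ennreal)"
        using gmono[of "-real (Suc k)" "-real k"] gmono[of "real k" "real (Suc k)"]
        by (auto simp: indicator_def simp del: of_nat_Suc)
    qed
    have s1: "(SUP k. indicator {-real k..real k} x) = (1::ennreal)" for x
    proof (rule antisym)
      show "(SUP k. indicator {-real k..real k} x) \<le> (1::ennreal)"
        by (rule SUP_least) (auto simp: indicator_def)
      obtain k :: nat where "\<bar>x\<bar> \<le> real k" using real_arch_simple by blast
      then have "indicator {-real k..real k} x = (1::ennreal)" by (auto simp: abs_le_iff)
      then show "(1::ennreal) \<le> (SUP k. indicator {-real k..real k} x)"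
        by (intro SUP_upper2[of k]) auto
    qed
    have s2: "(SUP k::nat. indicator {?g (-real k)..?g (real k)} a) = (indicator {-1<..<1} a::ennreal)" for a
    proof (rule antisym)
      show "(SUP k::nat. indicator {?g (-real k)..?g (real k)} a) \<le> (indicator {-1<..<1} a::ennreal)"
      proof (rule SUP_least)
        fix k :: nat
        have "-1 < ?g (-real k)" "?g (real k) < 1" using bd[of "-real k"] bd[of "real k"] by auto
        then have "{?g (-real k)..?g (real k)} \<subseteq> {-1<..<1}" by (auto simp del: minus_divide_left)
        then show "indicator {?g (-real k)..?g (real k)} a \<le> (indicator {-1<..<1} a::ennreal)"
          by (auto simp: indicator_def subset_iff simp del: minus_divide_left)
      qed
      show "(indicator {-1<..<1} a::ennreal) \<le> (SUP k::nat. indicator {?g (-real k)..?g (real k)} a)"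
      proof (cases "a \<in> {-1<..<1}")
        case True
        then have a: "a\<^sup>2 < 1" by (simp add: abs_square_less_1 abs_less_iff)
        define x where "x = a / sqrt (1 - a\<^sup>2)"
        have "1 + x\<^sup>2 = 1 / (1 - a\<^sup>2)" using a by (simp add: x_def power_divide divide_simps)
        then have gx: "?g x = a" using a by (simp add: x_def real_sqrt_divide)
        obtain k :: nat where "\<bar>x\<bar> \<le> real k" using real_arch_simple by blast
        then have "?g (-real k) \<le> a" "a \<le> ?g (real k)"
          using gmono[of "-real k" x] gmono[of x "real k"] gx by auto
        then have "indicator {?g (-real k)..?g (real k)} a = (1::ennreal)" by auto
        then show ?thesis using True by (intro SUP_upper2[of k]) auto
      qed simp
    qed
    have "(\<integral>\<^sup>+x. indicator A (?g x) * ennreal (?g' x) \<partial>lborel)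
       = (\<integral>\<^sup>+x. (SUP k. indicator A (?g x) * ennreal (?g' x) * indicator {-real k..real k} x) \<partial>lborel)"
      by (simp add: s1 flip: SUP_mult_left_ennreal)
    also have "\<dots> = (SUP k. \<integral>\<^sup>+x. indicator A (?g x) * ennreal (?g' x) * indicator {-real k..real k} x \<partial>lborel)"
      by (rule nn_integral_monotone_convergence_SUP[OF 1]) measurable
    also have "\<dots> = (SUP k::nat. \<integral>\<^sup>+a. indicator A a * indicator {?g (-real k)..?g (real k)} a \<partial>lborel)"
      by (simp only: interval[OF that])
    also have "\<dots> = (\<integral>\<^sup>+a. (SUP k::nat. indicator A a * indicator {?g (-real k)..?g (real k)} a) \<partial>lborel)"
      by (rule nn_integral_monotone_convergence_SUP[OF 2, symmetric]) measurable
    also have "\<dots> = (\<integral>\<^sup>+a. indicator A a * indicator {-1<..<1} a \<partial>lborel)"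
      by (simp only: s2 flip: SUP_mult_left_ennreal)
    finally show ?thesis .
  qed
  have "distr (density lborel (\<lambda>x. ennreal (?g' x))) borel ?g = density lborel (indicator {-1<..<1})"
  proof (rule measure_eqI)
    fix A assume "A \<in> sets (distr (density lborel (\<lambda>x. ennreal (?g' x))) borel ?g)"
    then have [measurable]: "A \<in> sets borel" by simp
    have "emeasure (distr (density lborel (\<lambda>x. ennreal (?g' x))) borel ?g) A
        = (\<integral>\<^sup>+x. indicator A x \<partial>distr (density lborel (\<lambda>x. ennreal (?g' x))) borel ?g)"
      by simp
    also have "\<dots> = (\<integral>\<^sup>+x. indicator A (?g x) * ennreal (?g' x) \<partial>lborel)"
      by (subst nn_integral_distr) (simp_all add: nn_integral_density mult.commute)
    also have "\<dots> = emeasure (density lborel (indicator {-1<..<1})) A"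
      using sets_eq[of A] by (simp add: emeasure_density mult.commute)
    finally show "emeasure (distr (density lborel (\<lambda>x. ennreal (?g' x))) borel ?g) A
        = emeasure (density lborel (indicator {-1<..<1})) A" .
  qed simp
  then have "(\<integral>\<^sup>+a. G a \<partial>distr (density lborel (\<lambda>x. ennreal (?g' x))) borel ?g) = (\<integral>\<^sup>+a. G a \<partial>density lborel (indicator {-1<..<1}))"
    by simp
  then show ?thesis
    by (simp add: nn_integral_distr nn_integral_density mult.commute)
qed

section \<open>Beta integrals\<close>

lemma one_plus_square_pos: "0 < 1 + x\<^sup>2" for x :: real
  by (simp add: add_pos_nonneg)

lemma nn_integral_Beta:
  assumes "a > 0" "b > 0"
  shows "(\<integral>\<^sup>+t. ennreal (t powr (a - 1) * (1 - t) powr (b - 1)) * indicator {0<..<1} t \<partial>lborel) = ennreal (Beta a b)"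
proof -
  have "(\<integral>\<^sup>+t. ennreal (t powr (a - 1) * (1 - t) powr (b - 1)) * indicator {0..1} t \<partial>lborel) = ennreal (Beta a b)"
    by (rule nn_integral_has_integral_lebesgue'[OF _ has_integral_Beta_real[OF assms]]) auto
  moreover have "ennreal (t powr (a - 1) * (1 - t) powr (b - 1)) * indicator {0..1} t
      = ennreal (t powr (a - 1) * (1 - t) powr (b - 1)) * indicator {0<..<1} t" for t
    by (cases "t = 0 \<or> t = 1") (auto simp: indicator_def)
  ultimately show ?thesis by simp
qed

text \<open>
  With t = 2 s - 1 one has 1 - t^2 = 4 s (1 - s), so this is a beta integral.
\<close>

lemma nn_integral_one_minus_square_powr:
  assumes "q > -1"
  shows "(\<integral>\<^sup>+t. ennreal ((1 - t\<^sup>2) powr q) * indicator {-1<..<1} t \<partial>lborel)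
       = ennreal (2 * 4 powr q * Beta (q + 1) (q + 1))"
proof -
  have "(\<integral>\<^sup>+t. ennreal ((1 - t\<^sup>2) powr q) * indicator {-1<..<1} t \<partial>lborel)
      = ennreal 2 * (\<integral>\<^sup>+s. ennreal ((1 - (-1 + 2 * s)\<^sup>2) powr q) * indicator {-1<..<1} (-1 + 2 * s) \<partial>lborel)"
    by (subst nn_integral_real_affine[where c = 2 and t = "-1"]) auto
  also have "(\<lambda>s. ennreal ((1 - (-1 + 2 * s)\<^sup>2) powr q) * indicator {-1<..<1} (-1 + 2 * s))
      = (\<lambda>s::real. ennreal (4 powr q) * (ennreal (s powr (q + 1 - 1) * (1 - s) powr (q + 1 - 1)) * indicator {0<..<1} s))"
  proof
    fix s :: real
    show "ennreal ((1 - (-1 + 2 * s)\<^sup>2) powr q) * indicator {-1<..<1} (-1 + 2 * s)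
       = ennreal (4 powr q) * (ennreal (s powr (q + 1 - 1) * (1 - s) powr (q + 1 - 1)) * indicator {0<..<1} s)"
    proof (cases "s \<in> {0<..<1}")
      case True
      have "1 - (-1 + 2 * s)\<^sup>2 = 4 * (s * (1 - s))" by (simp add: power2_eq_square algebra_simps)
      then have "(1 - (-1 + 2 * s)\<^sup>2) powr q = 4 powr q * (s powr q * (1 - s) powr q)"
        using True by (simp add: powr_mult)
      then show ?thesis using True by (simp add: ennreal_mult')
    qed (auto simp: indicator_def)
  qed
  also have "ennreal 2 * (\<integral>\<^sup>+s. ennreal (4 powr q) * (ennreal (s powr (q + 1 - 1) * (1 - s) powr (q + 1 - 1)) * indicator {0<..<1} s) \<partial>lborel)
     = ennreal 2 * (ennreal (4 powr q) * ennreal (Beta (q + 1) (q + 1)))"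
    using assms nn_integral_Beta[of "q + 1" "q + 1"] by (subst nn_integral_cmult) auto
  also have "\<dots> = ennreal (2 * 4 powr q * Beta (q + 1) (q + 1))"
    by (simp add: ennreal_mult' mult.assoc)
  finally show ?thesis .
qed

lemma nn_integral_one_plus_square_powr:
  assumes "m > 1/2"
  shows "(\<integral>\<^sup>+x. ennreal ((1 + x\<^sup>2) powr (-m)) \<partial>lborel)
       = ennreal (2 * 4 powr (m - 3/2) * Beta (m - 1/2) (m - 1/2))"
proof -
  have "(\<integral>\<^sup>+x. ennreal ((1 + x\<^sup>2) powr (-m)) \<partial>lborel)
     = (\<integral>\<^sup>+x. ennreal ((1 - (x / sqrt (1 + x\<^sup>2))\<^sup>2) powr (m - 3/2)) * ennreal ((1 + x\<^sup>2) powr (-3/2)) \<partial>lborel)"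
  proof (rule nn_integral_cong)
    fix x :: real
    have p: "1 + x\<^sup>2 > 0" by (rule one_plus_square_pos)
    have "1 - (x / sqrt (1 + x\<^sup>2))\<^sup>2 = (1 + x\<^sup>2) powr (-1)"
      using p by (simp add: power_divide powr_minus_divide divide_simps)
    then have "(1 - (x / sqrt (1 + x\<^sup>2))\<^sup>2) powr (m - 3/2) = (1 + x\<^sup>2) powr (-1 * (m - 3/2))"
      by (simp only: powr_powr)
    then have "(1 - (x / sqrt (1 + x\<^sup>2))\<^sup>2) powr (m - 3/2) * (1 + x\<^sup>2) powr (-3/2) = (1 + x\<^sup>2) powr (-m)"
      unfolding powr_powr by (simp flip: powr_add)
    then show "ennreal ((1 + x\<^sup>2) powr (-m)) = ennreal ((1 - (x / sqrt (1 + x\<^sup>2))\<^sup>2) powr (m - 3/2)) * ennreal ((1 + x\<^sup>2) powr (-3/2))"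
      by (simp flip: ennreal_mult')
  qed
  also have "\<dots> = (\<integral>\<^sup>+a. ennreal ((1 - a\<^sup>2) powr (m - 3/2)) * indicator {-1<..<1} a \<partial>lborel)"
    by (rule nn_integral_unit_interval_eq_real_line[of "\<lambda>a. ennreal ((1 - a\<^sup>2) powr (m - 3/2))"]) measurable
  finally show ?thesis
    using nn_integral_one_minus_square_powr[of "m - 3/2"] assms by simp
qed

section \<open>Integrals over a half plane and over a disc\<close>

text \<open>
  In the coordinates (x, slope) the distance to the origin is x * sqrt (1 + slope^2), so that for fixed
  slope a further scaling of x separates the variables.  This replaces polar coordinates by
  scalings of a single variable.
\<close>

lemma nn_integral_half_plane_slopes:
  fixes F :: "real \<Rightarrow> real \<Rightarrow> ennreal"
  assumes [measurable]: "case_prod F \<in> borel_measurable (lborel \<Otimes>\<^sub>M lborel)"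
  shows "(\<integral>\<^sup>+x. \<integral>\<^sup>+y. F x y * indicator {0<..} x \<partial>lborel \<partial>lborel)
       = (\<integral>\<^sup>+\<tau>. \<integral>\<^sup>+x. F x (x * \<tau>) * ennreal x * indicator {0<..} x \<partial>lborel \<partial>lborel)"
proof -
  have "(\<integral>\<^sup>+x. \<integral>\<^sup>+y. F x y * indicator {0<..} x \<partial>lborel \<partial>lborel)
      = (\<integral>\<^sup>+x. \<integral>\<^sup>+\<tau>. F x (x * \<tau>) * ennreal x * indicator {0<..} x \<partial>lborel \<partial>lborel)"
  proof (rule nn_integral_cong)
    fix x :: real
    show "(\<integral>\<^sup>+y. F x y * indicator {0<..} x \<partial>lborel) = (\<integral>\<^sup>+\<tau>. F x (x * \<tau>) * ennreal x * indicator {0<..} x \<partial>lborel)"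
    proof (cases "x > 0")
      case True
      have m: "F x \<in> borel_measurable borel"
        using measurable_Pair2'[of x lborel lborel] measurable_compose[OF measurable_Pair2' assms, of x] by simp
      then have m': "(\<lambda>\<tau>. F x (x * \<tau>)) \<in> borel_measurable borel" by measurable
      have "(\<integral>\<^sup>+y. F x y \<partial>lborel) = ennreal \<bar>x\<bar> * (\<integral>\<^sup>+\<tau>. F x (0 + x * \<tau>) \<partial>lborel)"
        using True by (intro nn_integral_real_affine m) auto
      then show ?thesis using True m' by (simp add: nn_integral_cmult mult.commute)
    qed auto
  qed
  also have "\<dots> = (\<integral>\<^sup>+\<tau>. \<integral>\<^sup>+x. F x (x * \<tau>) * ennreal x * indicator {0<..} x \<partial>lborel \<partial>lborel)"
    by (rule lborel_pair.Fubini'[symmetric]) measurable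
  finally show ?thesis .
qed

text \<open>
  The angular integral of cos^k over the right half circle appears on the right-hand side as an
  integral over the slope.
\<close>

lemma nn_integral_half_plane_polar:
  fixes G :: "real \<Rightarrow> ennreal"
  assumes [measurable]: "G \<in> borel_measurable borel"
  shows "(\<integral>\<^sup>+x. \<integral>\<^sup>+y. G (sqrt (x\<^sup>2 + y\<^sup>2)) * ennreal (x ^ k) * indicator {0<..} x \<partial>lborel \<partial>lborel)
       = (\<integral>\<^sup>+\<tau>. ennreal ((1 + \<tau>\<^sup>2) powr (-(real k + 2) / 2)) \<partial>lborel)
         * (\<integral>\<^sup>+\<rho>. G \<rho> * ennreal (\<rho> ^ (k + 1)) * indicator {0<..} \<rho> \<partial>lborel)"
proof -
  have "(\<integral>\<^sup>+x. \<integral>\<^sup>+y. G (sqrt (x\<^sup>2 + y\<^sup>2)) * ennreal (x ^ k) * indicator {0<..} x \<partial>lborel \<partial>lborel)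
      = (\<integral>\<^sup>+\<tau>. \<integral>\<^sup>+x. G (sqrt (x\<^sup>2 + (x * \<tau>)\<^sup>2)) * ennreal (x ^ k) * ennreal x * indicator {0<..} x \<partial>lborel \<partial>lborel)"
    by (rule nn_integral_half_plane_slopes[of "\<lambda>x y. G (sqrt (x\<^sup>2 + y\<^sup>2)) * ennreal (x ^ k)"]) measurable
  also have "\<dots> = (\<integral>\<^sup>+\<tau>. ennreal ((1 + \<tau>\<^sup>2) powr (-(real k + 2) / 2))
         * (\<integral>\<^sup>+\<rho>. G \<rho> * ennreal (\<rho> ^ (k + 1)) * indicator {0<..} \<rho> \<partial>lborel) \<partial>lborel)"
  proof (rule nn_integral_cong)
    fix \<tau> :: real
    define c where "c = (1 + \<tau>\<^sup>2) powr (-1/2)"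
    have c: "c > 0" using one_plus_square_pos[of \<tau>] by (simp add: c_def)
    have c2: "c\<^sup>2 * (1 + \<tau>\<^sup>2) = 1"
      using one_plus_square_pos[of \<tau>] by (simp add: c_def power2_eq_square powr_minus_divide flip: powr_add)
    have ck: "c ^ (k + 2) = (1 + \<tau>\<^sup>2) powr (-(real k + 2) / 2)"
    proof -
      have "c ^ (k + 2) = c powr real (k + 2)" using c by (rule powr_realpow[symmetric])
      also have "\<dots> = (1 + \<tau>\<^sup>2) powr (-1/2 * real (k + 2))" unfolding c_def by (rule powr_powr)
      also have "-1/2 * real (k + 2) = -(real k + 2) / 2" by (simp only: of_nat_add of_nat_numeral)
      finally show ?thesis .
    qed
    have "(\<integral>\<^sup>+x. G (sqrt (x\<^sup>2 + (x * \<tau>)\<^sup>2)) * ennreal (x ^ k) * ennreal x * indicator {0<..} x \<partial>lborel)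
       = ennreal \<bar>c\<bar> * (\<integral>\<^sup>+\<rho>. G (sqrt ((0 + c * \<rho>)\<^sup>2 + ((0 + c * \<rho>) * \<tau>)\<^sup>2)) * ennreal ((0 + c * \<rho>) ^ k) * ennreal (0 + c * \<rho>) * indicator {0<..} (0 + c * \<rho>) \<partial>lborel)"
      using c by (intro nn_integral_real_affine) auto
    also have "\<dots> = ennreal c * (\<integral>\<^sup>+\<rho>. ennreal (c ^ (k + 1)) * (G \<rho> * ennreal (\<rho> ^ (k + 1)) * indicator {0<..} \<rho>) \<partial>lborel)"
    proof -
      have "G (sqrt ((0 + c * \<rho>)\<^sup>2 + ((0 + c * \<rho>) * \<tau>)\<^sup>2)) * ennreal ((0 + c * \<rho>) ^ k) * ennreal (0 + c * \<rho>) * indicator {0<..} (0 + c * \<rho>)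
         = ennreal (c ^ (k + 1)) * (G \<rho> * ennreal (\<rho> ^ (k + 1)) * indicator {0<..} \<rho>)" for \<rho>
      proof (cases "\<rho> > 0")
        case True
        have "(0 + c * \<rho>)\<^sup>2 + ((0 + c * \<rho>) * \<tau>)\<^sup>2 = (c\<^sup>2 * (1 + \<tau>\<^sup>2)) * \<rho>\<^sup>2" by (simp add: power_mult_distrib algebra_simps)
        then have "sqrt ((0 + c * \<rho>)\<^sup>2 + ((0 + c * \<rho>) * \<tau>)\<^sup>2) = \<rho>" using True by (simp add: c2)
        moreover have "ennreal ((0 + c * \<rho>) ^ k) * ennreal (0 + c * \<rho>) = ennreal (c ^ (k + 1)) * ennreal (\<rho> ^ (k + 1))"
          using True c by (simp add: power_mult_distrib mult_ac flip: ennreal_mult')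
        ultimately show ?thesis using True c by (simp add: mult_ac)
      qed (use c in \<open>auto simp: zero_less_mult_iff\<close>)
      then show ?thesis using c by simp
    qed
    also have "\<dots> = ennreal (c ^ (k + 2)) * (\<integral>\<^sup>+\<rho>. G \<rho> * ennreal (\<rho> ^ (k + 1)) * indicator {0<..} \<rho> \<partial>lborel)"
      using c by (subst nn_integral_cmult) (auto simp: mult_ac ennreal_mult)
    finally show "(\<integral>\<^sup>+x. G (sqrt (x\<^sup>2 + (x * \<tau>)\<^sup>2)) * ennreal (x ^ k) * ennreal x * indicator {0<..} x \<partial>lborel)
      = ennreal ((1 + \<tau>\<^sup>2) powr (-(real k + 2) / 2)) * (\<integral>\<^sup>+\<rho>. G \<rho> * ennreal (\<rho> ^ (k + 1)) * indicator {0<..} \<rho> \<partial>lborel)"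
      by (simp only: ck)
  qed
  also have "\<dots> = (\<integral>\<^sup>+\<tau>. ennreal ((1 + \<tau>\<^sup>2) powr (-(real k + 2) / 2)) \<partial>lborel)
         * (\<integral>\<^sup>+\<rho>. G \<rho> * ennreal (\<rho> ^ (k + 1)) * indicator {0<..} \<rho> \<partial>lborel)"
    by (rule nn_integral_multc) measurable
  finally show ?thesis .
qed

lemma Gamma_duplication_real:
  assumes "x > 0"
  shows "Gamma x * Gamma (x + 1/2) = exp ((1 - 2 * x) * ln 2) * sqrt pi * Gamma (2 * x)"
proof -
  let ?z = "complex_of_real x"
  have "?z \<notin> \<int>\<^sub>\<le>\<^sub>0" "?z + 1/2 \<notin> \<int>\<^sub>\<le>\<^sub>0"
    using assms by (auto elim!: nonpos_Ints_cases simp: complex_eq_iff)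
  then have dup: "Gamma ?z * Gamma (?z + 1/2) = exp ((1 - 2 * ?z) * of_real (ln 2)) * of_real (sqrt pi) * Gamma (2 * ?z)"
    by (rule Gamma_legendre_duplication)
  have 1: "?z + 1/2 = of_real (x + 1/2)" and 2: "2 * ?z = of_real (2 * x)"
    and 3: "(1 - 2 * ?z) * of_real (ln 2) = of_real ((1 - 2 * x) * ln 2)" by simp_all
  from dup[unfolded 3] show ?thesis
    unfolding 1 2 Gamma_complex_of_real exp_of_real unfolding of_real_mult[symmetric] of_real_eq_iff .
qed

text \<open>
  The domain is the disc of radius 1 about (1, 0), seen from its boundary point 0.  Along the ray of
  slope tau the disc is met for 0 < x < 2 / (1 + tau^2), and x = s * 2 / (1 + tau^2) splits the
  integrand into a power of 1 + tau^2 and a beta density in s.  The duplication formula combines the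
  Gamma values of the two factors.
\<close>

lemma nn_integral_disc_powr:
  fixes g :: real and k :: nat
  assumes "g \<ge> 0"
  shows "(\<integral>\<^sup>+x. \<integral>\<^sup>+y. ennreal (sqrt (x\<^sup>2 + y\<^sup>2) powr g * (2 * x - (x\<^sup>2 + y\<^sup>2)) ^ k)
                  * indicator {0<..} (2 * x - (x\<^sup>2 + y\<^sup>2)) \<partial>lborel \<partial>lborel)
       = ennreal (pi * Gamma (g + real k + 2) * Gamma (real k + 1) / (Gamma (g / 2 + real k + 2))\<^sup>2)"
proof -
  define m where "m = g / 2 + real k + 2"
  define \<kappa> where "\<kappa> = Beta (g + real k + 2) (real k + 1)"
  have kap: "\<kappa> \<ge> 0" using assms by (auto simp: \<kappa>_def Beta_def intro!: divide_nonneg_nonneg mult_nonneg_nonneg)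
  let ?F = "\<lambda>x y. ennreal (sqrt (x\<^sup>2 + y\<^sup>2) powr g * (2 * x - (x\<^sup>2 + y\<^sup>2)) ^ k) * indicator {0<..} (2 * x - (x\<^sup>2 + y\<^sup>2))"
  have "(\<integral>\<^sup>+x. \<integral>\<^sup>+y. ?F x y \<partial>lborel \<partial>lborel) = (\<integral>\<^sup>+x. \<integral>\<^sup>+y. ?F x y * indicator {0<..} x \<partial>lborel \<partial>lborel)"
  proof -
    have "?F x y = ?F x y * indicator {0<..} x" for x y :: real
    proof (cases "x > 0")
      case False
      then have "\<not> x\<^sup>2 + y\<^sup>2 < 2 * x" using sum_power2_ge_zero[of x y] by linarith
      then show ?thesis by simp
    qed simp
    then show ?thesis by presburger
  qed
  also have "\<dots> = (\<integral>\<^sup>+\<tau>. \<integral>\<^sup>+x. ?F x (x * \<tau>) * ennreal x * indicator {0<..} x \<partial>lborel \<partial>lborel)"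
    by (rule nn_integral_half_plane_slopes[of ?F]) measurable
  also have "\<dots> = (\<integral>\<^sup>+\<tau>. ennreal (2 powr (g + 2 * real k + 2) * (1 + \<tau>\<^sup>2) powr (-m)) * ennreal \<kappa> \<partial>lborel)"
  proof (rule nn_integral_cong)
    fix \<tau> :: real
    define R where "R = 2 / (1 + \<tau>\<^sup>2)"
    have R: "R > 0" "R * (1 + \<tau>\<^sup>2) = 2" using one_plus_square_pos[of \<tau>] by (auto simp: R_def divide_simps)
    have Rx: "(R * s)\<^sup>2 + (R * s * \<tau>)\<^sup>2 = 2 * R * s\<^sup>2" for s
    proof -
      have "(R * s)\<^sup>2 + (R * s * \<tau>)\<^sup>2 = R * s\<^sup>2 * (R * (1 + \<tau>\<^sup>2))" by (simp add: power2_eq_square algebra_simps)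
      then show ?thesis by (simp add: R(2))
    qed
    have "(\<integral>\<^sup>+x. ?F x (x * \<tau>) * ennreal x * indicator {0<..} x \<partial>lborel)
       = ennreal \<bar>R\<bar> * (\<integral>\<^sup>+s. ?F (0 + R * s) ((0 + R * s) * \<tau>) * ennreal (0 + R * s) * indicator {0<..} (0 + R * s) \<partial>lborel)"
      using R by (intro nn_integral_real_affine) auto
    also have "(\<lambda>s. ?F (0 + R * s) ((0 + R * s) * \<tau>) * ennreal (0 + R * s) * indicator {0<..} (0 + R * s))
        = (\<lambda>s. ennreal ((2 * R) powr (g / 2 + real k) * R) * (ennreal (s powr (g + real k + 2 - 1) * (1 - s) powr (real k + 1 - 1)) * indicator {0<..<1} s))"
    proof
      fix s :: real
      show "?F (0 + R * s) ((0 + R * s) * \<tau>) * ennreal (0 + R * s) * indicator {0<..} (0 + R * s)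
        = ennreal ((2 * R) powr (g / 2 + real k) * R) * (ennreal (s powr (g + real k + 2 - 1) * (1 - s) powr (real k + 1 - 1)) * indicator {0<..<1} s)"
      proof (cases "s \<in> {0<..<1}")
        case True
        then have s: "0 < s" "s < 1" by auto
        have less: "2 * R * s\<^sup>2 < 2 * (R * s)" using s R by (simp add: power2_eq_square)
        have "sqrt (2 * R * s\<^sup>2) = (2 * R) powr (1/2) * s" using s R by (simp add: real_sqrt_mult powr_half_sqrt)
        then have 1: "sqrt (2 * R * s\<^sup>2) powr g = (2 * R) powr (g / 2) * s powr g"
          using s R by (simp add: powr_mult powr_powr)
        have "2 * (R * s) - 2 * R * s\<^sup>2 = (2 * R) * s * (1 - s)" by (simp add: power2_eq_square algebra_simps)
        then have 2: "(2 * (R * s) - 2 * R * s\<^sup>2) ^ k = (2 * R) powr real k * s powr real k * (1 - s) powr real k"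
          using s R by (simp add: power_mult_distrib powr_realpow)
        have "sqrt (2 * R * s\<^sup>2) powr g * (2 * (R * s) - 2 * R * s\<^sup>2) ^ k * (R * s)
            = ((2 * R) powr (g / 2) * (2 * R) powr real k * R) * ((s powr g * s powr real k * s powr 1) * (1 - s) powr real k)"
          unfolding 1 2 using s by (simp add: mult_ac)
        also have "\<dots> = ((2 * R) powr (g / 2 + real k) * R) * (s powr (g + real k + 2 - 1) * (1 - s) powr (real k + 1 - 1))"
          by (simp only: powr_add[symmetric]) (simp add: algebra_simps)
        finally have 3: "sqrt (2 * R * s\<^sup>2) powr g * (2 * (R * s) - 2 * R * s\<^sup>2) ^ k * (R * s) = \<dots>" .
        have "?F (0 + R * s) ((0 + R * s) * \<tau>) * ennreal (0 + R * s) * indicator {0<..} (0 + R * s)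
           = ennreal (sqrt (2 * R * s\<^sup>2) powr g * (2 * (R * s) - 2 * R * s\<^sup>2) ^ k) * ennreal (R * s)"
          using s R less by (simp add: Rx)
        also have "\<dots> = ennreal (sqrt (2 * R * s\<^sup>2) powr g * (2 * (R * s) - 2 * R * s\<^sup>2) ^ k * (R * s))"
          using s R by (subst ennreal_mult'') auto
        also have "\<dots> = ennreal ((2 * R) powr (g / 2 + real k) * R) * ennreal (s powr (g + real k + 2 - 1) * (1 - s) powr (real k + 1 - 1))"
          unfolding 3 using R by (intro ennreal_mult') auto
        finally show ?thesis using True by simp
      next
        case False
        have "s \<le> 0 \<or> \<not> 2 * R * s\<^sup>2 < 2 * (R * s)"
          using False R mult_right_mono[of 1 s s] by (auto simp: power2_eq_square not_less)
        then show ?thesis using False R unfolding add_0 Rx by (auto simp: indicator_def zero_less_mult_iff)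
      qed
    qed
    also have "ennreal \<bar>R\<bar> * (\<integral>\<^sup>+s. ennreal ((2 * R) powr (g / 2 + real k) * R) * (ennreal (s powr (g + real k + 2 - 1) * (1 - s) powr (real k + 1 - 1)) * indicator {0<..<1} s) \<partial>lborel)
       = ennreal R * (ennreal ((2 * R) powr (g / 2 + real k) * R) * ennreal \<kappa>)"
      using R assms by (subst nn_integral_cmult, measurable) (simp only: \<kappa>_def nn_integral_Beta, simp)
    also have "\<dots> = ennreal (R * ((2 * R) powr (g / 2 + real k) * R)) * ennreal \<kappa>"
      using R by (simp add: ennreal_mult' mult.assoc)
    also have "R * ((2 * R) powr (g / 2 + real k) * R) = 2 powr (g + 2 * real k + 2) * (1 + \<tau>\<^sup>2) powr (-m)"
    proof -
      define z where "z = 1 + \<tau>\<^sup>2"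
      have z: "z > 0" using one_plus_square_pos by (simp add: z_def)
      have "R = 2 powr 1 * z powr (-1)" using z by (simp add: R_def z_def powr_minus_divide)
      moreover have "(2 * R) powr (g / 2 + real k) = 2 powr (2 * (g / 2 + real k)) * z powr (-1 * (g / 2 + real k))"
      proof -
        have "2 * R = 2 powr 2 * z powr (-1)" using z by (simp add: R_def z_def powr_minus_divide)
        then have "(2 * R) powr (g / 2 + real k) = (2 powr 2) powr (g / 2 + real k) * (z powr (-1)) powr (g / 2 + real k)"
          by (simp only: powr_mult powr_ge_zero)
        then show ?thesis by (simp only: powr_powr)
      qed
      ultimately have "R * ((2 * R) powr (g / 2 + real k) * R)
          = (2 powr 1 * 2 powr (2 * (g / 2 + real k)) * 2 powr 1) * (z powr (-1) * z powr (-1 * (g / 2 + real k)) * z powr (-1))"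
        by (simp only: mult_ac)
      also have "\<dots> = 2 powr (g + 2 * real k + 2) * z powr (-m)"
        unfolding powr_add[symmetric]
        by (rule arg_cong2[where f = "\<lambda>a b. 2 powr a * z powr b"]) (simp_all add: m_def)
      finally show ?thesis by (simp add: z_def)
    qed
    finally show "(\<integral>\<^sup>+x. ?F x (x * \<tau>) * ennreal x * indicator {0<..} x \<partial>lborel)
       = ennreal (2 powr (g + 2 * real k + 2) * (1 + \<tau>\<^sup>2) powr (-m)) * ennreal \<kappa>" .
  qed
  also have "\<dots> = (\<integral>\<^sup>+\<tau>. ennreal (2 powr (g + 2 * real k + 2)) * ennreal ((1 + \<tau>\<^sup>2) powr (-m)) \<partial>lborel) * ennreal \<kappa>"
    by (subst nn_integral_multc) (auto simp: ennreal_mult')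
  also have "\<dots> = ennreal (2 powr (g + 2 * real k + 2)) * ennreal (2 * 4 powr (m - 3/2) * Beta (m - 1/2) (m - 1/2)) * ennreal \<kappa>"
  proof -
    have "m > 1/2" using assms by (simp add: m_def)
    from nn_integral_one_plus_square_powr[OF this] show ?thesis by (subst nn_integral_cmult) simp_all
  qed
  also have "\<dots> = ennreal (2 powr (g + 2 * real k + 2) * (2 * 4 powr (m - 3/2) * Beta (m - 1/2) (m - 1/2)) * \<kappa>)"
    using kap by (simp add: ennreal_mult' ennreal_mult'')
  also have "2 powr (g + 2 * real k + 2) * (2 * 4 powr (m - 3/2) * Beta (m - 1/2) (m - 1/2)) * \<kappa>
      = pi * Gamma (g + real k + 2) * Gamma (real k + 1) / (Gamma m)\<^sup>2"
  proof -
    define N where "N = 2 powr (2 * m - 2)"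
    define A where "A = Gamma (m - 1/2)"
    define C where "C = Gamma m"
    define D where "D = Gamma (2 * m - 1)"
    have m: "m - 1/2 > 0" "m \<ge> 2" using assms by (auto simp: m_def)
    have pos: "A > 0" "C > 0" "D > 0" "N > 0" using m by (auto simp: A_def C_def D_def N_def intro!: Gamma_real_pos)
    have "Gamma (m - 1/2) * Gamma (m - 1/2 + 1/2) = exp ((1 - 2*(m - 1/2)) * ln 2) * sqrt pi * Gamma (2*(m - 1/2))"
      using m by (intro Gamma_duplication_real) auto
    moreover have "exp ((1 - 2*(m - 1/2)) * ln 2) = 1 / N"
      by (simp add: N_def powr_def field_simps exp_minus flip: exp_add exp_diff)
    ultimately have "A * C = 1 / N * sqrt pi * D"
      by (simp add: A_def C_def D_def algebra_simps)
    then have "D * sqrt pi = A * C * N" using pos by (simp add: field_simps)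
    then have "(D * sqrt pi)\<^sup>2 = (A * C * N)\<^sup>2" by simp
    then have dup: "D\<^sup>2 * pi = A\<^sup>2 * C\<^sup>2 * N\<^sup>2" by (simp add: power_mult_distrib)
    have N1: "2 powr (g + 2 * real k + 2) = N" by (simp add: N_def m_def algebra_simps)
    have "2 * 4 powr (m - 3/2) = (2::real) powr (2 * m - 2)"
    proof -
      have "(4::real) powr (m - 3/2) = 2 powr (2 * (m - 3/2))"
        using powr_powr[of "2::real" 2 "m - 3/2"] by simp
      then have "2 * (4::real) powr (m - 3/2) = 2 powr (1 + 2 * (m - 3/2))" by (simp only: powr_add) simp
      then show ?thesis by (simp add: algebra_simps)
    qed
    then have N2: "2 * 4 powr (m - 3/2) = N" by (simp add: N_def)
    have B1: "Beta (m - 1/2) (m - 1/2) = A\<^sup>2 / D"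
      by (simp add: Beta_def A_def D_def power2_eq_square)
    have B2: "\<kappa> = Gamma (g + real k + 2) * Gamma (real k + 1) / D"
      by (simp add: Beta_def \<kappa>_def D_def m_def algebra_simps)
    have "2 powr (g + 2 * real k + 2) * (2 * 4 powr (m - 3/2) * Beta (m - 1/2) (m - 1/2)) * \<kappa>
       = (N\<^sup>2 * A\<^sup>2 / D\<^sup>2) * Gamma (g + real k + 2) * Gamma (real k + 1)"
      unfolding N1 N2 B1 B2 by (simp add: power2_eq_square)
    also have "N\<^sup>2 * A\<^sup>2 / D\<^sup>2 = pi / C\<^sup>2" using dup pos by (simp add: field_simps)
    finally show ?thesis by (simp add: C_def)
  qed
  finally show ?thesis by (simp add: m_def)
qed

section \<open>From the sphere to the disc\<close>

text \<open>
  Projecting the plane centrally onto the open unit disc, (p, q) to (p, q) / sqrt (1 + p^2 + q^2),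
  one coordinate at a time: the scaling q = sqrt (1 + p^2) t turns 1 + p^2 + q^2 into the product
  (1 + p^2) (1 + t^2), after which both t and p are handled by the one-dimensional projection.
\<close>

lemma nn_integral_central_projection:
  fixes H :: "real \<times> real \<Rightarrow> ennreal" and k :: nat
  assumes [measurable]: "H \<in> borel_measurable (borel \<Otimes>\<^sub>M borel)"
  shows "(\<integral>\<^sup>+p. \<integral>\<^sup>+q. H (p / sqrt (1 + p\<^sup>2 + q\<^sup>2), q / sqrt (1 + p\<^sup>2 + q\<^sup>2))
                    * ennreal ((1 + p\<^sup>2 + q\<^sup>2) powr (-(real k + 2))) \<partial>lborel \<partial>lborel)
       = (\<integral>\<^sup>+a. \<integral>\<^sup>+b. H (a, b) * ennreal ((1 - (a\<^sup>2 + b\<^sup>2)) ^ k) * indicator {0<..} (1 - (a\<^sup>2 + b\<^sup>2)) \<partial>lborel \<partial>lborel)"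
proof -
  let ?s = "\<lambda>x::real. sqrt (1 + x\<^sup>2)"
  let ?I = "indicator {-1<..<1::real} :: real \<Rightarrow> ennreal"
  define G where "G \<alpha> = (\<integral>\<^sup>+u. H (\<alpha> * sqrt (1 - u\<^sup>2), u) * ennreal ((1 - u\<^sup>2) powr (real k + 1/2)) * ?I u \<partial>lborel)" for \<alpha>
  have "G \<in> borel_measurable lborel"
    unfolding G_def by measurable
  then have Gm[measurable]: "G \<in> borel_measurable borel" by simp
  have "(\<integral>\<^sup>+p. \<integral>\<^sup>+q. H (p / sqrt (1 + p\<^sup>2 + q\<^sup>2), q / sqrt (1 + p\<^sup>2 + q\<^sup>2))
                    * ennreal ((1 + p\<^sup>2 + q\<^sup>2) powr (-(real k + 2))) \<partial>lborel \<partial>lborel)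
     = (\<integral>\<^sup>+p. G (p / ?s p) * ennreal ((1 - (p / ?s p)\<^sup>2) ^ k) * ennreal ((1 + p\<^sup>2) powr (-3/2)) \<partial>lborel)"
  proof (rule nn_integral_cong)
    fix p :: real
    have P: "1 + p\<^sup>2 > 0" by (rule one_plus_square_pos)
    define \<alpha> where "\<alpha> = p / ?s p"
    have "(\<integral>\<^sup>+q. H (p / sqrt (1 + p\<^sup>2 + q\<^sup>2), q / sqrt (1 + p\<^sup>2 + q\<^sup>2)) * ennreal ((1 + p\<^sup>2 + q\<^sup>2) powr (-(real k + 2))) \<partial>lborel)
       = ennreal \<bar>?s p\<bar> * (\<integral>\<^sup>+t. H (p / sqrt (1 + p\<^sup>2 + (0 + ?s p * t)\<^sup>2), (0 + ?s p * t) / sqrt (1 + p\<^sup>2 + (0 + ?s p * t)\<^sup>2)) * ennreal ((1 + p\<^sup>2 + (0 + ?s p * t)\<^sup>2) powr (-(real k + 2))) \<partial>lborel)"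
      by (rule nn_integral_real_affine) (measurable, use P in simp)
    also have "\<dots> = ennreal (?s p) * (\<integral>\<^sup>+t. ennreal ((1 + p\<^sup>2) powr (-(real k + 2))) *
         (H (\<alpha> * sqrt (1 - (t / ?s t)\<^sup>2), t / ?s t) * ennreal ((1 - (t / ?s t)\<^sup>2) powr (real k + 1/2)) * ennreal ((1 + t\<^sup>2) powr (-3/2))) \<partial>lborel)"
    proof -
      have A: "H (p / sqrt (1 + p\<^sup>2 + (0 + ?s p * t)\<^sup>2), (0 + ?s p * t) / sqrt (1 + p\<^sup>2 + (0 + ?s p * t)\<^sup>2)) * ennreal ((1 + p\<^sup>2 + (0 + ?s p * t)\<^sup>2) powr (-(real k + 2)))
        = ennreal ((1 + p\<^sup>2) powr (-(real k + 2))) *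
         (H (\<alpha> * sqrt (1 - (t / ?s t)\<^sup>2), t / ?s t) * ennreal ((1 - (t / ?s t)\<^sup>2) powr (real k + 1/2)) * ennreal ((1 + t\<^sup>2) powr (-3/2)))" for t
      proof -
        have T: "1 + t\<^sup>2 > 0" by (rule one_plus_square_pos)
        have 1: "1 + p\<^sup>2 + (0 + ?s p * t)\<^sup>2 = (1 + p\<^sup>2) * (1 + t\<^sup>2)" using P by (simp add: power_mult_distrib algebra_simps)
        have 2: "1 - (t / ?s t)\<^sup>2 = 1 / (1 + t\<^sup>2)" using T by (simp add: power_divide divide_simps)
        have 3: "p / sqrt ((1 + p\<^sup>2) * (1 + t\<^sup>2)) = \<alpha> * sqrt (1 / (1 + t\<^sup>2))"
          by (simp add: \<alpha>_def real_sqrt_mult real_sqrt_divide)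
        have 4: "(0 + ?s p * t) / sqrt ((1 + p\<^sup>2) * (1 + t\<^sup>2)) = t / ?s t"
          using P by (simp add: real_sqrt_mult)
        have "(1 / (1 + t\<^sup>2)) powr (real k + 1/2) = (1 + t\<^sup>2) powr (-1 * (real k + 1/2))"
          unfolding powr_powr[symmetric] using T by (simp add: powr_minus_divide)
        then have "(1 / (1 + t\<^sup>2)) powr (real k + 1/2) * (1 + t\<^sup>2) powr (-3/2) = (1 + t\<^sup>2) powr (-1 * (real k + 1/2) + (-3/2))"
          by (simp only: powr_add)
        also have "-1 * (real k + 1/2) + (-3/2) = -(real k + 2)" by simp
        finally have 5: "((1 + p\<^sup>2) * (1 + t\<^sup>2)) powr (-(real k + 2)) = (1 + p\<^sup>2) powr (-(real k + 2)) * ((1 / (1 + t\<^sup>2)) powr (real k + 1/2) * (1 + t\<^sup>2) powr (-3/2))"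
          using P T by (simp add: powr_mult)
        have 6: "ennreal (((1 + p\<^sup>2) * (1 + t\<^sup>2)) powr (-(real k + 2))) = ennreal ((1 + p\<^sup>2) powr (-(real k + 2))) * (ennreal ((1 / (1 + t\<^sup>2)) powr (real k + 1/2)) * ennreal ((1 + t\<^sup>2) powr (-3/2)))"
          unfolding 5 by (simp add: ennreal_mult')
        show ?thesis unfolding 1 2 3 4 6 by (simp only: mult_ac)
      qed
      have "\<bar>?s p\<bar> = ?s p" using P by simp
      then show ?thesis by (simp only: A)
    qed
    also have "\<dots> = ennreal (?s p) * (ennreal ((1 + p\<^sup>2) powr (-(real k + 2))) * G \<alpha>)"
    proof -
      have "(\<lambda>u. H (\<alpha> * sqrt (1 - u\<^sup>2), u) * ennreal ((1 - u\<^sup>2) powr (real k + 1/2))) \<in> borel_measurable borel"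
        by measurable
      from nn_integral_unit_interval_eq_real_line[OF this] show ?thesis
        by (subst nn_integral_cmult) (simp_all add: G_def)
    qed
    also have "\<dots> = G \<alpha> * ennreal ((1 - \<alpha>\<^sup>2) ^ k) * ennreal ((1 + p\<^sup>2) powr (-3/2))"
    proof -
      have 2: "1 - \<alpha>\<^sup>2 = 1 / (1 + p\<^sup>2)" using P by (simp add: \<alpha>_def power_divide divide_simps)
      have "(1 - \<alpha>\<^sup>2) ^ k = (1 + p\<^sup>2) powr (-1 * real k)"
        unfolding powr_powr[symmetric] 2 using P by (simp add: powr_minus_divide powr_realpow)
      then have "(1 - \<alpha>\<^sup>2) ^ k * (1 + p\<^sup>2) powr (-3/2) = (1 + p\<^sup>2) powr (-1 * real k + (-3/2))"
        by (simp only: powr_add)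
      also have "-1 * real k + (-3/2) = 1/2 + (-(real k + 2))" by simp
      also have "(1 + p\<^sup>2) powr (1/2 + (-(real k + 2))) = ?s p * (1 + p\<^sup>2) powr (-(real k + 2))"
        using P by (simp only: powr_add powr_half_sqrt[OF less_imp_le])
      finally have "?s p * (1 + p\<^sup>2) powr (-(real k + 2)) = (1 - \<alpha>\<^sup>2) ^ k * (1 + p\<^sup>2) powr (-3/2)" ..
      then have "ennreal (?s p) * ennreal ((1 + p\<^sup>2) powr (-(real k + 2))) = ennreal ((1 - \<alpha>\<^sup>2) ^ k) * ennreal ((1 + p\<^sup>2) powr (-3/2))"
        by (simp flip: ennreal_mult'')
      then have "ennreal (?s p) * (ennreal ((1 + p\<^sup>2) powr (-(real k + 2))) * G \<alpha>) = (ennreal ((1 - \<alpha>\<^sup>2) ^ k) * ennreal ((1 + p\<^sup>2) powr (-3/2))) * G \<alpha>"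
        by (simp only: mult.assoc[symmetric])
      then show ?thesis by (simp only: mult_ac)
    qed
    finally show "(\<integral>\<^sup>+q. H (p / sqrt (1 + p\<^sup>2 + q\<^sup>2), q / sqrt (1 + p\<^sup>2 + q\<^sup>2)) * ennreal ((1 + p\<^sup>2 + q\<^sup>2) powr (-(real k + 2))) \<partial>lborel)
       = G (p / ?s p) * ennreal ((1 - (p / ?s p)\<^sup>2) ^ k) * ennreal ((1 + p\<^sup>2) powr (-3/2))"
      by (simp only: \<alpha>_def)
  qed
  also have "\<dots> = (\<integral>\<^sup>+\<alpha>. G \<alpha> * ennreal ((1 - \<alpha>\<^sup>2) ^ k) * ?I \<alpha> \<partial>lborel)"
    by (rule nn_integral_unit_interval_eq_real_line[of "\<lambda>\<alpha>. G \<alpha> * ennreal ((1 - \<alpha>\<^sup>2) ^ k)"]) measurable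
  also have "\<dots> = (\<integral>\<^sup>+\<alpha>. \<integral>\<^sup>+u. (H (\<alpha> * sqrt (1 - u\<^sup>2), u) * ennreal ((1 - u\<^sup>2) powr (real k + 1/2)) * ?I u) * (ennreal ((1 - \<alpha>\<^sup>2) ^ k) * ?I \<alpha>) \<partial>lborel \<partial>lborel)"
    unfolding G_def mult.assoc[of _ "ennreal ((1 - _\<^sup>2) ^ k)"]
    by (intro nn_integral_cong nn_integral_multc[symmetric]) measurable
  also have "\<dots> = (\<integral>\<^sup>+u. \<integral>\<^sup>+\<alpha>. (H (\<alpha> * sqrt (1 - u\<^sup>2), u) * ennreal ((1 - u\<^sup>2) powr (real k + 1/2)) * ?I u) * (ennreal ((1 - \<alpha>\<^sup>2) ^ k) * ?I \<alpha>) \<partial>lborel \<partial>lborel)"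
    by (rule lborel_pair.Fubini'[symmetric]) measurable
  also have "\<dots> = (\<integral>\<^sup>+u. \<integral>\<^sup>+a. H (a, u) * ennreal ((1 - (a\<^sup>2 + u\<^sup>2)) ^ k) * indicator {0<..} (1 - (a\<^sup>2 + u\<^sup>2)) \<partial>lborel \<partial>lborel)"
  proof (rule nn_integral_cong)
    fix u :: real
    show "(\<integral>\<^sup>+\<alpha>. (H (\<alpha> * sqrt (1 - u\<^sup>2), u) * ennreal ((1 - u\<^sup>2) powr (real k + 1/2)) * ?I u) * (ennreal ((1 - \<alpha>\<^sup>2) ^ k) * ?I \<alpha>) \<partial>lborel)
       = (\<integral>\<^sup>+a. H (a, u) * ennreal ((1 - (a\<^sup>2 + u\<^sup>2)) ^ k) * indicator {0<..} (1 - (a\<^sup>2 + u\<^sup>2)) \<partial>lborel)"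
    proof (cases "u \<in> {-1<..<1}")
      case True
      define c where "c = sqrt (1 - u\<^sup>2)"
      have u: "u\<^sup>2 < 1" using True by (simp add: abs_square_less_1 abs_less_iff)
      have c: "c > 0" "c\<^sup>2 = 1 - u\<^sup>2" using u by (auto simp: c_def)
      have "(1 - u\<^sup>2) powr (real k + 1/2) = (1 - u\<^sup>2) ^ k * c"
        using u by (simp add: powr_add powr_realpow powr_half_sqrt c_def)
      then have e: "ennreal ((1 - u\<^sup>2) powr (real k + 1/2)) = ennreal c * ennreal ((1 - u\<^sup>2) ^ k)"
        using c by (simp add: ennreal_mult' mult.commute)
      have "(\<integral>\<^sup>+a. H (a, u) * ennreal ((1 - (a\<^sup>2 + u\<^sup>2)) ^ k) * indicator {0<..} (1 - (a\<^sup>2 + u\<^sup>2)) \<partial>lborel)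
          = ennreal \<bar>c\<bar> * (\<integral>\<^sup>+\<alpha>. H (0 + c * \<alpha>, u) * ennreal ((1 - ((0 + c * \<alpha>)\<^sup>2 + u\<^sup>2)) ^ k) * indicator {0<..} (1 - ((0 + c * \<alpha>)\<^sup>2 + u\<^sup>2)) \<partial>lborel)"
        by (rule nn_integral_real_affine) (measurable, use c in simp)
      also have "\<dots> = (\<integral>\<^sup>+\<alpha>. ennreal c * (H (c * \<alpha>, u) * ennreal ((1 - ((c * \<alpha>)\<^sup>2 + u\<^sup>2)) ^ k) * indicator {0<..} (1 - ((c * \<alpha>)\<^sup>2 + u\<^sup>2))) \<partial>lborel)"
        by (subst nn_integral_cmult, measurable) (use c in simp)
      also have "\<dots> = (\<integral>\<^sup>+\<alpha>. (H (\<alpha> * sqrt (1 - u\<^sup>2), u) * ennreal ((1 - u\<^sup>2) powr (real k + 1/2)) * ?I u) * (ennreal ((1 - \<alpha>\<^sup>2) ^ k) * ?I \<alpha>) \<partial>lborel)"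
      proof (rule nn_integral_cong)
        fix \<alpha> :: real
        have 1: "1 - ((c * \<alpha>)\<^sup>2 + u\<^sup>2) = (1 - u\<^sup>2) * (1 - \<alpha>\<^sup>2)" by (simp add: power_mult_distrib c algebra_simps)
        show "ennreal c * (H (c * \<alpha>, u) * ennreal ((1 - ((c * \<alpha>)\<^sup>2 + u\<^sup>2)) ^ k) * indicator {0<..} (1 - ((c * \<alpha>)\<^sup>2 + u\<^sup>2)))
            = (H (\<alpha> * sqrt (1 - u\<^sup>2), u) * ennreal ((1 - u\<^sup>2) powr (real k + 1/2)) * ?I u) * (ennreal ((1 - \<alpha>\<^sup>2) ^ k) * ?I \<alpha>)"
        proof (cases "\<alpha> \<in> {-1<..<1}")
          case t: True
          then have a: "\<alpha>\<^sup>2 < 1" by (simp add: abs_square_less_1 abs_less_iff)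
          then have "0 < (1 - u\<^sup>2) * (1 - \<alpha>\<^sup>2)" using u by simp
          then show ?thesis unfolding 1 e using t True a u
            by (simp add: power_mult_distrib ennreal_mult' mult_ac flip: c_def)
        next
          case f: False
          then have "\<not> \<alpha>\<^sup>2 < 1" by (auto simp: abs_square_less_1 abs_less_iff)
          then have "\<not> 0 < (1 - u\<^sup>2) * (1 - \<alpha>\<^sup>2)" using u by (simp add: zero_less_mult_iff)
          then show ?thesis unfolding 1 using f by auto
        qed
      qed
      finally show ?thesis ..
    next
      case False
      then have "\<not> u\<^sup>2 < 1" by (auto simp: abs_square_less_1 abs_less_iff)
      then have "\<not> 0 < 1 - (a\<^sup>2 + u\<^sup>2)" for a using zero_le_power2[of a] by linarith
      then show ?thesis using False by simp
    qed
  qed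
  also have "\<dots> = (\<integral>\<^sup>+a. \<integral>\<^sup>+u. H (a, u) * ennreal ((1 - (a\<^sup>2 + u\<^sup>2)) ^ k) * indicator {0<..} (1 - (a\<^sup>2 + u\<^sup>2)) \<partial>lborel \<partial>lborel)"
    by (rule lborel_pair.Fubini') measurable
  finally show ?thesis .
qed

lemma nn_integral_sphere_measure:
  fixes F :: "'a::euclidean_space \<Rightarrow> ennreal"
  assumes [measurable]: "F \<in> borel_measurable borel"
  shows "(\<integral>\<^sup>+\<eta>. F \<eta> \<partial>sphere_measure)
       = ennreal (real DIM('a)) * (\<integral>\<^sup>+x. F (sgn x) * indicator (ball 0 1 - {0}) x \<partial>lborel)"
proof -
  have F: "F \<in> borel_measurable (restrict_space borel (sphere 0 1))"
    by (rule measurable_restrict_space1) measurable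
  show ?thesis
    unfolding sphere_measure_def nn_integral_completion
    by (subst nn_integral_scale_measure, use F in simp, subst nn_integral_distr[OF measurable_sgn_sphere], use F in simp)
       (simp add: nn_integral_restrict_space)
qed

lemma Re_cdot: "Re (cdot \<xi> \<eta>) = \<xi> \<bullet> \<eta>"
  by (simp add: cdot_def inner_vec_def inner_complex_def)

lemma Im_cdot: "Im (cdot \<xi> \<eta>) = (\<chi> j. - \<i> * \<xi> $ j) \<bullet> \<eta>"
  by (simp add: cdot_def inner_vec_def inner_complex_def algebra_simps)

text \<open>
  The real and imaginary parts of cdot xi are the inner products with the two orthonormal vectors xi
  and zeta = -i xi.  They are completed to an isometry by any real isometry from the orthogonal
  complement of these two vectors, which has real dimension 2n, onto the space of n complex
  coordinates.
\<close>

lemma cdot_split_isometry: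
  fixes \<xi> :: "complex ^ ('n::finite option)"
  assumes "norm \<xi> = 1"
  obtains T :: "complex ^ ('n option) \<Rightarrow> (complex ^ 'n) \<times> real \<times> real"
  where "linear T" "\<And>\<eta>. norm (T \<eta>) = norm \<eta>" "surj T"
    "\<And>\<eta>. snd (T \<eta>) = (Re (cdot \<xi> \<eta>), Im (cdot \<xi> \<eta>))"
proof -
  define \<zeta> where "\<zeta> = (\<chi> j. - \<i> * \<xi> $ j)"
  have xx: "\<xi> \<bullet> \<xi> = 1" using assms by (simp add: norm_eq_1)
  have zz: "\<zeta> \<bullet> \<zeta> = 1"
    using xx by (simp add: \<zeta>_def inner_vec_def inner_complex_def algebra_simps)
  have xz: "\<xi> \<bullet> \<zeta> = 0" "\<zeta> \<bullet> \<xi> = 0"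
    by (simp_all add: \<zeta>_def inner_vec_def inner_complex_def algebra_simps)
  define S where "S = {y. \<forall>x \<in> span {\<xi>, \<zeta>}. orthogonal x y}"
  have S_iff: "y \<in> S \<longleftrightarrow> \<xi> \<bullet> y = 0 \<and> \<zeta> \<bullet> y = 0" for y
  proof
    assume "y \<in> S"
    then show "\<xi> \<bullet> y = 0 \<and> \<zeta> \<bullet> y = 0"
      using span_base[of \<xi> "{\<xi>, \<zeta>}"] span_base[of \<zeta> "{\<xi>, \<zeta>}"] unfolding S_def orthogonal_def by blast
  next
    assume "\<xi> \<bullet> y = 0 \<and> \<zeta> \<bullet> y = 0"
    then show "y \<in> S"
      unfolding S_def by (auto simp: orthogonal_def span_insert span_singleton algebra_simps inner_add_left)
  qed
  have subS: "subspace S" by (auto simp: subspace_def S_iff inner_add_right)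
  have "\<xi> \<noteq> \<zeta>" using xx xz by auto
  have indep: "independent {\<xi>, \<zeta>}"
    by (rule pairwise_orthogonal_independent)
       (use xx zz xz in \<open>auto simp: pairwise_def orthogonal_def\<close>)
  then have "dim (span {\<xi>, \<zeta>}) = 2"
    using \<open>\<xi> \<noteq> \<zeta>\<close> by (simp add: dim_eq_card_independent)
  moreover have "dim S + dim (span {\<xi>, \<zeta>}) = DIM(complex ^ ('n option))"
    using dim_subspace_orthogonal_to_vectors[of "span {\<xi>, \<zeta>}" UNIV] by (simp add: S_def)
  ultimately have "dim S = DIM(complex ^ 'n)" by simp
  then have "dim S = dim (UNIV :: (complex ^ 'n) set)" by simp
  then obtain f :: "complex ^ ('n option) \<Rightarrow> complex ^ 'n" and g where fg: "linear f" "linear g"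
     "f ` S = UNIV" "g ` UNIV = S" "\<And>x. x \<in> S \<Longrightarrow> norm (f x) = norm x" "\<And>x. x \<in> UNIV \<Longrightarrow> norm (g x) = norm x"
     "\<And>x. x \<in> S \<Longrightarrow> g (f x) = x" "\<And>x. x \<in> UNIV \<Longrightarrow> f (g x) = x"
    by (rule isometries_subspaces[OF subS subspace_UNIV]) (rule that)
  define P where "P \<eta> = \<eta> - (\<xi> \<bullet> \<eta>) *\<^sub>R \<xi> - (\<zeta> \<bullet> \<eta>) *\<^sub>R \<zeta>" for \<eta>
  have PS: "P \<eta> \<in> S" for \<eta> by (simp add: S_iff P_def inner_diff_right xx zz xz)
  have linP: "linear P"
    by (rule linearI) (simp_all add: P_def algebra_simps inner_add_right)
  define T where "T \<eta> = (f (P \<eta>), \<xi> \<bullet> \<eta>, \<zeta> \<bullet> \<eta>)" for \<eta>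
  show ?thesis
  proof
    show "linear T"
      by (rule linearI) (simp_all add: T_def linear_add[OF linP] linear_add[OF fg(1)] linear_scale[OF linP]
          linear_scale[OF fg(1)] inner_add_right)
    show "norm (T \<eta>) = norm \<eta>" for \<eta>
    proof -
      have "(norm (P \<eta>))\<^sup>2 + (\<xi> \<bullet> \<eta>)\<^sup>2 + (\<zeta> \<bullet> \<eta>)\<^sup>2 = (norm \<eta>)\<^sup>2"
        unfolding P_def power2_norm_eq_inner
        by (simp add: inner_diff_left inner_diff_right xx zz xz inner_commute[of \<eta> \<xi>] inner_commute[of \<eta> \<zeta>] power2_eq_square algebra_simps)
      then show ?thesis
        by (simp add: T_def norm_prod_def fg(5)[OF PS] real_sqrt_unique add.assoc)
    qed
    show "surj T"
    proof (rule surjI)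
      fix y :: "(complex ^ 'n) \<times> real \<times> real"
      obtain z a b where y: "y = (z, a, b)" by (cases y)
      define \<eta> where "\<eta> = g z + a *\<^sub>R \<xi> + b *\<^sub>R \<zeta>"
      have "g z \<in> S" using fg(4) by auto
      then have *: "\<xi> \<bullet> \<eta> = a" "\<zeta> \<bullet> \<eta> = b" by (simp_all add: \<eta>_def S_iff inner_add_right xx zz xz)
      then have "P \<eta> = g z" by (simp add: P_def) (simp add: \<eta>_def)
      with * show "T ((\<lambda>(z, a, b). g z + a *\<^sub>R \<xi> + b *\<^sub>R \<zeta>) y) = y"
        by (simp add: T_def y fg(8) flip: \<eta>_def)
    qed
    show "snd (T \<eta>) = (Re (cdot \<xi> \<eta>), Im (cdot \<xi> \<eta>))" for \<eta>
      by (simp add: T_def Re_cdot Im_cdot \<zeta>_def)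
  qed
qed

text \<open>
  Under the normalised surface measure the point cdot xi eta of the unit disc has a density
  proportional to (1 - |w|^2)^(n - 1).  The surface integral is an integral over the unit ball of a
  function that is constant along rays; rotate so that cdot xi becomes the last two real coordinates w
  and let z denote the others.  Scaling w = |z| v for fixed z makes the argument of H depend on v
  alone, and the integral over z of |z|^2 on the remaining ball is a constant times a power of
  1 + |v|^2.  Central projection of the v-plane then gives the disc.
\<close>

lemma nn_integral_sphere_eq_disc_up_to_constant:
  fixes H :: "real \<times> real \<Rightarrow> ennreal" and \<xi> :: "complex ^ ('n::finite option)"
  assumes "norm \<xi> = 1" and H: "H \<in> borel_measurable (borel \<Otimes>\<^sub>M borel)"
  defines "M \<equiv> ennreal (real DIM(complex ^ ('n option)))
       * (\<integral>\<^sup>+z. ennreal ((norm z)\<^sup>2) * indicator (ball 0 1) z \<partial>(lborel :: (complex ^ 'n) measure))"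
  shows "(\<integral>\<^sup>+\<eta>. H (Re (cdot \<xi> \<eta>), Im (cdot \<xi> \<eta>)) \<partial>sphere_measure)
       = M * (\<integral>\<^sup>+a. \<integral>\<^sup>+b. H (a, b) * ennreal ((1 - (a\<^sup>2 + b\<^sup>2)) ^ (CARD('n) - 1)) * indicator {0<..} (1 - (a\<^sup>2 + b\<^sup>2)) \<partial>lborel \<partial>lborel)"
proof -
  let ?Z = "lborel :: (complex ^ 'n) measure" and ?W = "lborel :: (real \<times> real) measure"
  let ?d = "ennreal (real DIM(complex ^ ('n option)))"
  have Hb[measurable]: "H \<in> borel_measurable borel" using H by (simp add: borel_prod)
  define s where "s v = sqrt (1 + (norm v)\<^sup>2)" for v :: "real \<times> real"
  have s: "s v > 0" for v unfolding s_def using one_plus_square_pos by simp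
  have sm[measurable]: "s \<in> borel_measurable borel" unfolding s_def by measurable
  define M0 where "M0 = (\<integral>\<^sup>+z. ennreal ((norm z)\<^sup>2) * indicator (ball 0 1) z \<partial>?Z)"
  have [measurable]: "ball 0 1 \<in> sets (borel :: (complex ^ 'n) measure)" by simp
  obtain T :: "complex ^ ('n option) \<Rightarrow> (complex ^ 'n) \<times> real \<times> real"
    where T: "linear T" "\<And>\<eta>. norm (T \<eta>) = norm \<eta>" "surj T"
      "\<And>\<eta>. snd (T \<eta>) = (Re (cdot \<xi> \<eta>), Im (cdot \<xi> \<eta>))"
    using cdot_split_isometry[OF assms(1)] by blast
  have [measurable]: "T \<in> borel_measurable borel"
    by (intro borel_measurable_continuous_onI linear_continuous_on linear_conv_bounded_linear[THEN iffD1] T(1))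
  define B where "B = ball 0 1 - {0 :: (complex ^ 'n) \<times> real \<times> real}"
  have [measurable]: "B \<in> sets borel" unfolding B_def by simp
  have [measurable]: "(\<lambda>u. snd u /\<^sub>R norm u) \<in> borel_measurable (borel :: ((complex ^ 'n) \<times> real \<times> real) measure)"
    by (intro borel_measurable_scaleR borel_measurable_inverse borel_measurable_norm
        borel_measurable_continuous_onI continuous_intros)
  have [measurable]: "indicator B \<in> borel_measurable (borel :: ((complex ^ 'n) \<times> real \<times> real) measure)"
    by (intro borel_measurable_indicator) fact
  define K where "K u = H (snd u /\<^sub>R norm u) * indicator B u" for u :: "(complex ^ 'n) \<times> real \<times> real"
  have Km[measurable]: "K \<in> borel_measurable borel" unfolding K_def by measurable
  have [measurable]: "(\<lambda>\<eta>. snd (T \<eta>)) \<in> borel_measurable borel"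
    by (intro borel_measurable_continuous_onI continuous_on_snd linear_continuous_on linear_conv_bounded_linear[THEN iffD1] T(1))
  have mH: "(\<lambda>\<eta>. H (Re (cdot \<xi> \<eta>), Im (cdot \<xi> \<eta>))) \<in> borel_measurable borel"
    unfolding T(4)[symmetric] by measurable
  have "(\<integral>\<^sup>+\<eta>. H (Re (cdot \<xi> \<eta>), Im (cdot \<xi> \<eta>)) \<partial>sphere_measure)
      = ?d * (\<integral>\<^sup>+x. H (Re (cdot \<xi> (sgn x)), Im (cdot \<xi> (sgn x))) * indicator (ball 0 1 - {0}) x \<partial>lborel)"
    by (rule nn_integral_sphere_measure[OF mH])
  also have "(\<integral>\<^sup>+x. H (Re (cdot \<xi> (sgn x)), Im (cdot \<xi> (sgn x))) * indicator (ball 0 1 - {0}) x \<partial>lborel)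
      = (\<integral>\<^sup>+x. K (T x) \<partial>lborel)"
  proof (rule nn_integral_cong)
    fix x
    have "T x = 0 \<longleftrightarrow> x = 0" using T(2)[of x] by (metis norm_eq_zero)
    moreover have "snd (T (sgn x)) = snd (T x) /\<^sub>R norm x"
      unfolding sgn_div_norm by (simp add: linear_scale[OF T(1)])
    ultimately show "H (Re (cdot \<xi> (sgn x)), Im (cdot \<xi> (sgn x))) * indicator (ball 0 1 - {0}) x = K (T x)"
      by (simp add: K_def B_def T(2) indicator_def flip: T(4))
  qed
  also have "\<dots> = (\<integral>\<^sup>+u. K u \<partial>lborel)"
    by (rule nn_integral_lborel_isometry[OF T(1,2,3) Km])
  also have "\<dots> = (\<integral>\<^sup>+z. \<integral>\<^sup>+w. K (z, w) \<partial>?W \<partial>?Z)"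
    unfolding lborel_prod[symmetric, where 'a = "complex ^ 'n" and 'b = "real \<times> real"]
    by (rule lborel.nn_integral_fst[symmetric]) (simp add: lborel_prod)
  also have "\<dots> = (\<integral>\<^sup>+z. \<integral>\<^sup>+v. ennreal ((norm z)\<^sup>2) * (H (v /\<^sub>R s v) * indicator {..<1} (norm z * s v)) \<partial>?W \<partial>?Z)"
  proof (rule nn_integral_cong_AE)
    have "AE z in ?Z. z \<noteq> 0" by (rule AE_lborel_singleton)
    then show "AE z in ?Z. (\<integral>\<^sup>+w. K (z, w) \<partial>?W) = (\<integral>\<^sup>+v. ennreal ((norm z)\<^sup>2) * (H (v /\<^sub>R s v) * indicator {..<1} (norm z * s v)) \<partial>?W)"
    proof eventually_elim
      fix z :: "complex ^ 'n" assume z: "z \<noteq> 0"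
      have m: "(\<lambda>w. K (z, w)) \<in> borel_measurable borel" by measurable
      have "(\<integral>\<^sup>+w. K (z, w) \<partial>?W) = ennreal (\<bar>norm z\<bar> ^ DIM(real \<times> real)) * (\<integral>\<^sup>+v. K (z, 0 + norm z *\<^sub>R v) \<partial>?W)"
        by (rule nn_integral_lborel_affine[OF m]) (use z in simp)
      also have "\<dots> = (\<integral>\<^sup>+v. ennreal ((norm z)\<^sup>2) * K (z, norm z *\<^sub>R v) \<partial>?W)"
        by (subst nn_integral_cmult, measurable) (simp add: power2_eq_square)
      also have "\<dots> = (\<integral>\<^sup>+v. ennreal ((norm z)\<^sup>2) * (H (v /\<^sub>R s v) * indicator {..<1} (norm z * s v)) \<partial>?W)"
      proof (intro nn_integral_cong arg_cong2[where f = "(*)"] refl)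
        fix v :: "real \<times> real"
        have "(norm z)\<^sup>2 + (norm (norm z *\<^sub>R v))\<^sup>2 = (norm z)\<^sup>2 * (1 + (norm v)\<^sup>2)"
          by (simp add: power_mult_distrib algebra_simps)
        then have n: "norm (z, norm z *\<^sub>R v) = norm z * s v"
          by (simp add: norm_prod_def s_def real_sqrt_mult)
        have e: "(norm z *\<^sub>R v) /\<^sub>R (norm z * s v) = v /\<^sub>R s v" using z by simp
        have "(z, norm z *\<^sub>R v) \<in> B \<longleftrightarrow> norm z * s v < 1"
          unfolding B_def Diff_iff mem_ball_0 n using z by (simp add: zero_prod_def)
        then show "K (z, norm z *\<^sub>R v) = H (v /\<^sub>R s v) * indicator {..<1} (norm z * s v)"
          unfolding K_def n snd_conv e by (simp add: indicator_def)
      qed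
      finally show "(\<integral>\<^sup>+w. K (z, w) \<partial>?W) = (\<integral>\<^sup>+v. ennreal ((norm z)\<^sup>2) * (H (v /\<^sub>R s v) * indicator {..<1} (norm z * s v)) \<partial>?W)" .
    qed
  qed
  also have "\<dots> = (\<integral>\<^sup>+v. \<integral>\<^sup>+z. ennreal ((norm z)\<^sup>2) * (H (v /\<^sub>R s v) * indicator {..<1} (norm z * s v)) \<partial>?Z \<partial>?W)"
    by (rule lborel_pair.Fubini'[symmetric]) measurable
  also have "\<dots> = (\<integral>\<^sup>+v. M0 * (H (v /\<^sub>R s v) * ennreal ((1 / s v) ^ (2 * CARD('n) + 2))) \<partial>?W)"
  proof (rule nn_integral_cong)
    fix v
    have m1: "(\<lambda>z::complex ^ 'n. ennreal ((norm z)\<^sup>2) * (H (v /\<^sub>R s v) * indicator {..<1} (norm z * s v))) \<in> borel_measurable borel"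
      by measurable
    have m2: "(\<lambda>z::complex ^ 'n. ennreal ((norm z)\<^sup>2) * indicator (ball 0 1) z) \<in> borel_measurable borel"
      by measurable
    have "(\<integral>\<^sup>+z. ennreal ((norm z)\<^sup>2) * (H (v /\<^sub>R s v) * indicator {..<1} (norm z * s v)) \<partial>?Z)
      = ennreal (\<bar>1 / s v\<bar> ^ DIM(complex ^ 'n)) * (\<integral>\<^sup>+z. ennreal ((norm (0 + (1 / s v) *\<^sub>R z))\<^sup>2) * (H (v /\<^sub>R s v) * indicator {..<1} (norm (0 + (1 / s v) *\<^sub>R z) * s v)) \<partial>?Z)"
      by (rule nn_integral_lborel_affine[OF m1]) (use s[of v] in simp)
    also have "(\<lambda>z::complex ^ 'n. ennreal ((norm (0 + (1 / s v) *\<^sub>R z))\<^sup>2) * (H (v /\<^sub>R s v) * indicator {..<1} (norm (0 + (1 / s v) *\<^sub>R z) * s v)))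
       = (\<lambda>z. (ennreal ((1 / s v)\<^sup>2) * H (v /\<^sub>R s v)) * (ennreal ((norm z)\<^sup>2) * indicator (ball 0 1) z))"
    proof
      fix z :: "complex ^ 'n"
      have "norm (0 + (1 / s v) *\<^sub>R z) = (1 / s v) * norm z" using s[of v] by simp
      moreover have "(1 / s v) * norm z * s v = norm z" using s[of v] by simp
      moreover have "ennreal (((1 / s v) * norm z)\<^sup>2) = ennreal ((1 / s v)\<^sup>2) * ennreal ((norm z)\<^sup>2)"
        unfolding power_mult_distrib by (rule ennreal_mult) auto
      moreover have "indicator {..<1} (norm z) = (indicator (ball 0 1) z :: ennreal)"
        by (simp add: indicator_def)
      ultimately show "ennreal ((norm (0 + (1 / s v) *\<^sub>R z))\<^sup>2) * (H (v /\<^sub>R s v) * indicator {..<1} (norm (0 + (1 / s v) *\<^sub>R z) * s v))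
        = (ennreal ((1 / s v)\<^sup>2) * H (v /\<^sub>R s v)) * (ennreal ((norm z)\<^sup>2) * indicator (ball 0 1) z)"
        by (simp only: mult_ac)
    qed
    also have "(\<integral>\<^sup>+z. (ennreal ((1 / s v)\<^sup>2) * H (v /\<^sub>R s v)) * (ennreal ((norm z)\<^sup>2) * indicator (ball 0 1) z) \<partial>?Z)
       = (ennreal ((1 / s v)\<^sup>2) * H (v /\<^sub>R s v)) * M0"
      unfolding M0_def using m2 by (intro nn_integral_cmult) simp
    also have "ennreal (\<bar>1 / s v\<bar> ^ DIM(complex ^ 'n)) * ((ennreal ((1 / s v)\<^sup>2) * H (v /\<^sub>R s v)) * M0)
      = M0 * (H (v /\<^sub>R s v) * ennreal ((1 / s v) ^ (2 * CARD('n) + 2)))"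
    proof -
      have "(1 / s v) ^ (2 * CARD('n) + 2) = \<bar>1 / s v\<bar> ^ DIM(complex ^ 'n) * (1 / s v)\<^sup>2"
      proof -
        have "DIM(complex ^ 'n) = 2 * CARD('n)" "\<bar>1 / s v\<bar> = 1 / s v" using s[of v] by auto
        then show ?thesis by (simp only: power_add)
      qed
      then have "ennreal ((1 / s v) ^ (2 * CARD('n) + 2)) = ennreal (\<bar>1 / s v\<bar> ^ DIM(complex ^ 'n)) * ennreal ((1 / s v)\<^sup>2)"
        by (simp only: ennreal_mult[OF zero_le_power[OF abs_ge_zero] zero_le_power2])
      then show ?thesis by (simp only: mult_ac)
    qed
    finally show "(\<integral>\<^sup>+z. ennreal ((norm z)\<^sup>2) * (H (v /\<^sub>R s v) * indicator {..<1} (norm z * s v)) \<partial>?Z)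
       = M0 * (H (v /\<^sub>R s v) * ennreal ((1 / s v) ^ (2 * CARD('n) + 2)))" .
  qed
  also have "\<dots> = M0 * (\<integral>\<^sup>+v. H (v /\<^sub>R s v) * ennreal ((1 / s v) ^ (2 * CARD('n) + 2)) \<partial>?W)"
    by (rule nn_integral_cmult) measurable
  also have "(\<integral>\<^sup>+v. H (v /\<^sub>R s v) * ennreal ((1 / s v) ^ (2 * CARD('n) + 2)) \<partial>?W)
     = (\<integral>\<^sup>+p. \<integral>\<^sup>+q. H ((p, q) /\<^sub>R s (p, q)) * ennreal ((1 / s (p, q)) ^ (2 * CARD('n) + 2)) \<partial>lborel \<partial>lborel)"
    unfolding lborel_prod[symmetric, where 'a = real and 'b = real]
    by (rule lborel.nn_integral_fst[symmetric]) (simp add: lborel_prod, measurable)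
  also have "\<dots> = (\<integral>\<^sup>+p. \<integral>\<^sup>+q. H (p / sqrt (1 + p\<^sup>2 + q\<^sup>2), q / sqrt (1 + p\<^sup>2 + q\<^sup>2))
                    * ennreal ((1 + p\<^sup>2 + q\<^sup>2) powr (-(real (CARD('n) - 1) + 2))) \<partial>lborel \<partial>lborel)"
  proof (intro nn_integral_cong arg_cong2[where f = "(*)"])
    fix p q :: real
    have sp: "s (p, q) = sqrt (1 + p\<^sup>2 + q\<^sup>2)"
      by (simp add: s_def norm_prod_def add.assoc)
    show "H ((p, q) /\<^sub>R s (p, q)) = H (p / sqrt (1 + p\<^sup>2 + q\<^sup>2), q / sqrt (1 + p\<^sup>2 + q\<^sup>2))"
      by (simp add: sp divide_inverse mult.commute)
    have pos: "1 + p\<^sup>2 + q\<^sup>2 > 0" using one_plus_square_pos[of p] by (simp add: add_pos_nonneg)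
    have "(1 / s (p, q)) ^ (2 * CARD('n) + 2) = ((1 / s (p, q))\<^sup>2) ^ (CARD('n) + 1)"
    proof -
      have "2 * CARD('n) + 2 = 2 * (CARD('n) + 1)" by simp
      then show ?thesis by (simp only: power_mult)
    qed
    also have "(1 / s (p, q))\<^sup>2 = (1 + p\<^sup>2 + q\<^sup>2) powr (-1)"
      using pos by (simp add: sp power_divide powr_minus_divide)
    also have "((1 + p\<^sup>2 + q\<^sup>2) powr (-1)) ^ (CARD('n) + 1) = ((1 + p\<^sup>2 + q\<^sup>2) powr (-1)) powr real (CARD('n) + 1)"
      using pos by (intro powr_realpow[symmetric]) simp
    also have "\<dots> = (1 + p\<^sup>2 + q\<^sup>2) powr (-1 * real (CARD('n) + 1))" by (rule powr_powr)
    also have "-1 * real (CARD('n) + 1) = -(real (CARD('n) - 1) + 2)"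
      by (simp add: of_nat_diff Suc_leI)
    finally show "ennreal ((1 / s (p, q)) ^ (2 * CARD('n) + 2)) = ennreal ((1 + p\<^sup>2 + q\<^sup>2) powr (-(real (CARD('n) - 1) + 2)))"
      by simp
  qed
  also have "\<dots> = (\<integral>\<^sup>+a. \<integral>\<^sup>+b. H (a, b) * ennreal ((1 - (a\<^sup>2 + b\<^sup>2)) ^ (CARD('n) - 1)) * indicator {0<..} (1 - (a\<^sup>2 + b\<^sup>2)) \<partial>lborel \<partial>lborel)"
    by (rule nn_integral_central_projection[OF H])
  finally show ?thesis by (simp only: M_def M0_def mult.assoc)
qed

lemma pos_not_nonpos_Int: "x > 0 \<Longrightarrow> x \<notin> \<int>\<^sub>\<le>\<^sub>0" for x :: real
  by (auto elim!: nonpos_Ints_cases)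

lemma Beta_real_pos: "a > 0 \<Longrightarrow> b > 0 \<Longrightarrow> Beta a b > 0" for a b :: real
  unfolding Beta_def by (intro divide_pos_pos mult_pos_pos Gamma_real_pos) simp_all

text \<open>
  The area of the unit sphere of complex n-space, which is the normalisation of the density of
  cdot xi eta on the disc.
\<close>

definition slice_const :: "nat \<Rightarrow> real" where
  "slice_const n = 2 * pi ^ n / fact (n - 1)"

lemma slice_const_pos: "slice_const n > 0"
  by (simp add: slice_const_def)

lemma total_sphere_measure:
  "emeasure sphere_measure (sphere (0 :: complex ^ ('n::finite option)) 1) = ennreal (2 * pi ^ (CARD('n) + 1) / fact (CARD('n)))"
proof -
  define m where "m = real (CARD('n) + 1)"
  have m: "m > 0" "real (2 * (CARD('n) + 1)) = 2 * m" "fact (CARD('n) + 1) = m * fact (CARD('n))"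
    by (simp_all add: m_def)
  have d: "real DIM(complex ^ ('n option)) = real (2 * (CARD('n) + 1))" by simp
  have "unit_ball_vol (2 * m) = pi ^ (CARD('n) + 1) / (m * fact (CARD('n)))"
    using unit_ball_vol_even[of "CARD('n) + 1"] unfolding m(2,3) .
  then have "real (2 * (CARD('n) + 1)) * unit_ball_vol (real (2 * (CARD('n) + 1))) = 2 * pi ^ (CARD('n) + 1) / fact (CARD('n))"
    unfolding m(2) using m(1) by simp
  then show ?thesis by (simp only: emeasure_sphere_measure_sphere d)
qed

text \<open>
  The coordinates (x, y) are the real and imaginary part of 1 - w, up to the sign of y.  The constant
  left open before is found by comparing the two sides for the function 1.
\<close>

lemma nn_integral_sphere_eq_disc:
  fixes \<phi> :: "real \<Rightarrow> ennreal" and \<xi> :: "complex ^ ('n::finite option)"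
  assumes xi: "norm \<xi> = 1" and [measurable]: "\<phi> \<in> borel_measurable borel"
  shows "(\<integral>\<^sup>+\<eta>. \<phi> (cmod (1 - cdot \<xi> \<eta>)) \<partial>sphere_measure)
       = ennreal (slice_const CARD('n)) * (\<integral>\<^sup>+x. \<integral>\<^sup>+y. \<phi> (sqrt (x\<^sup>2 + y\<^sup>2)) *
            (ennreal ((2 * x - (x\<^sup>2 + y\<^sup>2)) ^ (CARD('n) - 1)) * indicator {0<..} (2 * x - (x\<^sup>2 + y\<^sup>2))) \<partial>lborel \<partial>lborel)"
proof -
  define M where "M = ennreal (real DIM(complex ^ ('n option)))
       * (\<integral>\<^sup>+z. ennreal ((norm z)\<^sup>2) * indicator (ball 0 1) z \<partial>(lborel :: (complex ^ 'n) measure))"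
  have main: "(\<integral>\<^sup>+\<eta>. \<phi> (cmod (1 - cdot \<xi> \<eta>)) \<partial>sphere_measure)
       = M * (\<integral>\<^sup>+x. \<integral>\<^sup>+y. \<phi> (sqrt (x\<^sup>2 + y\<^sup>2)) *
            (ennreal ((2 * x - (x\<^sup>2 + y\<^sup>2)) ^ (CARD('n) - 1)) * indicator {0<..} (2 * x - (x\<^sup>2 + y\<^sup>2))) \<partial>lborel \<partial>lborel)"
    if phi[measurable]: "\<phi> \<in> borel_measurable borel" for \<phi> :: "real \<Rightarrow> ennreal"
  proof -
    define H where "H = (\<lambda>w::real \<times> real. \<phi> (sqrt ((1 - fst w)\<^sup>2 + (snd w)\<^sup>2)))"
    have H[measurable]: "H \<in> borel_measurable (borel \<Otimes>\<^sub>M borel)" unfolding H_def by measurable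
    define \<Psi> where "\<Psi> a = (\<integral>\<^sup>+b. H (a, b) * ennreal ((1 - (a\<^sup>2 + b\<^sup>2)) ^ (CARD('n) - 1)) * indicator {0<..} (1 - (a\<^sup>2 + b\<^sup>2)) \<partial>lborel)" for a
    have "\<Psi> \<in> borel_measurable lborel" unfolding \<Psi>_def by measurable
    then have \<Psi>: "\<Psi> \<in> borel_measurable borel" by simp
    have "(\<integral>\<^sup>+\<eta>. \<phi> (cmod (1 - cdot \<xi> \<eta>)) \<partial>sphere_measure)
        = (\<integral>\<^sup>+\<eta>. H (Re (cdot \<xi> \<eta>), Im (cdot \<xi> \<eta>)) \<partial>sphere_measure)"
      by (simp add: H_def cmod_def)
    also have "\<dots> = M * (\<integral>\<^sup>+a. \<Psi> a \<partial>lborel)"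
      unfolding M_def \<Psi>_def by (rule nn_integral_sphere_eq_disc_up_to_constant[OF xi H])
    also have "(\<integral>\<^sup>+a. \<Psi> a \<partial>lborel) = (\<integral>\<^sup>+x. \<Psi> (1 - x) \<partial>lborel)"
      using nn_integral_real_affine[OF \<Psi>, of "-1" 1] by simp
    also have "\<dots> = (\<integral>\<^sup>+x. \<integral>\<^sup>+y. \<phi> (sqrt (x\<^sup>2 + y\<^sup>2)) *
            (ennreal ((2 * x - (x\<^sup>2 + y\<^sup>2)) ^ (CARD('n) - 1)) * indicator {0<..} (2 * x - (x\<^sup>2 + y\<^sup>2))) \<partial>lborel \<partial>lborel)"
    proof (intro nn_integral_cong)
      fix x :: real
      have "1 - ((1 - x)\<^sup>2 + y\<^sup>2) = 2 * x - (x\<^sup>2 + y\<^sup>2)" for y by (simp add: power2_eq_square algebra_simps)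
      then show "\<Psi> (1 - x) = (\<integral>\<^sup>+y. \<phi> (sqrt (x\<^sup>2 + y\<^sup>2)) *
            (ennreal ((2 * x - (x\<^sup>2 + y\<^sup>2)) ^ (CARD('n) - 1)) * indicator {0<..} (2 * x - (x\<^sup>2 + y\<^sup>2))) \<partial>lborel)"
        by (simp only: \<Psi>_def H_def fst_conv snd_conv diff_diff_eq2 add_diff_cancel_left' mult.assoc)
    qed
    finally show ?thesis .
  qed
  \<comment> \<open>the constant M follows from the case of the function 1\<close>
  have "ennreal (2 * pi ^ (CARD('n) + 1) / fact (CARD('n))) = (\<integral>\<^sup>+\<eta>. 1 \<partial>(sphere_measure :: (complex ^ ('n option)) measure))"
    by (simp add: space_sphere_measure total_sphere_measure)
  also have "\<dots> = M * (\<integral>\<^sup>+x. \<integral>\<^sup>+y. ennreal ((2 * x - (x\<^sup>2 + y\<^sup>2)) ^ (CARD('n) - 1)) * indicator {0<..} (2 * x - (x\<^sup>2 + y\<^sup>2)) \<partial>lborel \<partial>lborel)"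
    using main[of "\<lambda>_. 1"] by simp
  also have "(\<integral>\<^sup>+x. \<integral>\<^sup>+y. ennreal ((2 * x - (x\<^sup>2 + y\<^sup>2)) ^ (CARD('n) - 1)) * indicator {0<..} (2 * x - (x\<^sup>2 + y\<^sup>2)) \<partial>lborel \<partial>lborel)
     = (\<integral>\<^sup>+x. \<integral>\<^sup>+y. ennreal (sqrt (x\<^sup>2 + y\<^sup>2) powr 0 * (2 * x - (x\<^sup>2 + y\<^sup>2)) ^ (CARD('n) - 1)) * indicator {0<..} (2 * x - (x\<^sup>2 + y\<^sup>2)) \<partial>lborel \<partial>lborel)"
  proof (intro nn_integral_cong)
    fix x y :: real
    show "ennreal ((2 * x - (x\<^sup>2 + y\<^sup>2)) ^ (CARD('n) - 1)) * indicator {0<..} (2 * x - (x\<^sup>2 + y\<^sup>2))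
       = ennreal (sqrt (x\<^sup>2 + y\<^sup>2) powr 0 * (2 * x - (x\<^sup>2 + y\<^sup>2)) ^ (CARD('n) - 1)) * indicator {0<..} (2 * x - (x\<^sup>2 + y\<^sup>2))"
      \<comment> \<open>as 0 powr 0 = 0, the origin has to be excluded, where the indicator vanishes\<close>
      by (cases "x\<^sup>2 + y\<^sup>2 = 0") (auto simp: sum_power2_eq_zero_iff)
  qed
  also have "\<dots> = ennreal (pi / CARD('n))"
  proof -
    have "pi * Gamma (0 + real (CARD('n) - 1) + 2) * Gamma (real (CARD('n) - 1) + 1) / (Gamma (0 / 2 + real (CARD('n) - 1) + 2))\<^sup>2 = pi / CARD('n)"
    proof -
      have 1: "real (CARD('n) - 1) + 1 = real CARD('n)" by (simp add: of_nat_diff Suc_leI)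
      then have 2: "0 + real (CARD('n) - 1) + 2 = real CARD('n) + 1" "0 / 2 + real (CARD('n) - 1) + 2 = real CARD('n) + 1" by simp_all
      have 3: "Gamma (real CARD('n) + 1) = real CARD('n) * Gamma (real CARD('n))"
        by (rule Gamma_plus1[OF pos_not_nonpos_Int]) simp
      have "Gamma (real CARD('n)) > 0" by (rule Gamma_real_pos) simp
      then have "Gamma (real CARD('n)) \<noteq> 0" by (rule less_imp_neq[THEN not_sym])
      then show ?thesis unfolding 1 2 3 by (simp add: power2_eq_square)
    qed
    then show ?thesis using nn_integral_disc_powr[of 0 "CARD('n) - 1"] by simp
  qed
  finally have M: "M * ennreal (pi / CARD('n)) = ennreal (2 * pi ^ (CARD('n) + 1) / fact (CARD('n)))" ..
  have f: "fact CARD('n) = real CARD('n) * fact (CARD('n) - 1)"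
    by (rule fact_reduce) simp
  have "slice_const CARD('n) * (pi / CARD('n)) = 2 * pi ^ (CARD('n) + 1) / fact (CARD('n))"
    unfolding slice_const_def f by (simp add: field_simps)
  then have "ennreal (slice_const CARD('n)) * ennreal (pi / CARD('n)) = ennreal (2 * pi ^ (CARD('n) + 1) / fact (CARD('n)))"
    by (simp flip: ennreal_mult'')
  with M have "ennreal (pi / CARD('n)) * M = ennreal (pi / CARD('n)) * ennreal (slice_const CARD('n))"
    by (simp only: mult.commute)
  then have "M = ennreal (slice_const CARD('n))"
    by (simp add: ennreal_mult_cancel_left)
  with main[OF assms(2)] show ?thesis by simp
qed

section \<open>The kernel integral and the area of caps\<close>

text \<open>
  Up to the total area this is the value of the potential of a constant function; it does not depend
  on xi.
\<close>

lemma nn_integral_sphere_kernel: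
  fixes \<xi> :: "complex ^ ('n::finite option)"
  assumes "norm \<xi> = 1" "g \<ge> 0"
  shows "(\<integral>\<^sup>+\<eta>. ennreal (cmod (1 - cdot \<xi> \<eta>) powr g) \<partial>sphere_measure)
       = ennreal (2 * pi ^ (CARD('n) + 1) / fact CARD('n)
            * (fact CARD('n) * Gamma (g + CARD('n) + 1) / (Gamma (g / 2 + CARD('n) + 1))\<^sup>2))"
proof -
  let ?k = "CARD('n) - 1"
  have k: "real ?k = real CARD('n) - 1" by (simp add: of_nat_diff Suc_leI)
  have "(\<integral>\<^sup>+\<eta>. ennreal (cmod (1 - cdot \<xi> \<eta>) powr g) \<partial>sphere_measure)
     = ennreal (slice_const CARD('n)) * (\<integral>\<^sup>+x. \<integral>\<^sup>+y. ennreal (sqrt (x\<^sup>2 + y\<^sup>2) powr g) *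
            (ennreal ((2 * x - (x\<^sup>2 + y\<^sup>2)) ^ ?k) * indicator {0<..} (2 * x - (x\<^sup>2 + y\<^sup>2))) \<partial>lborel \<partial>lborel)"
    by (rule nn_integral_sphere_eq_disc[OF assms(1), of "\<lambda>t. ennreal (t powr g)"]) measurable
  also have "(\<integral>\<^sup>+x. \<integral>\<^sup>+y. ennreal (sqrt (x\<^sup>2 + y\<^sup>2) powr g) *
            (ennreal ((2 * x - (x\<^sup>2 + y\<^sup>2)) ^ ?k) * indicator {0<..} (2 * x - (x\<^sup>2 + y\<^sup>2))) \<partial>lborel \<partial>lborel)
    = (\<integral>\<^sup>+x. \<integral>\<^sup>+y. ennreal (sqrt (x\<^sup>2 + y\<^sup>2) powr g * (2 * x - (x\<^sup>2 + y\<^sup>2)) ^ ?k) * indicator {0<..} (2 * x - (x\<^sup>2 + y\<^sup>2)) \<partial>lborel \<partial>lborel)"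
    by (simp add: ennreal_mult' mult.assoc)
  also have "\<dots> = ennreal (pi * Gamma (g + real ?k + 2) * Gamma (real ?k + 1) / (Gamma (g / 2 + real ?k + 2))\<^sup>2)"
    by (rule nn_integral_disc_powr[OF assms(2)])
  also have "ennreal (slice_const CARD('n)) * \<dots> = ennreal (slice_const CARD('n) * (pi * Gamma (g + real ?k + 2) * Gamma (real ?k + 1) / (Gamma (g / 2 + real ?k + 2))\<^sup>2))"
    using slice_const_pos by (intro ennreal_mult'[symmetric] less_imp_le) auto
  also have "slice_const CARD('n) * (pi * Gamma (g + real ?k + 2) * Gamma (real ?k + 1) / (Gamma (g / 2 + real ?k + 2))\<^sup>2)
     = 2 * pi ^ (CARD('n) + 1) / fact CARD('n) * (fact CARD('n) * Gamma (g + CARD('n) + 1) / (Gamma (g / 2 + CARD('n) + 1))\<^sup>2)"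
  proof -
    have "Gamma (real ?k + 1) = fact ?k" using Gamma_fact[of ?k, where 'a = real] by (simp add: add.commute)
    moreover have "g + real ?k + 2 = g + CARD('n) + 1" "g / 2 + real ?k + 2 = g / 2 + CARD('n) + 1" by (simp_all add: k)
    ultimately show ?thesis by (simp only:) (simp add: slice_const_def)
  qed
  finally show ?thesis .
qed

text \<open>
  The slice at height t is a ball of radius (1 - t^2)^(1/4) in real dimension 2n.
\<close>

lemma emeasure_heisenberg_unit_ball:
  "emeasure lborel (heisenberg_unit_ball :: ((complex ^ 'n::finite) \<times> real) set)
     = ennreal (pi ^ CARD('n) / fact CARD('n) * (2 * 4 powr (CARD('n) / 2) * Beta (CARD('n) / 2 + 1) (CARD('n) / 2 + 1)))"
proof -
  let ?B = "heisenberg_unit_ball :: ((complex ^ 'n) \<times> real) set"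
  let ?u = "pi ^ CARD('n) / fact CARD('n)"
  have "?B = {x. norm (fst x) ^ 4 + (snd x)\<^sup>2 < 1}" by (auto simp: heisenberg_unit_ball_def)
  also have "open \<dots>" by (intro open_Collect_less continuous_intros)
  finally have "?B \<in> sets lborel" by simp
  then have B: "?B \<in> sets (lborel \<Otimes>\<^sub>M lborel)" by (simp only: lborel_prod)
  have "emeasure lborel ?B = emeasure (lborel \<Otimes>\<^sub>M lborel) ?B" by (simp add: lborel_prod)
  also have "\<dots> = (\<integral>\<^sup>+t. emeasure lborel ((\<lambda>z. (z, t)) -` ?B) \<partial>lborel)"
    by (rule lborel_pair.emeasure_pair_measure_alt2[OF B])
  also have "\<dots> = (\<integral>\<^sup>+t. ennreal ?u * (ennreal ((1 - t\<^sup>2) powr (CARD('n) / 2)) * indicator {-1<..<1} t) \<partial>lborel)"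
  proof (rule nn_integral_cong)
    fix t :: real
    show "emeasure lborel ((\<lambda>z. (z, t)) -` ?B) = ennreal ?u * (ennreal ((1 - t\<^sup>2) powr (CARD('n) / 2)) * indicator {-1<..<1} t)"
    proof (cases "t\<^sup>2 < 1")
      case True
      define r where "r = (1 - t\<^sup>2) powr (1/4)"
      have r: "r > 0" "r ^ 4 = 1 - t\<^sup>2" using True by (simp_all add: r_def powr_powr flip: powr_realpow)
      have "norm z ^ 4 + t\<^sup>2 < 1 \<longleftrightarrow> norm z < r" for z :: "complex ^ 'n"
      proof -
        have "norm z ^ 4 + t\<^sup>2 < 1 \<longleftrightarrow> norm z ^ 4 < r ^ 4" using r by auto
        also have "\<dots> \<longleftrightarrow> norm z < r"
          using r power_strict_mono[of "norm z" r 4] power_less_imp_less_base[of "norm z" 4 r] by auto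
        finally show ?thesis .
      qed
      then have "(\<lambda>z. (z, t)) -` ?B = ball 0 r"
        unfolding heisenberg_unit_ball_def ball_def vimage_def mem_Collect_eq prod.case dist_0_norm by (simp only:)
      moreover have "emeasure lborel (ball (0 :: complex ^ 'n) r) = ennreal (unit_ball_vol (real (2 * CARD('n))) * r ^ (2 * CARD('n)))"
      proof -
        have "DIM(complex ^ 'n) = 2 * CARD('n)" by simp
        with emeasure_ball[OF less_imp_le[OF r(1)], of "0 :: complex ^ 'n"] show ?thesis by (simp only:)
      qed
      moreover have "r ^ (2 * CARD('n)) = (1 - t\<^sup>2) powr (CARD('n) / 2)"
        using True by (simp add: r_def powr_powr flip: powr_realpow)
      moreover have "t \<in> {-1<..<1}" using True by (auto simp: abs_square_less_1 abs_less_iff)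
      ultimately show ?thesis using unit_ball_vol_even[of "CARD('n)"] by (simp add: ennreal_mult')
    next
      case False
      then have "\<not> norm z ^ 4 + t\<^sup>2 < 1" for z :: "complex ^ 'n" using zero_le_power[OF norm_ge_zero, of z 4] by linarith
      then have "(\<lambda>z. (z, t)) -` ?B = {}" by (auto simp: heisenberg_unit_ball_def)
      moreover have "t \<notin> {-1<..<1}" using False by (auto simp: abs_square_less_1 abs_less_iff)
      ultimately show ?thesis by simp
    qed
  qed
  also have "\<dots> = ennreal ?u * (\<integral>\<^sup>+t. ennreal ((1 - t\<^sup>2) powr (CARD('n) / 2)) * indicator {-1<..<1} t \<partial>lborel)"
    by (rule nn_integral_cmult) measurable
  also have "(\<integral>\<^sup>+t. ennreal ((1 - t\<^sup>2) powr (CARD('n) / 2)) * indicator {-1<..<1} t \<partial>lborel)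
     = ennreal (2 * 4 powr (CARD('n) / 2) * Beta (CARD('n) / 2 + 1) (CARD('n) / 2 + 1))"
    by (rule nn_integral_one_minus_square_powr) (rule less_le_trans[of _ 0], auto)
  also have "ennreal ?u * \<dots> = ennreal (?u * (2 * 4 powr (CARD('n) / 2) * Beta (CARD('n) / 2 + 1) (CARD('n) / 2 + 1)))"
    by (rule ennreal_mult'[symmetric]) simp
  finally show ?thesis .
qed

lemma measure_heisenberg_unit_ball:
  "measure lborel (heisenberg_unit_ball :: ((complex ^ 'n::finite) \<times> real) set)
     = pi ^ CARD('n) / fact CARD('n) * (2 * 4 powr (CARD('n) / 2) * Beta (CARD('n) / 2 + 1) (CARD('n) / 2 + 1))"
  unfolding measure_def emeasure_heisenberg_unit_ball
proof (rule enn2real_ennreal)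
  have "real CARD('n) / 2 + 1 > 0" by (rule add_nonneg_pos) simp_all
  then have "Beta (real CARD('n) / 2 + 1) (real CARD('n) / 2 + 1) > 0"
    by (intro Beta_real_pos)
  then show "0 \<le> pi ^ CARD('n) / fact CARD('n) * (2 * 4 powr (CARD('n) / 2) * Beta (CARD('n) / 2 + 1) (CARD('n) / 2 + 1))"
    by simp
qed

lemma measure_heisenberg_unit_ball_pos:
  "measure lborel (heisenberg_unit_ball :: ((complex ^ 'n::finite) \<times> real) set) > 0"
proof -
  have "real CARD('n) / 2 + 1 > 0" by (rule add_nonneg_pos) simp_all
  then have "Beta (real CARD('n) / 2 + 1) (real CARD('n) / 2 + 1) > 0"
    by (intro Beta_real_pos)
  then show ?thesis unfolding measure_heisenberg_unit_ball by simp
qed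

text \<open>
  On the disc 1 - |w|^2 = 2 Re (1 - w) - |1 - w|^2 <= 2 Re (1 - w).  Dropping the last term enlarges
  the disc to a half plane, where the density is homogeneous.  Applied to indicator functions this says
  that the cap |1 - cdot xi eta| < r has area at most 2^n |B_1| r^(n + 1), where B_1 is the Heisenberg
  unit ball; the bound is asymptotically sharp for small r.
\<close>

lemma nn_integral_sphere_le_radial:
  fixes \<phi> :: "real \<Rightarrow> ennreal" and \<xi> :: "complex ^ ('n::finite option)"
  assumes xi: "norm \<xi> = 1" and [measurable]: "\<phi> \<in> borel_measurable borel"
  shows "(\<integral>\<^sup>+\<eta>. \<phi> (cmod (1 - cdot \<xi> \<eta>)) \<partial>sphere_measure)
     \<le> ennreal ((real CARD('n) + 1) * (2 ^ CARD('n) * measure lborel (heisenberg_unit_ball :: ((complex ^ 'n) \<times> real) set)))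
       * (\<integral>\<^sup>+\<rho>. \<phi> \<rho> * ennreal (\<rho> ^ CARD('n)) * indicator {0<..} \<rho> \<partial>lborel)"
proof -
  let ?n = "CARD('n)" and ?k = "CARD('n) - 1"
  let ?R = "\<integral>\<^sup>+\<rho>. \<phi> \<rho> * ennreal (\<rho> ^ ?n) * indicator {0<..} \<rho> \<partial>lborel"
  have "?n \<ge> 1" using zero_less_card_finite[where 'a = 'n] by linarith
  then have k: "real ?k = real ?n - 1" "?k + 1 = ?n" by (simp_all only: of_nat_diff of_nat_1 le_add_diff_inverse2)
  have n0: "real ?n > 0" by simp
  define \<beta> where "\<beta> = Beta (real ?n / 2) (real ?n / 2)"
  have b: "\<beta> > 0" unfolding \<beta>_def by (rule Beta_real_pos) simp_all
  have "(\<integral>\<^sup>+\<eta>. \<phi> (cmod (1 - cdot \<xi> \<eta>)) \<partial>sphere_measure)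
    = ennreal (slice_const ?n) * (\<integral>\<^sup>+x. \<integral>\<^sup>+y. \<phi> (sqrt (x\<^sup>2 + y\<^sup>2)) *
            (ennreal ((2 * x - (x\<^sup>2 + y\<^sup>2)) ^ ?k) * indicator {0<..} (2 * x - (x\<^sup>2 + y\<^sup>2))) \<partial>lborel \<partial>lborel)"
    by (rule nn_integral_sphere_eq_disc[OF assms])
  also have "\<dots> \<le> ennreal (slice_const ?n) * (\<integral>\<^sup>+x. \<integral>\<^sup>+y. ennreal (2 ^ ?k) * (\<phi> (sqrt (x\<^sup>2 + y\<^sup>2)) *
            ennreal (x ^ ?k) * indicator {0<..} x) \<partial>lborel \<partial>lborel)"
  proof (intro mult_left_mono nn_integral_mono zero_le)
    fix x y :: real
    have "ennreal ((2 * x - (x\<^sup>2 + y\<^sup>2)) ^ ?k) * indicator {0<..} (2 * x - (x\<^sup>2 + y\<^sup>2)) \<le> ennreal (2 ^ ?k) * (ennreal (x ^ ?k) * indicator {0<..} x)"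
    proof (cases "0 < 2 * x - (x\<^sup>2 + y\<^sup>2)")
      case True
      then have x: "x > 0" using sum_power2_ge_zero[of x y] by linarith
      have "(2 * x - (x\<^sup>2 + y\<^sup>2)) ^ ?k \<le> (2 * x) ^ ?k"
        using True sum_power2_ge_zero[of x y] by (intro power_mono) auto
      then have "ennreal ((2 * x - (x\<^sup>2 + y\<^sup>2)) ^ ?k) \<le> ennreal ((2 * x) ^ ?k)" by (rule ennreal_leI)
      also have "ennreal ((2 * x) ^ ?k) = ennreal (2 ^ ?k) * ennreal (x ^ ?k)"
        unfolding power_mult_distrib by (rule ennreal_mult') simp
      finally show ?thesis using True x by simp
    qed simp
    then have "\<phi> (sqrt (x\<^sup>2 + y\<^sup>2)) * (ennreal ((2 * x - (x\<^sup>2 + y\<^sup>2)) ^ ?k) * indicator {0<..} (2 * x - (x\<^sup>2 + y\<^sup>2)))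
       \<le> \<phi> (sqrt (x\<^sup>2 + y\<^sup>2)) * (ennreal (2 ^ ?k) * (ennreal (x ^ ?k) * indicator {0<..} x))"
      by (rule mult_left_mono) simp
    then show "\<phi> (sqrt (x\<^sup>2 + y\<^sup>2)) * (ennreal ((2 * x - (x\<^sup>2 + y\<^sup>2)) ^ ?k) * indicator {0<..} (2 * x - (x\<^sup>2 + y\<^sup>2)))
       \<le> ennreal (2 ^ ?k) * (\<phi> (sqrt (x\<^sup>2 + y\<^sup>2)) * ennreal (x ^ ?k) * indicator {0<..} x)"
      by (simp only: mult_ac)
  qed
  also have "(\<integral>\<^sup>+x. \<integral>\<^sup>+y. ennreal (2 ^ ?k) * (\<phi> (sqrt (x\<^sup>2 + y\<^sup>2)) * ennreal (x ^ ?k) * indicator {0<..} x) \<partial>lborel \<partial>lborel)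
     = ennreal (2 ^ ?k) * (\<integral>\<^sup>+x. \<integral>\<^sup>+y. \<phi> (sqrt (x\<^sup>2 + y\<^sup>2)) * ennreal (x ^ ?k) * indicator {0<..} x \<partial>lborel \<partial>lborel)"
    by (subst nn_integral_cmult[symmetric], measurable) (intro nn_integral_cong nn_integral_cmult, measurable)
  also have "(\<integral>\<^sup>+x. \<integral>\<^sup>+y. \<phi> (sqrt (x\<^sup>2 + y\<^sup>2)) * ennreal (x ^ ?k) * indicator {0<..} x \<partial>lborel \<partial>lborel)
     = (\<integral>\<^sup>+\<tau>. ennreal ((1 + \<tau>\<^sup>2) powr (-(real ?k + 2) / 2)) \<partial>lborel) * ?R"
    unfolding nn_integral_half_plane_polar[OF assms(2)] k(2) ..
  also have "(\<integral>\<^sup>+\<tau>. ennreal ((1 + \<tau>\<^sup>2) powr (-(real ?k + 2) / 2)) \<partial>lborel) = ennreal (2 * 4 powr (?n / 2 - 1) * \<beta>)"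
    using nn_integral_one_plus_square_powr[of "(real ?n + 1) / 2"] n0
    by (simp add: k \<beta>_def add_divide_distrib diff_divide_distrib algebra_simps)
  also have "ennreal (slice_const ?n) * (ennreal (2 ^ ?k) * (ennreal (2 * 4 powr (?n / 2 - 1) * \<beta>) * ?R))
     = ennreal (slice_const ?n * 2 ^ ?k * (2 * 4 powr (?n / 2 - 1) * \<beta>)) * ?R"
    using slice_const_pos[of ?n] b by (simp add: ennreal_mult mult.assoc)
  also have "slice_const ?n * 2 ^ ?k * (2 * 4 powr (?n / 2 - 1) * \<beta>)
     = (real ?n + 1) * (2 ^ ?n * measure lborel (heisenberg_unit_ball :: ((complex ^ 'n) \<times> real) set))"
  proof -
    define h where "h = real ?n / 2"
    have h: "h > 0" "real ?n = 2 * h" by (auto simp: h_def)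
    have nonp: "h \<notin> \<int>\<^sub>\<le>\<^sub>0" "2 * h \<notin> \<int>\<^sub>\<le>\<^sub>0" "2 * h + 1 \<notin> \<int>\<^sub>\<le>\<^sub>0" using h by (auto intro!: pos_not_nonpos_Int)
    have "Gamma (h + 1 + (h + 1)) = Gamma (2 * h + 1 + 1)" by (simp add: algebra_simps)
    also have "\<dots> = (2 * h + 1) * (2 * h * Gamma (2 * h))"
      by (subst Gamma_plus1[OF nonp(3)], subst Gamma_plus1[OF nonp(2)]) (rule refl)
    finally have G2: "Gamma (h + 1 + (h + 1)) = (2 * h + 1) * (2 * h * Gamma (2 * h))" .
    have Gpos: "Gamma (2 * h) > 0" "Gamma h > 0" using h by (auto intro!: Gamma_real_pos)
    have Be: "Beta (h + 1) (h + 1) * (2 * (2 * h + 1)) = h * Beta h h"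
    proof -
      have aux: "(x * G) * (x * G) / (q * (2 * x * D)) * (2 * q) = x * (G * G / D)"
        if "x \<noteq> 0" "q \<noteq> 0" "D \<noteq> 0" for x q G D :: real
        using that by simp
      have "h \<noteq> 0" "2 * h + 1 \<noteq> 0" using h(1) by auto
      moreover have "Gamma (2 * h) \<noteq> 0" using Gpos(1) by (rule less_imp_neq[THEN not_sym])
      ultimately show ?thesis using aux[of h "2 * h + 1" "Gamma (2 * h)" "Gamma h"]
        unfolding Beta_def G2 Gamma_plus1[OF nonp(1)] mult_2[symmetric, of h] by blast
    qed
    have f: "fact ?n = real ?n * fact ?k" by (rule fact_reduce) simp
    have p2: "(2::real) ^ ?n = 2 * 2 ^ ?k" by (metis k(2) power_Suc Suc_eq_plus1)
    have p4: "(4::real) powr h = 4 * 4 powr (h - 1)" by (simp add: powr_diff)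
    have "(real ?n + 1) * (2 ^ ?n * measure lborel (heisenberg_unit_ball :: ((complex ^ 'n) \<times> real) set))
       = (2 * h + 1) * (2 * 2 ^ ?k * (pi ^ ?n / (2 * h * fact ?k) * (2 * (4 * 4 powr (h - 1)) * Beta (h + 1) (h + 1))))"
      unfolding measure_heisenberg_unit_ball f p2 h(2) by (simp add: p4)
    also have "\<dots> = 2 ^ ?k * pi ^ ?n / (h * fact ?k) * 4 * 4 powr (h - 1) * (Beta (h + 1) (h + 1) * (2 * (2 * h + 1)))"
      using h by (simp add: field_simps)
    also have "\<dots> = 2 ^ ?k * pi ^ ?n / fact ?k * 4 * 4 powr (h - 1) * Beta h h"
      unfolding Be using h by (simp add: field_simps)
    also have "\<dots> = slice_const ?n * 2 ^ ?k * (2 * 4 powr (?n / 2 - 1) * \<beta>)"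
      by (simp add: slice_const_def \<beta>_def h_def field_simps)
    finally show ?thesis ..
  qed
  finally show ?thesis .
qed

section \<open>Potentials of functions bounded by one\<close>

text \<open>
  With p = 2 / (2 + mu) and k = x powr (mu * d), this is the maximum over 0 <= u <= 1 of
  u powr p / p - u * k; the maximum is attained at u = 1 exactly if x <= 1.
\<close>

definition young_profile :: "real \<Rightarrow> real \<Rightarrow> real \<Rightarrow> real" where
  "young_profile \<mu> d x = (if x \<le> 1 then 1 + \<mu> / 2 - x powr (\<mu> * d) else \<mu> / 2 * x powr (- 2 * d))"

lemma young_profile_measurable[measurable]: "young_profile \<mu> d \<in> borel_measurable borel"
  unfolding young_profile_def by measurable

lemma young_profile_nonneg:
  assumes "\<mu> > 0" "d > 0" "x \<ge> 0"
  shows "young_profile \<mu> d x \<ge> 0"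
proof (cases "x \<le> 1")
  case True
  then have "x powr (\<mu> * d) \<le> 1" using assms by (simp add: powr_le1)
  then show ?thesis using True assms by (simp add: young_profile_def)
qed (use assms in \<open>simp add: young_profile_def\<close>)

text \<open>
  For x <= 1 compare u powr p with its tangent at 1, for x > 1 with its tangent at the point v where
  the derivative of u powr p / p equals k = x powr (mu * d).  Both are instances of the weighted
  arithmetic-geometric mean inequality.
\<close>

lemma young_profile_inequality:
  fixes u x :: real
  assumes mu: "\<mu> > 0" and d: "d > 0" and u: "0 \<le> u" "u \<le> 1" and x: "x \<ge> 0"
  shows "(1 + \<mu> / 2) * u powr (2 / (2 + \<mu>)) \<le> u * x powr (\<mu> * d) + young_profile \<mu> d x"
proof (cases "u = 0")
  case True
  then show ?thesis using young_profile_nonneg[OF mu d x] by simp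
next
  case False
  then have u0: "u > 0" using u by simp
  define p where "p = 2 / (2 + \<mu>)"
  have p: "0 < p" "p < 1" "(1 + \<mu> / 2) * p = 1" "(1 + \<mu> / 2) * (1 - p) = \<mu> / 2"
    using mu by (simp_all add: p_def field_simps)
  define k where "k = x powr (\<mu> * d)"
  have young: "u powr p * v powr (1 - p) \<le> p * u + (1 - p) * v" if "v > 0" for v
    using Youngs_inequality_0[of p "1 - p" u v] p u0 that by simp
  show ?thesis
  proof (cases "x \<le> 1")
    case True
    have k: "k \<le> 1" using True x mu d by (simp add: k_def powr_le1)
    have "(1 + \<mu> / 2) * u powr p \<le> (1 + \<mu> / 2) * (p * u + (1 - p))"
      using young[of 1] mu by (intro mult_left_mono) auto
    also have "\<dots> = ((1 + \<mu> / 2) * p) * u + (1 + \<mu> / 2) * (1 - p)" by (simp only: distrib_left mult.assoc)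
    also have "\<dots> = u + \<mu> / 2" by (simp only: p mult_1_left)
    also have "\<dots> \<le> u * k + (1 + \<mu> / 2 - k)"
      using mult_nonneg_nonneg[of "1 - u" "1 - k"] k u by (simp add: algebra_simps)
    finally show ?thesis using True by (simp add: young_profile_def k_def p_def)
  next
    case False
    have k: "k > 0" using False by (simp add: k_def)
    \<comment> \<open>the contact point of the tangent with slope k\<close>
    define v where "v = k powr (-1 / (1 - p))"
    have v: "v > 0" using k by (simp add: v_def)
    have "v powr (1 - p) = k powr (-1)" using p unfolding v_def powr_powr by simp
    then have vk: "v powr (1 - p) * k = 1" using k by (simp add: powr_minus)
    have "-1 / (1 - p) + 1 = - 2 / \<mu>" using mu by (simp add: p_def field_simps)
    then have "v * k = k powr (- 2 / \<mu>)"
      using k powr_add[of k "-1 / (1 - p)" 1] by (simp add: v_def)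
    also have "\<dots> = x powr (\<mu> * d * (- 2 / \<mu>))" unfolding k_def by (rule powr_powr)
    also have "\<mu> * d * (- 2 / \<mu>) = - 2 * d" using mu by simp
    finally have vk2: "v * k = x powr (- 2 * d)" .
    have "u powr p = u powr p * v powr (1 - p) * k" using vk by (simp add: mult.assoc)
    also have "\<dots> \<le> (p * u + (1 - p) * v) * k"
      using young[OF v] k by (intro mult_right_mono) auto
    finally have "(1 + \<mu> / 2) * u powr p \<le> (1 + \<mu> / 2) * ((p * u + (1 - p) * v) * k)"
      using mu by (intro mult_left_mono) auto
    also have "\<dots> = ((1 + \<mu> / 2) * p) * (u * k) + ((1 + \<mu> / 2) * (1 - p)) * (v * k)"
      by (simp only: distrib_left distrib_right mult_ac)
    also have "\<dots> = u * k + \<mu> / 2 * x powr (- 2 * d)" unfolding p vk2 by simp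
    finally show ?thesis using False by (simp add: young_profile_def k_def p_def)
  qed
qed

lemma nn_integral_young_profile:
  assumes mu: "\<mu> > 0"
  shows "(\<integral>\<^sup>+x. ennreal (young_profile \<mu> (real n + 1) x) * ennreal (x ^ n) * indicator {0<..} x \<partial>lborel)
       = ennreal (\<mu> * (2 + \<mu>) / ((1 + \<mu>) * (real n + 1)))"
proof -
  let ?d = "real n + 1"
  define f where "f x = (1 + \<mu> / 2) * x powr real n - x powr (\<mu> * ?d + real n)" for x
  define g where "g x = \<mu> / 2 * x powr (- 2 * ?d + real n)" for x
  have e: "\<mu> * ?d + real n > -1" "- 2 * ?d + real n < -1" using mu by (simp_all add: add_nonneg_pos less_le_trans[of "-1" 0])
  have md: "\<mu> * ?d \<ge> 0" using mu by simp
  have "(f has_integral ((1 + \<mu> / 2) * (1 powr (real n + 1) / (real n + 1)) - 1 powr (\<mu> * ?d + real n + 1) / (\<mu> * ?d + real n + 1))) {0..1}"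
    unfolding f_def using e by (intro has_integral_diff has_integral_mult_right has_integral_powr_from_0) auto
  then have f: "(\<integral>\<^sup>+x. ennreal (f x) * indicator {0..1} x \<partial>lborel) = ennreal ((1 + \<mu> / 2) / ?d - 1 / (\<mu> * ?d + real n + 1))"
  proof (subst nn_integral_has_integral_lebesgue')
    fix x :: real assume x: "x \<in> {0..1}"
    have "x powr (\<mu> * ?d + real n) \<le> x powr real n" using x md by (intro powr_mono') auto
    also have "\<dots> \<le> (1 + \<mu> / 2) * x powr real n" using mu by (simp add: mult_le_cancel_right1)
    finally show "0 \<le> f x" by (simp add: f_def)
  qed auto
  have "(g has_integral (\<mu> / 2 * (-(1 powr (- 2 * ?d + real n + 1)) / (- 2 * ?d + real n + 1)))) {1..}"
    unfolding g_def using e by (intro has_integral_mult_right has_integral_powr_to_inf) auto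
  then have g: "(\<integral>\<^sup>+x. ennreal (g x) * indicator {1..} x \<partial>lborel) = ennreal (\<mu> / 2 / ?d)"
  proof (subst nn_integral_has_integral_lebesgue')
    have aux: "\<mu> / 2 * (-(1 powr (- D)) / (- D)) = \<mu> / 2 / D" for D :: real by simp
    have "- 2 * ?d + real n + 1 = - ?d" by simp
    then show "ennreal (\<mu> / 2 * (-(1 powr (- 2 * ?d + real n + 1)) / (- 2 * ?d + real n + 1))) = ennreal (\<mu> / 2 / ?d)"
      by (simp only: aux)
  qed (use mu in \<open>auto simp: g_def\<close>)
  have [measurable]: "f \<in> borel_measurable borel" "g \<in> borel_measurable borel" unfolding f_def g_def by measurable
  have "(\<integral>\<^sup>+x. ennreal (young_profile \<mu> ?d x) * ennreal (x ^ n) * indicator {0<..} x \<partial>lborel)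
     = (\<integral>\<^sup>+x. ennreal (f x) * indicator {0..1} x + ennreal (g x) * indicator {1..} x \<partial>lborel)"
  proof (rule nn_integral_cong_AE)
    have "AE x in lborel. x \<noteq> 1" "AE x in lborel. x \<noteq> (0::real)" by (rule AE_lborel_singleton)+
    then show "AE x in lborel. ennreal (young_profile \<mu> ?d x) * ennreal (x ^ n) * indicator {0<..} x
        = ennreal (f x) * indicator {0..1} x + ennreal (g x) * indicator {1..} x"
    proof eventually_elim
      fix x :: real assume "x \<noteq> 1" "x \<noteq> 0"
      then consider "x < 0" | "0 < x" "x < 1" | "1 < x" by linarith
      then show "ennreal (young_profile \<mu> ?d x) * ennreal (x ^ n) * indicator {0<..} x
        = ennreal (f x) * indicator {0..1} x + ennreal (g x) * indicator {1..} x"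
      proof cases
        case 2
        have "young_profile \<mu> ?d x * x ^ n = f x"
          using 2 by (simp add: young_profile_def f_def powr_add algebra_simps flip: powr_realpow)
        then show ?thesis using 2 by (simp flip: ennreal_mult'')
      next
        case 3
        have "young_profile \<mu> ?d x * x ^ n = g x"
        proof -
          have "young_profile \<mu> ?d x = \<mu> / 2 * x powr (- 2 * ?d)" "x powr real n = x ^ n"
            using 3 by (simp_all add: young_profile_def powr_realpow)
          then show ?thesis by (simp only: g_def powr_add mult.assoc)
        qed
        then show ?thesis using 3 by (simp flip: ennreal_mult'')
      qed auto
    qed
  qed
  also have "\<dots> = ennreal ((1 + \<mu> / 2) / ?d - 1 / (\<mu> * ?d + real n + 1)) + ennreal (\<mu> / 2 / ?d)"
    by (subst nn_integral_add) (simp_all add: f g)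
  also have "\<dots> = ennreal ((1 + \<mu> / 2) / ?d - 1 / (\<mu> * ?d + real n + 1) + \<mu> / 2 / ?d)"
  proof (rule ennreal_plus[symmetric])
    have "1 / (\<mu> * ?d + real n + 1) \<le> 1 / ?d" using md by (intro divide_left_mono) (auto intro!: mult_pos_pos add_nonneg_pos)
    also have "\<dots> \<le> (1 + \<mu> / 2) / ?d" using mu by (intro divide_right_mono) auto
    finally show "0 \<le> (1 + \<mu> / 2) / ?d - 1 / (\<mu> * ?d + real n + 1)" by simp
  qed (use mu in auto)
  also have "(1 + \<mu> / 2) / ?d - 1 / (\<mu> * ?d + real n + 1) + \<mu> / 2 / ?d = \<mu> * (2 + \<mu>) / ((1 + \<mu>) * ?d)"
  proof -
    have 1: "\<mu> * ?d + real n + 1 = (1 + \<mu>) * ?d" by (simp add: algebra_simps)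
    have aux: "(1 + \<mu> / 2) / D - 1 / ((1 + \<mu>) * D) + \<mu> / 2 / D = \<mu> * (2 + \<mu>) / ((1 + \<mu>) * D)" if "D > 0" for D :: real
      using that mu by (simp add: divide_simps) (simp add: algebra_simps)
    show ?thesis unfolding 1 by (rule aux) simp
  qed
  finally show ?thesis .
qed

lemma nn_integral_young_profile_scaled:
  assumes mu: "\<mu> > 0" and r: "r > 0"
  shows "(\<integral>\<^sup>+\<rho>. ennreal (young_profile \<mu> (real n + 1) (\<rho> / r)) * ennreal (\<rho> ^ n) * indicator {0<..} \<rho> \<partial>lborel)
       = ennreal (r ^ (n + 1) * (\<mu> * (2 + \<mu>) / ((1 + \<mu>) * (real n + 1))))"
proof -
  let ?h = "young_profile \<mu> (real n + 1)"
  have "(\<integral>\<^sup>+\<rho>. ennreal (?h (\<rho> / r)) * ennreal (\<rho> ^ n) * indicator {0<..} \<rho> \<partial>lborel)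
     = ennreal \<bar>r\<bar> * (\<integral>\<^sup>+x. ennreal (?h ((0 + r * x) / r)) * ennreal ((0 + r * x) ^ n) * indicator {0<..} (0 + r * x) \<partial>lborel)"
    by (rule nn_integral_real_affine) (measurable, use r in simp)
  also have "(\<lambda>x. ennreal (?h ((0 + r * x) / r)) * ennreal ((0 + r * x) ^ n) * indicator {0<..} (0 + r * x))
     = (\<lambda>x. ennreal (r ^ n) * (ennreal (?h x) * ennreal (x ^ n) * indicator {0<..} x))"
  proof
    fix x :: real
    show "ennreal (?h ((0 + r * x) / r)) * ennreal ((0 + r * x) ^ n) * indicator {0<..} (0 + r * x)
      = ennreal (r ^ n) * (ennreal (?h x) * ennreal (x ^ n) * indicator {0<..} x)"
    proof (cases "x > 0")
      case True
      have "ennreal ((0 + r * x) ^ n) = ennreal (r ^ n) * ennreal (x ^ n)"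
        unfolding add_0 power_mult_distrib by (rule ennreal_mult') (use r in simp)
      moreover have "(0 + r * x) / r = x" "0 + r * x > 0" using r True by simp_all
      ultimately show ?thesis using True by (simp add: mult_ac)
    next
      case False
      then have "\<not> 0 + r * x > 0" using r by (simp add: zero_less_mult_iff)
      then show ?thesis using False by simp
    qed
  qed
  also have "ennreal \<bar>r\<bar> * (\<integral>\<^sup>+x. ennreal (r ^ n) * (ennreal (?h x) * ennreal (x ^ n) * indicator {0<..} x) \<partial>lborel)
    = ennreal r * (ennreal (r ^ n) * ennreal (\<mu> * (2 + \<mu>) / ((1 + \<mu>) * (real n + 1))))"
    using r by (subst nn_integral_cmult) (simp_all add: nn_integral_young_profile[OF mu])
  also have "\<dots> = ennreal (r ^ (n + 1) * (\<mu> * (2 + \<mu>) / ((1 + \<mu>) * (real n + 1))))"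
  proof -
    have "ennreal (r ^ (n + 1)) = ennreal r * ennreal (r ^ n)"
      unfolding Suc_eq_plus1[symmetric] power_Suc by (rule ennreal_mult') (use r in simp)
    then show ?thesis
      using r by (subst ennreal_mult') (auto simp: mult.assoc)
  qed
  finally show ?thesis .
qed

lemma borel_measurable_sphere_measure:
  assumes "f \<in> borel_measurable borel"
  shows "f \<in> borel_measurable sphere_measure"
  unfolding sphere_measure_def
proof (rule measurable_completion)
  have "f \<in> borel_measurable (restrict_space borel (sphere 0 1))"
    using assms by (rule measurable_restrict_space1)
  then show "f \<in> borel_measurable (scale_measure (ennreal (real DIM('a)))
     (distr (restrict_space lborel (ball 0 1 - {0})) (restrict_space borel (sphere 0 1)) sgn))"
    by (simp add: measurable_def space_scale_measure space_restrict_space)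
qed

lemma finite_measure_sphere_measure: "finite_measure (sphere_measure :: 'a::euclidean_space measure)"
proof
  show "emeasure (sphere_measure :: 'a measure) (space sphere_measure) \<noteq> \<infinity>"
    unfolding space_sphere_measure emeasure_sphere_measure_sphere by simp
qed

lemma cdot_measurable[measurable]: "(\<lambda>\<eta>. cdot \<xi> \<eta>) \<in> borel_measurable borel"
  unfolding cdot_def by (intro borel_measurable_continuous_onI continuous_intros)

text \<open>
  Among functions u with values in [0, 1] and a given integral X of u powr p, the potential at xi is
  smallest if u is concentrated near xi, as the kernel vanishes there.  Quantitatively, the
  inequality for the Young profile is integrated with x = |1 - cdot xi eta| / r; the integral
  of the profile is bounded by that over a half plane, and r is chosen such that
  C r^(n + 1) = X / 2, which gives the best bound.
\<close>

lemma capped_potential_lower_bound: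
  fixes u :: "complex ^ ('n::finite option) \<Rightarrow> real"
  defines "C \<equiv> 2 ^ CARD('n) * measure lborel (heisenberg_unit_ball :: ((complex ^ 'n) \<times> real) set)"
  assumes mu: "\<mu> > 0" and um: "u \<in> borel_measurable sphere_measure"
    and u: "\<And>\<eta>. norm \<eta> = 1 \<Longrightarrow> 0 \<le> u \<eta> \<and> u \<eta> \<le> 1" and xi: "norm \<xi> = 1"
  shows "ennreal ((2 * C) powr (-\<mu>) * (1 + \<mu> / 2) / (1 + \<mu>) * (\<integral>\<eta>. u \<eta> powr (2 / (2 + \<mu>)) \<partial>sphere_measure) powr (1 + \<mu>))
     \<le> (\<integral>\<^sup>+\<eta>. ennreal (u \<eta> * cmod (1 - cdot \<xi> \<eta>) powr (\<mu> * (real CARD('n) + 1))) \<partial>sphere_measure)"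
    (is "_ \<le> ?I")
proof -
  let ?\<sigma> = "sphere_measure :: (complex ^ ('n option)) measure"
  let ?d = "real CARD('n) + 1" and ?p = "2 / (2 + \<mu>)"
  interpret finite_measure ?\<sigma> by (rule finite_measure_sphere_measure)
  note [measurable] = um borel_measurable_sphere_measure[OF cdot_measurable]
  have C: "C > 0" unfolding C_def using measure_heisenberg_unit_ball_pos[where 'n = 'n] by simp
  define X where "X = (\<integral>\<eta>. u \<eta> powr ?p \<partial>?\<sigma>)"
  have int: "integrable ?\<sigma> (\<lambda>\<eta>. u \<eta> powr ?p)"
  proof (rule integrable_const_bound[of _ 1])
    show "AE \<eta> in ?\<sigma>. norm (u \<eta> powr ?p) \<le> 1"
      by (rule AE_I2) (use u mu in \<open>auto simp: space_sphere_measure intro!: powr_le1\<close>)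
  qed measurable
  have X0: "X \<ge> 0" unfolding X_def by simp
  show ?thesis
  proof (cases "X = 0 \<or> ?I = \<infinity>")
    case True
    then show ?thesis by (auto simp: X_def)
  next
    case False
    then have X: "X > 0" and "?I \<noteq> \<infinity>" using X0 by auto
    then obtain I where I: "?I = ennreal I" "I \<ge> 0" by (cases ?I) auto
    \<comment> \<open>the radius at which the bound for the area of a cap equals X / 2\<close>
    define r where "r = (X / (2 * C)) powr (1 / ?d)"
    have r: "r > 0" using X C by (simp add: r_def)
    have rd: "r ^ (CARD('n) + 1) = X / (2 * C)"
    proof -
      have "r ^ (CARD('n) + 1) = r powr ?d" using powr_realpow[OF r, of "CARD('n) + 1"] by (simp add: add.commute)
      also have "\<dots> = X / (2 * C)" unfolding r_def powr_powr using X C by simp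
      finally show ?thesis .
    qed
    have rmu: "r powr (\<mu> * ?d) = (X / (2 * C)) powr \<mu>" unfolding r_def powr_powr by simp
    let ?h = "young_profile \<mu> ?d"
    have "(\<integral>\<^sup>+\<eta>. ennreal (?h (cmod (1 - cdot \<xi> \<eta>) / r)) \<partial>?\<sigma>)
       \<le> ennreal (?d * C) * (\<integral>\<^sup>+\<rho>. ennreal (?h (\<rho> / r)) * ennreal (\<rho> ^ CARD('n)) * indicator {0<..} \<rho> \<partial>lborel)"
      unfolding C_def by (rule nn_integral_sphere_le_radial[OF xi, of "\<lambda>\<rho>. ennreal (?h (\<rho> / r))"]) measurable
    also have "\<dots> = ennreal (?d * C) * ennreal (r ^ (CARD('n) + 1) * (\<mu> * (2 + \<mu>) / ((1 + \<mu>) * ?d)))"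
      unfolding nn_integral_young_profile_scaled[OF mu r] ..
    also have "\<dots> = ennreal ((1 + \<mu> / 2) * X * \<mu> / (1 + \<mu>))"
    proof -
      have aux: "(D * C) * (X / (2 * C) * (\<mu> * (2 + \<mu>) / ((1 + \<mu>) * D))) = (1 + \<mu> / 2) * X * \<mu> / (1 + \<mu>)" if "D > 0" for D :: real
        using that mu C by (simp add: divide_simps)
      have "(?d * C) * (r ^ (CARD('n) + 1) * (\<mu> * (2 + \<mu>) / ((1 + \<mu>) * ?d))) = (1 + \<mu> / 2) * X * \<mu> / (1 + \<mu>)"
        unfolding rd by (rule aux) simp
      moreover have "ennreal (?d * C) * ennreal (r ^ (CARD('n) + 1) * (\<mu> * (2 + \<mu>) / ((1 + \<mu>) * ?d)))
          = ennreal ((?d * C) * (r ^ (CARD('n) + 1) * (\<mu> * (2 + \<mu>) / ((1 + \<mu>) * ?d))))"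
        by (rule ennreal_mult'[symmetric]) (use C in simp)
      ultimately show ?thesis by (simp only:)
    qed
    finally have radial: "(\<integral>\<^sup>+\<eta>. ennreal (?h (cmod (1 - cdot \<xi> \<eta>) / r)) \<partial>?\<sigma>) \<le> ennreal ((1 + \<mu> / 2) * X * \<mu> / (1 + \<mu>))" .
    have "ennreal ((1 + \<mu> / 2) * X) = (\<integral>\<^sup>+\<eta>. ennreal ((1 + \<mu> / 2) * u \<eta> powr ?p) \<partial>?\<sigma>)"
      unfolding X_def using int mu by (subst nn_integral_eq_integral) auto
    also have "\<dots> \<le> (\<integral>\<^sup>+\<eta>. ennreal (r powr (-(\<mu> * ?d))) * ennreal (u \<eta> * cmod (1 - cdot \<xi> \<eta>) powr (\<mu> * ?d))
          + ennreal (?h (cmod (1 - cdot \<xi> \<eta>) / r)) \<partial>?\<sigma>)"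
    proof (rule nn_integral_mono)
      fix \<eta> assume "\<eta> \<in> space ?\<sigma>"
      then have u\<eta>: "0 \<le> u \<eta>" "u \<eta> \<le> 1" using u by (auto simp: space_sphere_measure)
      let ?x = "cmod (1 - cdot \<xi> \<eta>)"
      have x: "?x / r \<ge> 0" using r by simp
      have d: "?d > 0" by simp
      have "(1 + \<mu> / 2) * u \<eta> powr ?p \<le> u \<eta> * (?x / r) powr (\<mu> * ?d) + ?h (?x / r)"
        by (rule young_profile_inequality[OF mu d u\<eta> x])
      also have "(?x / r) powr (\<mu> * ?d) = r powr (-(\<mu> * ?d)) * ?x powr (\<mu> * ?d)"
        using r by (simp add: powr_divide powr_minus_divide)
      finally have "ennreal ((1 + \<mu> / 2) * u \<eta> powr ?p)
          \<le> ennreal (r powr (-(\<mu> * ?d)) * (u \<eta> * ?x powr (\<mu> * ?d)) + ?h (?x / r))"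
        by (intro ennreal_leI) (simp add: mult_ac)
      also have "\<dots> = ennreal (r powr (-(\<mu> * ?d)) * (u \<eta> * ?x powr (\<mu> * ?d))) + ennreal (?h (?x / r))"
        using u\<eta> young_profile_nonneg[OF mu d x] by (intro ennreal_plus) auto
      also have "ennreal (r powr (-(\<mu> * ?d)) * (u \<eta> * ?x powr (\<mu> * ?d))) = ennreal (r powr (-(\<mu> * ?d))) * ennreal (u \<eta> * ?x powr (\<mu> * ?d))"
        by (rule ennreal_mult') simp
      finally show "ennreal ((1 + \<mu> / 2) * u \<eta> powr ?p) \<le> ennreal (r powr (-(\<mu> * ?d))) * ennreal (u \<eta> * ?x powr (\<mu> * ?d)) + ennreal (?h (?x / r))" .
    qed
    also have "\<dots> = ennreal (r powr (-(\<mu> * ?d))) * ?I + (\<integral>\<^sup>+\<eta>. ennreal (?h (cmod (1 - cdot \<xi> \<eta>) / r)) \<partial>?\<sigma>)"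
      by (subst nn_integral_add, measurable) (subst nn_integral_cmult, measurable)
    also have "\<dots> \<le> ennreal (r powr (-(\<mu> * ?d))) * ?I + ennreal ((1 + \<mu> / 2) * X * \<mu> / (1 + \<mu>))"
      using radial by (rule add_left_mono)
    also have "\<dots> = ennreal (r powr (-(\<mu> * ?d)) * I + (1 + \<mu> / 2) * X * \<mu> / (1 + \<mu>))"
      unfolding I(1) using I(2) mu X by (simp add: ennreal_mult')
    finally have "(1 + \<mu> / 2) * X \<le> r powr (-(\<mu> * ?d)) * I + (1 + \<mu> / 2) * X * \<mu> / (1 + \<mu>)"
      using I(2) mu X by (subst (asm) ennreal_le_iff) (auto intro!: add_nonneg_nonneg)
    moreover have "(1 + \<mu> / 2) * X - (1 + \<mu> / 2) * X * \<mu> / (1 + \<mu>) = (1 + \<mu> / 2) * X / (1 + \<mu>)"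
      using mu by (simp add: divide_simps) (simp add: algebra_simps)
    ultimately have "(1 + \<mu> / 2) * X / (1 + \<mu>) \<le> r powr (-(\<mu> * ?d)) * I" by linarith
    then have "r powr (\<mu> * ?d) * ((1 + \<mu> / 2) * X / (1 + \<mu>)) \<le> r powr (\<mu> * ?d) * (r powr (-(\<mu> * ?d)) * I)"
      by (rule mult_left_mono) simp
    also have "\<dots> = I" using r by (simp add: powr_minus)
    also have "r powr (\<mu> * ?d) * ((1 + \<mu> / 2) * X / (1 + \<mu>)) = (2 * C) powr (-\<mu>) * (1 + \<mu> / 2) / (1 + \<mu>) * X powr (1 + \<mu>)"
      unfolding rmu using X C by (simp add: powr_divide powr_minus_divide powr_add)
    finally show ?thesis unfolding I(1) X_def by (rule ennreal_leI)
  qed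
qed

section \<open>The energy of two functions\<close>

text \<open>
  A nonnegative function is split at height 1.  Half of the lower part stays in the remainder, so that
  cap f * rest g + rest f * cap g contains the product of the two lower parts exactly once.
\<close>

definition cap :: "real \<Rightarrow> real" where "cap s = min s 1"
definition rest :: "real \<Rightarrow> real" where "rest s = s - cap s / 2"

lemma cap_rest_measurable[measurable]: "cap \<in> borel_measurable borel" "rest \<in> borel_measurable borel"
  unfolding cap_def rest_def by measurable

lemma cap_rest_product: "cap s * rest t + rest s * cap t \<le> s * t"
proof -
  have "s * t - (cap s * rest t + rest s * cap t) = (s - cap s) * (t - cap t)"
    by (simp add: rest_def algebra_simps)
  moreover have "0 \<le> (s - cap s) * (t - cap t)" by (intro mult_nonneg_nonneg) (auto simp: cap_def)
  ultimately show ?thesis by linarith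
qed

lemma one_plus_le_two_powr:
  fixes \<mu> :: real
  assumes "\<mu> \<ge> 0" shows "1 + \<mu> \<le> 2 powr (3 * \<mu> / 2)"
proof -
  have "\<mu> * (2 / 3) \<le> \<mu> * ln 2" using assms ln2_ge_two_thirds by (intro mult_left_mono)
  then have "1 + \<mu> \<le> 1 + 3 * \<mu> / 2 * ln 2" by simp
  also have "\<dots> \<le> exp (3 * \<mu> / 2 * ln 2)" by (rule exp_ge_add_one_self)
  finally show ?thesis by (simp add: powr_def)
qed

lemma one_plus_le_two_powr_large:
  fixes \<mu> :: real
  assumes "\<mu> \<ge> 1" shows "1 + \<mu> \<le> 2 powr \<mu>"
proof -
  have "(\<mu> - 1) * (2 / 3) \<le> (\<mu> - 1) * ln 2" using assms ln2_ge_two_thirds by (intro mult_left_mono) auto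
  then have "1 + \<mu> \<le> 2 * (1 + (\<mu> - 1) * ln 2)" using assms by argo
  also have "\<dots> \<le> 2 * exp ((\<mu> - 1) * ln 2)" by (intro mult_left_mono exp_ge_add_one_self) auto
  also have "\<dots> = 2 powr \<mu>" by (simp add: powr_def algebra_simps exp_diff)
  finally show ?thesis .
qed

text \<open>
  The factor (1 + mu) 2^(-mu), which may exceed 1 for mu < 1, compensates the loss of 1 / (1 + mu) in the
  potential bound.  Let s > 1 and write y for s powr p, so that the claim compares the convex function s of y with a
  multiple of y - 1.  For mu >= 1 the factor is at most 1 and the tangent at y = 1 suffices; for mu < 1
  the tangent at y = 2 is steep enough, and the gap is covered by the 1/2 that the remainder keeps.
\<close>

lemma rest_lower_bound:
  assumes mu: "\<mu> > 0" and s: "s \<ge> 0"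
  shows "(1 + \<mu>) * 2 powr (-\<mu>) * (1 + \<mu> / 2) * (s powr (2 / (2 + \<mu>)) - cap s powr (2 / (2 + \<mu>))) \<le> rest s"
proof (cases "s \<le> 1")
  case True
  then show ?thesis using s by (simp add: cap_def rest_def)
next
  case False
  then have s: "s > 1" by simp
  define p where "p = 2 / (2 + \<mu>)"
  define k where "k = (1 + \<mu>) * 2 powr (-\<mu>)"
  define y where "y = s powr p"
  have p: "0 < p" "p < 1" "(1 + \<mu> / 2) * p = 1" "(1 + \<mu> / 2) * (1 - p) = \<mu> / 2"
    using mu by (simp_all add: p_def field_simps)
  have y: "y \<ge> 1" using s p by (simp add: y_def ge_one_powr_ge_zero)
  have k0: "k \<ge> 0" using mu by (simp add: k_def)
  have young: "(1 + \<mu> / 2) * (y * v powr (1 - p)) \<le> s + \<mu> / 2 * v" if "v > 0" for v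
  proof -
    have "y * v powr (1 - p) \<le> p * s + (1 - p) * v"
      using Youngs_inequality_0[of p "1 - p" s v] p s that by (simp add: y_def)
    then have "(1 + \<mu> / 2) * (y * v powr (1 - p)) \<le> (1 + \<mu> / 2) * (p * s + (1 - p) * v)"
      using mu by (intro mult_left_mono) auto
    also have "\<dots> = ((1 + \<mu> / 2) * p) * s + ((1 + \<mu> / 2) * (1 - p)) * v"
      by (simp only: distrib_left mult.assoc)
    finally show ?thesis by (simp only: p mult_1_left)
  qed
  have "k * (1 + \<mu> / 2) * (y - 1) \<le> s - 1 / 2"
  proof (cases "\<mu> \<ge> 1")
    case True
    have "k \<le> 1" using one_plus_le_two_powr_large[OF True] by (simp add: k_def powr_minus divide_simps)
    then have "k * ((1 + \<mu> / 2) * (y - 1)) \<le> 1 * ((1 + \<mu> / 2) * (y - 1))"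
      using mu y by (intro mult_right_mono) auto
    also have "\<dots> = (1 + \<mu> / 2) * (y * 1 powr (1 - p)) - (1 + \<mu> / 2)"
      by (simp only: powr_one_eq_one mult_1_left mult_1_right right_diff_distrib)
    also have "\<dots> \<le> s - 1" using young[of 1] by linarith
    finally show ?thesis by simp
  next
    case False
    define h where "h = 2 powr (\<mu> / 2)"
    have h: "h \<ge> 1" using mu by (simp add: h_def ge_one_powr_ge_zero)
    have "1 + \<mu> \<le> h * 2 powr \<mu>"
      using one_plus_le_two_powr[of \<mu>] mu by (simp add: h_def flip: powr_add)
    then have kh: "k \<le> h" by (simp add: k_def powr_minus divide_simps)
    \<comment> \<open>the tangent at y = 2, that is, at s = 2 powr (1 / p)\<close>
    have v1: "(2 powr (1 + \<mu> / 2)) powr (1 - p) = h"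
      unfolding powr_powr h_def p(4) ..
    have v2: "2 powr (1 + \<mu> / 2) = 2 * h" by (simp add: h_def powr_add)
    have "(1 + \<mu> / 2) * (y * h) \<le> s + \<mu> / 2 * (2 * h)"
      using young[of "2 powr (1 + \<mu> / 2)", unfolded v1, unfolded v2] h by simp
    moreover have "k * ((1 + \<mu> / 2) * (y - 1)) \<le> h * ((1 + \<mu> / 2) * (y - 1))"
      using kh mu y by (intro mult_right_mono) auto
    moreover have "1 * (1 / 2) \<le> h * (1 - \<mu> / 2)" using h False by (intro mult_mono) auto
    moreover have "h * ((1 + \<mu> / 2) * (y - 1)) = (1 + \<mu> / 2) * (y * h) - h * (1 + \<mu> / 2)"
      "\<mu> / 2 * (2 * h) - h * (1 + \<mu> / 2) = -(h * (1 - \<mu> / 2))"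
      "k * (1 + \<mu> / 2) * (y - 1) = k * ((1 + \<mu> / 2) * (y - 1))"
      by (simp_all add: field_simps)
    ultimately show ?thesis by linarith
  qed
  then show ?thesis using s by (simp add: cap_def rest_def k_def p_def y_def)
qed

lemma powr_product_symmetrized:
  fixes a b \<mu> :: real
  assumes "a > 0" "b > 0"
  shows "2 * (a * b) powr (1 + \<mu> / 2) \<le> a powr (1 + \<mu>) * b + b powr (1 + \<mu>) * a"
proof -
  have "2 * (a powr (\<mu> / 2) * b powr (\<mu> / 2)) \<le> (a powr (\<mu> / 2))\<^sup>2 + (b powr (\<mu> / 2))\<^sup>2"
    using sum_squares_bound[of "a powr (\<mu> / 2)" "b powr (\<mu> / 2)"] by simp
  also have "\<dots> = a powr \<mu> + b powr \<mu>" by (simp add: power2_eq_square flip: powr_add)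
  finally have "(a * b) * (2 * (a powr (\<mu> / 2) * b powr (\<mu> / 2))) \<le> (a * b) * (a powr \<mu> + b powr \<mu>)"
    using assms by (intro mult_left_mono) auto
  then show ?thesis using assms by (simp add: powr_add powr_mult algebra_simps)
qed

text \<open>
  Joint measurability is needed to exchange the two integrals over the sphere.
\<close>

lemma kernel_measurable[measurable]:
  "(\<lambda>z. cmod (1 - cdot (fst z) (snd z))) \<in> borel_measurable
     ((sphere_measure :: (complex ^ 'm::finite) measure) \<Otimes>\<^sub>M sphere_measure)"
proof -
  have [measurable]: "(\<lambda>\<xi>. \<xi> $ j) \<in> borel_measurable (sphere_measure :: (complex ^ 'm) measure)"
    "(\<lambda>\<xi>. cnj (\<xi> $ j)) \<in> borel_measurable (sphere_measure :: (complex ^ 'm) measure)" for j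
    by (intro borel_measurable_sphere_measure borel_measurable_continuous_onI continuous_intros)+
  show ?thesis unfolding cdot_def by measurable
qed

lemma cmod_one_minus_cdot_commute: "cmod (1 - cdot \<xi> \<eta>) = cmod (1 - cdot \<eta> \<xi>)"
proof -
  have "cdot \<eta> \<xi> = cnj (cdot \<xi> \<eta>)" by (simp add: cdot_def mult.commute)
  then have "1 - cdot \<eta> \<xi> = cnj (1 - cdot \<xi> \<eta>)" by simp
  then show ?thesis by (simp only: complex_mod_cnj)
qed

lemma capped_energy_lower_bound:
  fixes u w :: "complex ^ ('n::finite option) \<Rightarrow> real"
  defines "C \<equiv> 2 ^ CARD('n) * measure lborel (heisenberg_unit_ball :: ((complex ^ 'n) \<times> real) set)"
  assumes mu: "\<mu> > 0" and um: "u \<in> borel_measurable sphere_measure" and wm: "w \<in> borel_measurable sphere_measure"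
    and u: "\<And>\<eta>. norm \<eta> = 1 \<Longrightarrow> 0 \<le> u \<eta> \<and> u \<eta> \<le> 1" and w: "\<And>\<eta>. norm \<eta> = 1 \<Longrightarrow> 0 \<le> w \<eta>"
  shows "ennreal ((2 * C) powr (-\<mu>) * (1 + \<mu> / 2) / (1 + \<mu>) * (\<integral>\<eta>. u \<eta> powr (2 / (2 + \<mu>)) \<partial>sphere_measure) powr (1 + \<mu>))
       * (\<integral>\<^sup>+\<xi>. ennreal (w \<xi>) \<partial>sphere_measure)
     \<le> (\<integral>\<^sup>+\<xi>. \<integral>\<^sup>+\<eta>. ennreal (w \<xi> * u \<eta> * cmod (1 - cdot \<xi> \<eta>) powr (\<mu> * (real CARD('n) + 1))) \<partial>sphere_measure \<partial>sphere_measure)"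
proof -
  let ?c = "ennreal ((2 * C) powr (-\<mu>) * (1 + \<mu> / 2) / (1 + \<mu>) * (\<integral>\<eta>. u \<eta> powr (2 / (2 + \<mu>)) \<partial>sphere_measure) powr (1 + \<mu>))"
  note [measurable] = um wm borel_measurable_sphere_measure[OF cdot_measurable]
  have "?c * (\<integral>\<^sup>+\<xi>. ennreal (w \<xi>) \<partial>sphere_measure) = (\<integral>\<^sup>+\<xi>. ennreal (w \<xi>) * ?c \<partial>sphere_measure)"
    by (subst nn_integral_multc) (auto simp: mult.commute)
  also have "\<dots> \<le> (\<integral>\<^sup>+\<xi>. \<integral>\<^sup>+\<eta>. ennreal (w \<xi> * u \<eta> * cmod (1 - cdot \<xi> \<eta>) powr (\<mu> * (real CARD('n) + 1))) \<partial>sphere_measure \<partial>sphere_measure)"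
  proof (rule nn_integral_mono)
    fix \<xi> :: "complex ^ ('n option)" assume "\<xi> \<in> space sphere_measure"
    then have xi: "norm \<xi> = 1" by (simp add: space_sphere_measure)
    have "ennreal (w \<xi>) * ?c \<le> ennreal (w \<xi>) * (\<integral>\<^sup>+\<eta>. ennreal (u \<eta> * cmod (1 - cdot \<xi> \<eta>) powr (\<mu> * (real CARD('n) + 1))) \<partial>sphere_measure)"
      unfolding C_def by (intro mult_left_mono capped_potential_lower_bound[OF mu um u xi]) auto
    also have "\<dots> = (\<integral>\<^sup>+\<eta>. ennreal (w \<xi>) * ennreal (u \<eta> * cmod (1 - cdot \<xi> \<eta>) powr (\<mu> * (real CARD('n) + 1))) \<partial>sphere_measure)"
      by (rule nn_integral_cmult[symmetric]) measurable
    also have "\<dots> = (\<integral>\<^sup>+\<eta>. ennreal (w \<xi> * u \<eta> * cmod (1 - cdot \<xi> \<eta>) powr (\<mu> * (real CARD('n) + 1))) \<partial>sphere_measure)"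
      using w[OF xi] by (simp add: ennreal_mult' mult.assoc)
    finally show "ennreal (w \<xi>) * ?c \<le> (\<integral>\<^sup>+\<eta>. ennreal (w \<xi> * u \<eta> * cmod (1 - cdot \<xi> \<eta>) powr (\<mu> * (real CARD('n) + 1))) \<partial>sphere_measure)" .
  qed
  finally show ?thesis .
qed

text \<open>
  Of the products arising from the decomposition, those of a lower part with a remainder are kept.
  The lower part, say of f, has a potential bounded below uniformly over the sphere by a multiple of
  (P / 2) powr (1 + mu), and the remainder of g has integral at least a multiple of R / 2.  The two
  resulting terms are combined by the inequality of the arithmetic and geometric mean, which
  produces the scaling (P R) powr (1 / p).
\<close>

lemma energy_lower_bound_normalized:
  fixes f g :: "complex ^ ('n::finite option) \<Rightarrow> real"
  defines "C \<equiv> 2 ^ CARD('n) * measure lborel (heisenberg_unit_ball :: ((complex ^ 'n) \<times> real) set)"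
  defines "p \<equiv> \<lambda>\<mu>. 2 / (2 + \<mu>)"
  assumes mu: "\<mu> > 0"
    and fm: "f \<in> borel_measurable sphere_measure" and gm: "g \<in> borel_measurable sphere_measure"
    and f: "\<And>\<eta>. norm \<eta> = 1 \<Longrightarrow> 0 \<le> f \<eta>" and g: "\<And>\<eta>. norm \<eta> = 1 \<Longrightarrow> 0 \<le> g \<eta>"
    and fi: "integrable sphere_measure (\<lambda>\<eta>. f \<eta> powr p \<mu>)" and gi: "integrable sphere_measure (\<lambda>\<eta>. g \<eta> powr p \<mu>)"
    and P: "P = (\<integral>\<eta>. f \<eta> powr p \<mu> \<partial>sphere_measure)" "P > 0" "(\<integral>\<eta>. cap (f \<eta>) powr p \<mu> \<partial>sphere_measure) = P / 2"
    and R: "R = (\<integral>\<eta>. g \<eta> powr p \<mu> \<partial>sphere_measure)" "R > 0" "(\<integral>\<eta>. cap (g \<eta>) powr p \<mu> \<partial>sphere_measure) = R / 2"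
  shows "ennreal ((8 * C) powr (-\<mu>) * (1 + \<mu> / 2)\<^sup>2 / 2 * (P * R) powr (1 + \<mu> / 2))
     \<le> (\<integral>\<^sup>+\<xi>. \<integral>\<^sup>+\<eta>. ennreal (f \<xi> * g \<eta> * cmod (1 - cdot \<xi> \<eta>) powr (\<mu> * (real CARD('n) + 1))) \<partial>sphere_measure \<partial>sphere_measure)"
proof -
  let ?\<sigma> = "sphere_measure :: (complex ^ ('n option)) measure"
  interpret finite_measure ?\<sigma> by (rule finite_measure_sphere_measure)
  interpret pair_sigma_finite ?\<sigma> ?\<sigma> ..
  let ?\<gamma> = "\<mu> * (real CARD('n) + 1)"
  let ?K = "\<lambda>\<xi> \<eta>. cmod (1 - cdot \<xi> \<eta>) powr ?\<gamma>"
  note [measurable] = fm gm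
  have C: "C > 0" unfolding C_def using measure_heisenberg_unit_ball_pos[where 'n = 'n] by simp
  define c1 where "c1 = (2 * C) powr (-\<mu>) * (1 + \<mu> / 2) / (1 + \<mu>)"
  define k where "k = (1 + \<mu>) * 2 powr (-\<mu>) * (1 + \<mu> / 2)"
  have c1: "c1 > 0" and k: "k > 0" using mu C by (simp_all add: c1_def k_def)
  have rest: "ennreal (k * (A / 2)) \<le> (\<integral>\<^sup>+\<xi>. ennreal (rest (h \<xi>)) \<partial>?\<sigma>)"
    if [measurable]: "h \<in> borel_measurable ?\<sigma>" and h: "\<And>\<eta>. norm \<eta> = 1 \<Longrightarrow> 0 \<le> h \<eta>"
      and hi: "integrable ?\<sigma> (\<lambda>\<eta>. h \<eta> powr p \<mu>)"
      and A: "A = (\<integral>\<eta>. h \<eta> powr p \<mu> \<partial>?\<sigma>)" "(\<integral>\<eta>. cap (h \<eta>) powr p \<mu> \<partial>?\<sigma>) = A / 2" for h A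
  proof -
    have p0: "p \<mu> > 0" using mu by (simp add: p_def)
    have ci: "integrable ?\<sigma> (\<lambda>\<eta>. cap (h \<eta>) powr p \<mu>)"
    proof (rule Bochner_Integration.integrable_bound[OF hi])
      show "AE \<eta> in ?\<sigma>. norm (cap (h \<eta>) powr p \<mu>) \<le> norm (h \<eta> powr p \<mu>)"
        by (rule AE_I2) (use h p0 in \<open>auto simp: space_sphere_measure cap_def intro!: powr_mono2\<close>)
    qed measurable
    have "(\<integral>\<eta>. k * (h \<eta> powr p \<mu> - cap (h \<eta>) powr p \<mu>) \<partial>?\<sigma>) = k * (A - A / 2)"
      unfolding A(2)[symmetric] unfolding A(1) using hi ci by simp
    moreover have "A - A / 2 = A / 2" by simp
    ultimately have "ennreal (k * (A / 2)) = ennreal (\<integral>\<eta>. k * (h \<eta> powr p \<mu> - cap (h \<eta>) powr p \<mu>) \<partial>?\<sigma>)"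
      by (simp only:)
    also have "\<dots> = (\<integral>\<^sup>+\<eta>. ennreal (k * (h \<eta> powr p \<mu> - cap (h \<eta>) powr p \<mu>)) \<partial>?\<sigma>)"
    proof (rule nn_integral_eq_integral[symmetric])
      show "integrable ?\<sigma> (\<lambda>\<eta>. k * (h \<eta> powr p \<mu> - cap (h \<eta>) powr p \<mu>))" using hi ci by simp
      show "AE \<eta> in ?\<sigma>. 0 \<le> k * (h \<eta> powr p \<mu> - cap (h \<eta>) powr p \<mu>)"
        by (rule AE_I2) (use h p0 k in \<open>auto simp: space_sphere_measure cap_def intro!: mult_nonneg_nonneg powr_mono2\<close>)
    qed
    also have "\<dots> \<le> (\<integral>\<^sup>+\<xi>. ennreal (rest (h \<xi>)) \<partial>?\<sigma>)"
      by (intro nn_integral_mono ennreal_leI)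
         (use rest_lower_bound[OF mu] h in \<open>simp add: space_sphere_measure k_def p_def\<close>)
    finally show ?thesis .
  qed
  have capb: "0 \<le> cap s \<and> cap s \<le> 1" "0 \<le> rest s" if "s \<ge> 0" for s
    using that by (auto simp: cap_def rest_def)
  have t1: "ennreal (c1 * (R / 2) powr (1 + \<mu>)) * ennreal (k * (P / 2))
      \<le> (\<integral>\<^sup>+\<xi>. \<integral>\<^sup>+\<eta>. ennreal (rest (f \<xi>) * cap (g \<eta>) * ?K \<xi> \<eta>) \<partial>?\<sigma> \<partial>?\<sigma>)"
  proof -
    have "ennreal (c1 * (R / 2) powr (1 + \<mu>)) * ennreal (k * (P / 2))
        \<le> ennreal (c1 * (R / 2) powr (1 + \<mu>)) * (\<integral>\<^sup>+\<xi>. ennreal (rest (f \<xi>)) \<partial>?\<sigma>)"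
      by (intro mult_left_mono rest[OF fm f fi P(1,3)]) auto
    also have "\<dots> \<le> (\<integral>\<^sup>+\<xi>. \<integral>\<^sup>+\<eta>. ennreal (rest (f \<xi>) * cap (g \<eta>) * ?K \<xi> \<eta>) \<partial>?\<sigma> \<partial>?\<sigma>)"
      unfolding c1_def C_def R(3)[symmetric] p_def
      by (rule capped_energy_lower_bound[OF mu]) (use f g capb in auto)
    finally show ?thesis .
  qed
  have t2: "ennreal (c1 * (P / 2) powr (1 + \<mu>)) * ennreal (k * (R / 2))
      \<le> (\<integral>\<^sup>+\<xi>. \<integral>\<^sup>+\<eta>. ennreal (cap (f \<xi>) * rest (g \<eta>) * ?K \<xi> \<eta>) \<partial>?\<sigma> \<partial>?\<sigma>)"
  proof -
    have "ennreal (c1 * (P / 2) powr (1 + \<mu>)) * ennreal (k * (R / 2))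
        \<le> ennreal (c1 * (P / 2) powr (1 + \<mu>)) * (\<integral>\<^sup>+\<xi>. ennreal (rest (g \<xi>)) \<partial>?\<sigma>)"
      by (intro mult_left_mono rest[OF gm g gi R(1,3)]) auto
    also have "\<dots> \<le> (\<integral>\<^sup>+\<eta>. \<integral>\<^sup>+\<xi>. ennreal (rest (g \<eta>) * cap (f \<xi>) * ?K \<eta> \<xi>) \<partial>?\<sigma> \<partial>?\<sigma>)"
      unfolding c1_def C_def P(3)[symmetric] p_def
      by (rule capped_energy_lower_bound[OF mu]) (use f g capb in auto)
    also have "\<dots> = (\<integral>\<^sup>+\<eta>. \<integral>\<^sup>+\<xi>. ennreal (cap (f \<xi>) * rest (g \<eta>) * ?K \<xi> \<eta>) \<partial>?\<sigma> \<partial>?\<sigma>)"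
      by (intro nn_integral_cong) (simp add: mult.commute[of "rest _"] cmod_one_minus_cdot_commute)
    also have "\<dots> = (\<integral>\<^sup>+\<xi>. \<integral>\<^sup>+\<eta>. ennreal (cap (f \<xi>) * rest (g \<eta>) * ?K \<xi> \<eta>) \<partial>?\<sigma> \<partial>?\<sigma>)"
      by (rule Fubini') measurable
    finally show ?thesis .
  qed
  have "ennreal ((8 * C) powr (-\<mu>) * (1 + \<mu> / 2)\<^sup>2 / 2 * (P * R) powr (1 + \<mu> / 2))
      \<le> ennreal (c1 * (P / 2) powr (1 + \<mu>) * (k * (R / 2)) + c1 * (R / 2) powr (1 + \<mu>) * (k * (P / 2)))"
  proof (rule ennreal_leI)
    have 1: "(8 * C) powr (-\<mu>) = (2 * C) powr (-\<mu>) * (2 powr (-\<mu>) * 2 powr (-\<mu>))"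
      using C powr_mult[of "2 * C" 4 "-\<mu>"] powr_mult[of 2 2 "-\<mu>"] by simp
    have 2: "(P / 2 * (R / 2)) powr (1 + \<mu> / 2) = (P * R) powr (1 + \<mu> / 2) * 2 powr (-\<mu>) / 4"
    proof -
      have "(P / 2 * (R / 2)) powr (1 + \<mu> / 2) = (P * R / 4) powr (1 + \<mu> / 2)" by simp
      also have "\<dots> = (P * R) powr (1 + \<mu> / 2) / 4 powr (1 + \<mu> / 2)"
        using P(2) R(2) by (simp add: powr_divide)
      also have "(4::real) powr (1 + \<mu> / 2) = 4 * 2 powr \<mu>"
        using powr_powr[of "2::real" 2 "\<mu> / 2"] by (simp add: powr_add)
      finally show ?thesis by (simp add: powr_minus divide_simps)
    qed
    have "(8 * C) powr (-\<mu>) * (1 + \<mu> / 2)\<^sup>2 / 2 * (P * R) powr (1 + \<mu> / 2)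
       = c1 * k * (2 * (P / 2 * (R / 2)) powr (1 + \<mu> / 2))"
      unfolding 1 2 c1_def k_def using mu by (simp add: power2_eq_square divide_simps)
    also have "\<dots> \<le> c1 * k * ((P / 2) powr (1 + \<mu>) * (R / 2) + (R / 2) powr (1 + \<mu>) * (P / 2))"
      using c1 k P(2) R(2) by (intro mult_left_mono powr_product_symmetrized) auto
    finally show "(8 * C) powr (-\<mu>) * (1 + \<mu> / 2)\<^sup>2 / 2 * (P * R) powr (1 + \<mu> / 2)
      \<le> c1 * (P / 2) powr (1 + \<mu>) * (k * (R / 2)) + c1 * (R / 2) powr (1 + \<mu>) * (k * (P / 2))"
      by (simp add: algebra_simps)
  qed
  also have "\<dots> = ennreal (c1 * (P / 2) powr (1 + \<mu>)) * ennreal (k * (R / 2)) + ennreal (c1 * (R / 2) powr (1 + \<mu>)) * ennreal (k * (P / 2))"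
  proof -
    have split: "ennreal (a * b + c * d) = ennreal a * ennreal b + ennreal c * ennreal d"
      if "a \<ge> 0" "b \<ge> 0" "c \<ge> 0" "d \<ge> 0" for a b c d
      using that by (simp add: ennreal_mult)
    show ?thesis by (rule split) (use c1 k P(2) R(2) in auto)
  qed
  also have "\<dots> \<le> (\<integral>\<^sup>+\<xi>. \<integral>\<^sup>+\<eta>. ennreal (cap (f \<xi>) * rest (g \<eta>) * ?K \<xi> \<eta>) \<partial>?\<sigma> \<partial>?\<sigma>)
      + (\<integral>\<^sup>+\<xi>. \<integral>\<^sup>+\<eta>. ennreal (rest (f \<xi>) * cap (g \<eta>) * ?K \<xi> \<eta>) \<partial>?\<sigma> \<partial>?\<sigma>)"
    by (rule add_mono[OF t2 t1])
  also have "\<dots> = (\<integral>\<^sup>+\<xi>. \<integral>\<^sup>+\<eta>. ennreal (cap (f \<xi>) * rest (g \<eta>) * ?K \<xi> \<eta>) + ennreal (rest (f \<xi>) * cap (g \<eta>) * ?K \<xi> \<eta>) \<partial>?\<sigma> \<partial>?\<sigma>)"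
  proof -
    note [measurable] = borel_measurable_sphere_measure[OF cdot_measurable]
    have "(\<integral>\<^sup>+\<eta>. ennreal (cap (f \<xi>) * rest (g \<eta>) * ?K \<xi> \<eta>) + ennreal (rest (f \<xi>) * cap (g \<eta>) * ?K \<xi> \<eta>) \<partial>?\<sigma>)
      = (\<integral>\<^sup>+\<eta>. ennreal (cap (f \<xi>) * rest (g \<eta>) * ?K \<xi> \<eta>) \<partial>?\<sigma>) + (\<integral>\<^sup>+\<eta>. ennreal (rest (f \<xi>) * cap (g \<eta>) * ?K \<xi> \<eta>) \<partial>?\<sigma>)" for \<xi>
      by (rule nn_integral_add) measurable
    then show ?thesis by (simp only:) (rule nn_integral_add[symmetric], measurable)
  qed
  also have "\<dots> \<le> (\<integral>\<^sup>+\<xi>. \<integral>\<^sup>+\<eta>. ennreal (f \<xi> * g \<eta> * ?K \<xi> \<eta>) \<partial>?\<sigma> \<partial>?\<sigma>)"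
  proof (intro nn_integral_mono)
    fix \<xi> \<eta> assume "\<xi> \<in> space ?\<sigma>" "\<eta> \<in> space ?\<sigma>"
    then have nn: "0 \<le> f \<xi>" "0 \<le> g \<eta>" using f g by (auto simp: space_sphere_measure)
    have "ennreal (cap (f \<xi>) * rest (g \<eta>) * ?K \<xi> \<eta>) + ennreal (rest (f \<xi>) * cap (g \<eta>) * ?K \<xi> \<eta>)
       = ennreal (cap (f \<xi>) * rest (g \<eta>) * ?K \<xi> \<eta> + rest (f \<xi>) * cap (g \<eta>) * ?K \<xi> \<eta>)"
      using nn capb by (intro ennreal_plus[symmetric] mult_nonneg_nonneg) auto
    also have "\<dots> \<le> ennreal (f \<xi> * g \<eta> * ?K \<xi> \<eta>)"
      unfolding distrib_right[symmetric] by (intro ennreal_leI mult_right_mono cap_rest_product) auto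
    finally show "ennreal (cap (f \<xi>) * rest (g \<eta>) * ?K \<xi> \<eta>) + ennreal (rest (f \<xi>) * cap (g \<eta>) * ?K \<xi> \<eta>) \<le> ennreal (f \<xi> * g \<eta> * ?K \<xi> \<eta>)" .
  qed
  finally show ?thesis .
qed

text \<open>
  The integral of (min f t) powr p depends continuously on t, vanishes at t = 0 and tends to the integral
  of f powr p, by dominated convergence; so it attains half of the limit.
\<close>

lemma median_level:
  fixes f :: "'a \<Rightarrow> real"
  assumes p: "p > 0" and fm: "f \<in> borel_measurable M" and f: "\<And>x. x \<in> space M \<Longrightarrow> 0 \<le> f x"
    and fi: "integrable M (\<lambda>x. f x powr p)" and pos: "(\<integral>x. f x powr p \<partial>M) > 0"
  obtains t where "t > 0" "(\<integral>x. (min (f x) t) powr p \<partial>M) = (\<integral>x. f x powr p \<partial>M) / 2"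
proof -
  note [measurable] = fm
  define F where "F t = (\<integral>x. (min (f x) t) powr p \<partial>M)" for t
  let ?P = "\<integral>x. f x powr p \<partial>M"
  have dom: "AE x in M. norm ((min (f x) t) powr p) \<le> f x powr p" if "t \<ge> 0" for t
    by (rule AE_I2) (use f p that in \<open>auto intro!: powr_mono2\<close>)
  have cont: "continuous_on {0..} F"
    unfolding continuous_on_sequentially
  proof (intro allI ballI impI)
    fix s and t :: real assume t: "t \<in> {0..}" and s: "(\<forall>n. s n \<in> {0..}) \<and> s \<longlonglongrightarrow> t"
    have "(\<lambda>n. F (s n)) \<longlonglongrightarrow> F t"
      unfolding F_def
    proof (rule integral_dominated_convergence[where w = "\<lambda>x. f x powr p"])
      show "AE x in M. (\<lambda>n. (min (f x) (s n)) powr p) \<longlonglongrightarrow> (min (f x) t) powr p"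
      proof (rule AE_I2)
        fix x assume x: "x \<in> space M"
        have "continuous_on {0..} (\<lambda>r. r powr p)"
          using p by (intro continuous_on_powr' continuous_intros) auto
        moreover have "(\<lambda>n. min (f x) (s n)) \<longlonglongrightarrow> min (f x) t" using s by (intro tendsto_intros) auto
        ultimately show "(\<lambda>n. (min (f x) (s n)) powr p) \<longlonglongrightarrow> (min (f x) t) powr p"
          by (rule continuous_on_tendsto_compose) (use f[OF x] s t in auto)
      qed
    qed (use fi dom s in auto)
    then show "(F \<circ> s) \<longlonglongrightarrow> F t" by (simp add: o_def)
  qed
  have "(\<lambda>n. F (real n)) \<longlonglongrightarrow> ?P"
    unfolding F_def
  proof (rule integral_dominated_convergence[where w = "\<lambda>x. f x powr p"])
    show "AE x in M. (\<lambda>n. (min (f x) (real n)) powr p) \<longlonglongrightarrow> f x powr p"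
    proof (rule AE_I2)
      fix x
      obtain N :: nat where "f x \<le> real N" using real_arch_simple by blast
      then have "\<forall>n\<ge>N. (min (f x) (real n)) powr p = f x powr p" by (auto simp: min_def)
      then show "(\<lambda>n. (min (f x) (real n)) powr p) \<longlonglongrightarrow> f x powr p"
        by (intro tendsto_eventually) (auto simp: eventually_sequentially)
    qed
  qed (use fi dom in auto)
  then have "\<forall>\<^sub>F n in sequentially. F (real n) > ?P / 2"
    using pos by (intro order_tendstoD(1)) auto
  then obtain n where n: "F (real n) > ?P / 2" by (auto simp: eventually_sequentially)
  have "F 0 = (\<integral>x. 0 \<partial>M)" unfolding F_def
    by (rule Bochner_Integration.integral_cong) (use f in auto)
  then have F0: "F 0 = 0" by simp
  have "\<exists>t. 0 \<le> t \<and> t \<le> real n \<and> F t = ?P / 2"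
    by (rule IVT') (use F0 pos n continuous_on_subset[OF cont] in auto)
  then obtain t where "0 \<le> t" "F t = ?P / 2" by auto
  moreover have "t \<noteq> 0" using F0 pos \<open>F t = ?P / 2\<close> by auto
  ultimately show ?thesis using that[of t] by (auto simp: F_def)
qed

text \<open>
  Both sides are homogeneous of degree one in f and in g separately, so f and g may be divided by the
  levels that halve the integrals of f powr p and g powr p.
\<close>

lemma energy_lower_bound:
  fixes f g :: "complex ^ ('n::finite option) \<Rightarrow> real"
  defines "C \<equiv> 2 ^ CARD('n) * measure lborel (heisenberg_unit_ball :: ((complex ^ 'n) \<times> real) set)"
  defines "p \<equiv> \<lambda>\<mu>. 2 / (2 + \<mu>)"
  assumes mu: "\<mu> > 0"
    and fm: "f \<in> borel_measurable sphere_measure" and gm: "g \<in> borel_measurable sphere_measure"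
    and f: "\<And>\<eta>. norm \<eta> = 1 \<Longrightarrow> 0 \<le> f \<eta>" and g: "\<And>\<eta>. norm \<eta> = 1 \<Longrightarrow> 0 \<le> g \<eta>"
    and fi: "integrable sphere_measure (\<lambda>\<eta>. f \<eta> powr p \<mu>)" and gi: "integrable sphere_measure (\<lambda>\<eta>. g \<eta> powr p \<mu>)"
    and P: "P = (\<integral>\<eta>. f \<eta> powr p \<mu> \<partial>sphere_measure)" "P > 0"
    and R: "R = (\<integral>\<eta>. g \<eta> powr p \<mu> \<partial>sphere_measure)" "R > 0"
  shows "ennreal ((8 * C) powr (-\<mu>) * (1 + \<mu> / 2)\<^sup>2 / 2 * (P powr (1 + \<mu> / 2) * R powr (1 + \<mu> / 2)))
     \<le> (\<integral>\<^sup>+\<xi>. \<integral>\<^sup>+\<eta>. ennreal (f \<xi> * g \<eta> * cmod (1 - cdot \<xi> \<eta>) powr (\<mu> * (real CARD('n) + 1))) \<partial>sphere_measure \<partial>sphere_measure)"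
proof -
  let ?\<sigma> = "sphere_measure :: (complex ^ ('n option)) measure"
  let ?\<gamma> = "\<mu> * (real CARD('n) + 1)"
  let ?K = "\<lambda>\<xi> \<eta>. cmod (1 - cdot \<xi> \<eta>) powr ?\<gamma>"
  interpret finite_measure ?\<sigma> by (rule finite_measure_sphere_measure)
  note [measurable] = fm gm
  have p: "p \<mu> > 0" "p \<mu> * (1 + \<mu> / 2) = 1" using mu by (simp_all add: p_def field_simps)
  have nonneg: "\<And>x. x \<in> space ?\<sigma> \<Longrightarrow> 0 \<le> f x" "\<And>x. x \<in> space ?\<sigma> \<Longrightarrow> 0 \<le> g x"
    using f g by (auto simp: space_sphere_measure)
  obtain t where t: "t > 0" "(\<integral>x. (min (f x) t) powr p \<mu> \<partial>?\<sigma>) = P / 2"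
    using median_level[OF p(1) fm nonneg(1) fi] P by metis
  obtain s where s: "s > 0" "(\<integral>x. (min (g x) s) powr p \<mu> \<partial>?\<sigma>) = R / 2"
    using median_level[OF p(1) gm nonneg(2) gi] R by metis
  have scale: "h x powr p \<mu> = r powr p \<mu> * (h x / r) powr p \<mu>"
    "(min (h x) r) powr p \<mu> = r powr p \<mu> * cap (h x / r) powr p \<mu>"
    if "r > 0" "h x \<ge> 0" for h :: "complex ^ ('n option) \<Rightarrow> real" and r x
  proof -
    have "min (h x) r = r * cap (h x / r)" using that by (auto simp: cap_def min_def field_simps)
    then show "(min (h x) r) powr p \<mu> = r powr p \<mu> * cap (h x / r) powr p \<mu>"
      using that by (simp add: powr_mult cap_def)
    show "h x powr p \<mu> = r powr p \<mu> * (h x / r) powr p \<mu>"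
      using that by (simp add: powr_divide)
  qed
  have scaled: "integrable ?\<sigma> (\<lambda>x. (h x / r) powr p \<mu>)"
     "(\<integral>x. h x powr p \<mu> \<partial>?\<sigma>) / r powr p \<mu> = (\<integral>x. (h x / r) powr p \<mu> \<partial>?\<sigma>)"
     "(\<integral>x. (min (h x) r) powr p \<mu> \<partial>?\<sigma>) / r powr p \<mu> = (\<integral>x. cap (h x / r) powr p \<mu> \<partial>?\<sigma>)"
    if r: "r > 0" and h: "\<And>x. x \<in> space ?\<sigma> \<Longrightarrow> 0 \<le> h x" and hi: "integrable ?\<sigma> (\<lambda>x. h x powr p \<mu>)" for h r
  proof -
    have rp: "r powr p \<mu> > 0" using r by simp
    have s1: "h x powr p \<mu> = r powr p \<mu> * (h x / r) powr p \<mu>"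
      and s2: "(min (h x) r) powr p \<mu> = r powr p \<mu> * cap (h x / r) powr p \<mu>" if "x \<in> space ?\<sigma>" for x
      using scale[of r h x] r h[OF that] by blast+
    have "integrable ?\<sigma> (\<lambda>x. h x powr p \<mu> / r powr p \<mu>)" using hi by simp
    then show "integrable ?\<sigma> (\<lambda>x. (h x / r) powr p \<mu>)"
      by (rule Bochner_Integration.integrable_cong[THEN iffD1, rotated 2]) (use s1 rp in auto)
    have "(\<integral>x. h x powr p \<mu> \<partial>?\<sigma>) = (\<integral>x. r powr p \<mu> * (h x / r) powr p \<mu> \<partial>?\<sigma>)"
      by (rule Bochner_Integration.integral_cong) (use s1 in auto)
    then show "(\<integral>x. h x powr p \<mu> \<partial>?\<sigma>) / r powr p \<mu> = (\<integral>x. (h x / r) powr p \<mu> \<partial>?\<sigma>)" using rp by simp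
    have "(\<integral>x. (min (h x) r) powr p \<mu> \<partial>?\<sigma>) = (\<integral>x. r powr p \<mu> * cap (h x / r) powr p \<mu> \<partial>?\<sigma>)"
      by (rule Bochner_Integration.integral_cong) (use s2 in auto)
    then show "(\<integral>x. (min (h x) r) powr p \<mu> \<partial>?\<sigma>) / r powr p \<mu> = (\<integral>x. cap (h x / r) powr p \<mu> \<partial>?\<sigma>)" using rp by simp
  qed
  note sf = scaled[OF t(1) nonneg(1) fi] and sg = scaled[OF s(1) nonneg(2) gi]
  have low: "ennreal ((8 * C) powr (-\<mu>) * (1 + \<mu> / 2)\<^sup>2 / 2 * ((P / t powr p \<mu>) * (R / s powr p \<mu>)) powr (1 + \<mu> / 2))
     \<le> (\<integral>\<^sup>+\<xi>. \<integral>\<^sup>+\<eta>. ennreal (f \<xi> / t * (g \<eta> / s) * ?K \<xi> \<eta>) \<partial>?\<sigma> \<partial>?\<sigma>)"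
    unfolding C_def
  proof (rule energy_lower_bound_normalized[OF mu])
    show "P / t powr p \<mu> = (\<integral>\<eta>. (f \<eta> / t) powr (2 / (2 + \<mu>)) \<partial>?\<sigma>)" "R / s powr p \<mu> = (\<integral>\<eta>. (g \<eta> / s) powr (2 / (2 + \<mu>)) \<partial>?\<sigma>)"
      using sf(2) sg(2) by (simp_all add: P R p_def)
    show "(\<integral>\<eta>. cap (f \<eta> / t) powr (2 / (2 + \<mu>)) \<partial>?\<sigma>) = P / t powr p \<mu> / 2"
      "(\<integral>\<eta>. cap (g \<eta> / s) powr (2 / (2 + \<mu>)) \<partial>?\<sigma>) = R / s powr p \<mu> / 2"
      using sf(3) sg(3) unfolding t(2) s(2) by (simp_all add: p_def)
  qed (use t s f g P(2) R(2) sf(1) sg(1) in \<open>auto simp: p_def\<close>)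
  have e: "((P / t powr p \<mu>) * (R / s powr p \<mu>)) powr (1 + \<mu> / 2) = P powr (1 + \<mu> / 2) * R powr (1 + \<mu> / 2) / (t * s)"
    using P(2) R(2) t(1) s(1) by (simp add: powr_mult powr_divide powr_powr p(2))
  have "ennreal ((8 * C) powr (-\<mu>) * (1 + \<mu> / 2)\<^sup>2 / 2 * (P powr (1 + \<mu> / 2) * R powr (1 + \<mu> / 2)))
     = ennreal (t * s) * ennreal ((8 * C) powr (-\<mu>) * (1 + \<mu> / 2)\<^sup>2 / 2 * ((P / t powr p \<mu>) * (R / s powr p \<mu>)) powr (1 + \<mu> / 2))"
    unfolding e using t(1) s(1) by (subst ennreal_mult'[symmetric]) auto
  also have "\<dots> \<le> ennreal (t * s) * (\<integral>\<^sup>+\<xi>. \<integral>\<^sup>+\<eta>. ennreal (f \<xi> / t * (g \<eta> / s) * ?K \<xi> \<eta>) \<partial>?\<sigma> \<partial>?\<sigma>)"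
    by (rule mult_left_mono[OF low]) simp
  also have "\<dots> = (\<integral>\<^sup>+\<xi>. ennreal (t * s) * (\<integral>\<^sup>+\<eta>. ennreal (f \<xi> / t * (g \<eta> / s) * ?K \<xi> \<eta>) \<partial>?\<sigma>) \<partial>?\<sigma>)"
    by (rule nn_integral_cmult[symmetric]) measurable
  also have "\<dots> = (\<integral>\<^sup>+\<xi>. \<integral>\<^sup>+\<eta>. ennreal (f \<xi> * g \<eta> * ?K \<xi> \<eta>) \<partial>?\<sigma> \<partial>?\<sigma>)"
  proof (rule nn_integral_cong)
    fix \<xi>
    note [measurable] = borel_measurable_sphere_measure[OF cdot_measurable]
    have "ennreal (t * s) * (\<integral>\<^sup>+\<eta>. ennreal (f \<xi> / t * (g \<eta> / s) * ?K \<xi> \<eta>) \<partial>?\<sigma>) = (\<integral>\<^sup>+\<eta>. ennreal (t * s) * ennreal (f \<xi> / t * (g \<eta> / s) * ?K \<xi> \<eta>) \<partial>?\<sigma>)"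
      by (rule nn_integral_cmult[symmetric]) measurable
    also have "\<dots> = (\<integral>\<^sup>+\<eta>. ennreal (f \<xi> * g \<eta> * ?K \<xi> \<eta>) \<partial>?\<sigma>)"
      using t(1) s(1) by (simp flip: ennreal_mult')
    finally show "ennreal (t * s) * (\<integral>\<^sup>+\<eta>. ennreal (f \<xi> / t * (g \<eta> / s) * ?K \<xi> \<eta>) \<partial>?\<sigma>) = (\<integral>\<^sup>+\<eta>. ennreal (f \<xi> * g \<eta> * ?K \<xi> \<eta>) \<partial>?\<sigma>)" .
  qed
  finally show ?thesis .
qed

theorem proposition1p2:
  fixes n :: nat and Q \<alpha> p :: real
  assumes "n = CARD('n::finite)"
    and "Q = 2 * real n + 2"
    and "\<alpha> > Q"
    and "p = 2 * Q / (Q + \<alpha>)"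
  shows
    "0 < (8 * measure lborel (heisenberg_unit_ball :: ((complex ^ 'n) \<times> real) set)) powr ((Q - \<alpha>) / Q)
           / (2 powr (1 + real n * ((\<alpha> - Q) / Q)) * p\<^sup>2)
     \<and> ennreal ((8 * measure lborel (heisenberg_unit_ball :: ((complex ^ 'n) \<times> real) set)) powr ((Q - \<alpha>) / Q)
           / (2 powr (1 + real n * ((\<alpha> - Q) / Q)) * p\<^sup>2))
         \<le> sphere_HLS_inf TYPE('n) ((\<alpha> - Q) / 2) p
     \<and> sphere_HLS_inf TYPE('n) ((\<alpha> - Q) / 2) p
         \<le> ennreal ((2 * pi ^ (n + 1) / fact n) powr ((Q - \<alpha>) / Q)
              * (fact n * Gamma (\<alpha> / 2) / (Gamma ((Q + \<alpha>) / 4))\<^sup>2))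
     \<and> (\<forall>\<xi> \<in> sphere (0 :: complex ^ ('n option)) 1.
          (2 * pi ^ (n + 1) / fact n) powr ((Q - \<alpha>) / Q)
              * (fact n * Gamma (\<alpha> / 2) / (Gamma ((Q + \<alpha>) / 4))\<^sup>2)
          = measure sphere_measure (sphere (0 :: complex ^ ('n option)) 1) powr (1 - 2 / p)
              * (\<integral>\<eta>. cmod (1 - cdot \<xi> \<eta>) powr ((\<alpha> - Q) / 2) \<partial>sphere_measure))"
proof -
  let ?\<sigma> = "sphere_measure :: (complex ^ ('n option)) measure"
  interpret finite_measure ?\<sigma> by (rule finite_measure_sphere_measure)
  note n = assms(1)
  define B where "B = measure lborel (heisenberg_unit_ball :: ((complex ^ 'n) \<times> real) set)"
  have B: "B > 0" unfolding B_def by (rule measure_heisenberg_unit_ball_pos)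
  define \<mu> where "\<mu> = (\<alpha> - Q) / Q"
  define \<gamma> where "\<gamma> = (\<alpha> - Q) / 2"
  define S where "S = 2 * pi ^ (n + 1) / fact n"
  define G where "G = fact n * Gamma (\<alpha> / 2) / (Gamma ((Q + \<alpha>) / 4))\<^sup>2"
  have Q: "Q > 0" using assms(2) by simp
  have mu: "\<mu> > 0" using Q assms(3) by (simp add: \<mu>_def)
  have \<alpha>: "\<alpha> = Q * (1 + \<mu>)" using Q by (simp add: \<mu>_def field_simps)
  have neg: "(Q - \<alpha>) / Q = -\<mu>" using Q by (simp add: \<mu>_def field_simps)
  have gam: "\<gamma> = \<mu> * (real CARD('n) + 1)" "\<gamma> \<ge> 0"
    using assms(2,3) Q unfolding \<gamma>_def \<mu>_def n by (simp_all add: field_simps)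
  have p: "p = 2 / (2 + \<mu>)"
  proof -
    have "Q + \<alpha> = Q * (2 + \<mu>)" by (simp add: \<alpha> algebra_simps)
    then show ?thesis using Q assms(4) by simp
  qed
  have ip: "1 / p = 1 + \<mu> / 2" "2 / p = 2 + \<mu>" using mu by (simp_all add: p field_simps)
  have S: "S > 0" by (simp add: S_def)
  have G: "G > 0"
    unfolding G_def using Q assms(3) by (intro divide_pos_pos mult_pos_pos zero_less_power Gamma_real_pos) auto
  have kernel_nn: "(\<integral>\<^sup>+\<eta>. ennreal (cmod (1 - cdot \<xi> \<eta>) powr \<gamma>) \<partial>?\<sigma>) = ennreal (S * G)" if "norm \<xi> = 1" for \<xi>
  proof -
    have "\<gamma> + CARD('n) + 1 = \<alpha> / 2" "\<gamma> / 2 + CARD('n) + 1 = (Q + \<alpha>) / 4"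
      using assms(2) unfolding \<gamma>_def n by (simp_all add: field_simps)
    then show ?thesis
      using nn_integral_sphere_kernel[OF that gam(2)] by (simp only: S_def G_def n)
  qed
  have kernel_m[measurable]: "(\<lambda>\<eta>. cmod (1 - cdot \<xi> \<eta>) powr \<gamma>) \<in> borel_measurable ?\<sigma>" for \<xi>
    by (rule borel_measurable_sphere_measure) measurable
  have total: "emeasure ?\<sigma> (space ?\<sigma>) = ennreal S" "measure ?\<sigma> (sphere 0 1) = S"
    using S total_sphere_measure[where 'n = 'n] by (simp_all add: space_sphere_measure S_def n measure_def)
  define c where "c = (8 * B) powr (-\<mu>) / (2 powr (1 + real n * \<mu>) * p\<^sup>2)"
  have c: "c > 0" using B mu by (simp add: c_def p)
  have c_eq: "c = (8 * (2 ^ CARD('n) * B)) powr (-\<mu>) * (1 + \<mu> / 2)\<^sup>2 / 2"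
  proof -
    have 1: "(8 * (2 ^ CARD('n) * B)) powr (-\<mu>) = (8 * B) powr (-\<mu>) * 2 powr (real n * (-\<mu>))"
    proof -
      have "8 * (2 ^ CARD('n) * B) = (8 * B) * 2 powr real n" by (simp add: n powr_realpow)
      then show ?thesis using B by (simp add: powr_mult powr_powr)
    qed
    have 2: "2 powr (1 + real n * \<mu>) = 2 * 2 powr (real n * \<mu>)" by (simp add: powr_add)
    have 3: "1 + \<mu> / 2 = 1 / p" by (simp add: ip)
    show ?thesis unfolding c_def 1 2 3 by (simp add: power_divide powr_minus divide_simps)
  qed
  have "ennreal c \<le> sphere_HLS_inf TYPE('n) \<gamma> p"
    unfolding sphere_HLS_inf_def Let_def
  proof (rule INF_greatest, clarify)
    fix f g :: "complex ^ ('n option) \<Rightarrow> real"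
    assume fg: "f \<in> Lp_nonneg_nonzero ?\<sigma> p" "g \<in> Lp_nonneg_nonzero ?\<sigma> p"
    have facts: "h \<in> borel_measurable ?\<sigma>" "\<And>\<eta>. norm \<eta> = 1 \<Longrightarrow> 0 \<le> h \<eta>"
       "integrable ?\<sigma> (\<lambda>\<eta>. h \<eta> powr (2 / (2 + \<mu>)))" "(\<integral>\<eta>. h \<eta> powr (2 / (2 + \<mu>)) \<partial>?\<sigma>) > 0"
       "Lp_norm ?\<sigma> p h = (\<integral>\<eta>. h \<eta> powr (2 / (2 + \<mu>)) \<partial>?\<sigma>) powr (1 + \<mu> / 2)"
      if h: "h \<in> Lp_nonneg_nonzero ?\<sigma> p" for h
    proof -
      show m: "h \<in> borel_measurable ?\<sigma>" using h by (simp add: Lp_nonneg_nonzero_def Lp_space_def)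
      have nn: "0 \<le> h \<eta>" if "\<eta> \<in> space ?\<sigma>" for \<eta> using h that by (simp add: Lp_nonneg_nonzero_def)
      then show "\<And>\<eta>. norm \<eta> = 1 \<Longrightarrow> 0 \<le> h \<eta>" by (simp add: space_sphere_measure)
      have "integrable ?\<sigma> (\<lambda>\<eta>. \<bar>h \<eta>\<bar> powr p)" using h by (simp add: Lp_nonneg_nonzero_def Lp_space_def)
      moreover have "integrable ?\<sigma> (\<lambda>\<eta>. \<bar>h \<eta>\<bar> powr p) \<longleftrightarrow> integrable ?\<sigma> (\<lambda>\<eta>. h \<eta> powr p)"
        by (rule Bochner_Integration.integrable_cong) (use nn in auto)
      ultimately have int: "integrable ?\<sigma> (\<lambda>\<eta>. h \<eta> powr p)" by simp
      then show "integrable ?\<sigma> (\<lambda>\<eta>. h \<eta> powr (2 / (2 + \<mu>)))" by (simp only: p)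
      have "(\<integral>\<eta>. \<bar>h \<eta>\<bar> powr p \<partial>?\<sigma>) = (\<integral>\<eta>. h \<eta> powr p \<partial>?\<sigma>)"
        by (rule Bochner_Integration.integral_cong) (use nn in auto)
      then show "Lp_norm ?\<sigma> p h = (\<integral>\<eta>. h \<eta> powr (2 / (2 + \<mu>)) \<partial>?\<sigma>) powr (1 + \<mu> / 2)"
        unfolding Lp_norm_def ip by (simp only: p)
      have "(\<integral>\<eta>. h \<eta> powr p \<partial>?\<sigma>) \<noteq> 0"
      proof
        assume "(\<integral>\<eta>. h \<eta> powr p \<partial>?\<sigma>) = 0"
        then have "AE \<eta> in ?\<sigma>. h \<eta> powr p = 0"
          using integral_nonneg_eq_0_iff_AE[OF int] by simp
        then have "AE \<eta> in ?\<sigma>. h \<eta> = 0" by simp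
        then show False using h by (simp add: Lp_nonneg_nonzero_def)
      qed
      moreover have "(\<integral>\<eta>. h \<eta> powr p \<partial>?\<sigma>) \<ge> 0" by simp
      ultimately have "(\<integral>\<eta>. h \<eta> powr p \<partial>?\<sigma>) > 0" by linarith
      then show "(\<integral>\<eta>. h \<eta> powr (2 / (2 + \<mu>)) \<partial>?\<sigma>) > 0" by (simp only: p)
    qed
    note F = facts[OF fg(1)] and G = facts[OF fg(2)]
    define N where "N = Lp_norm ?\<sigma> p f * Lp_norm ?\<sigma> p g"
    have N: "N > 0" unfolding N_def F(5) G(5) using F(4) G(4) by simp
    let ?J = "\<integral>\<^sup>+\<xi>. \<integral>\<^sup>+\<eta>. ennreal (f \<xi> * g \<eta> * cmod (1 - cdot \<xi> \<eta>) powr \<gamma>) \<partial>?\<sigma> \<partial>?\<sigma>"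
    have "ennreal (c * N) \<le> ?J"
      unfolding c_eq N_def F(5) G(5) gam(1) B_def
      by (rule energy_lower_bound[OF mu F(1) G(1) F(2) G(2) F(3) G(3) refl F(4) refl G(4)])
    then have "ennreal (c * N) / ennreal N \<le> ?J / ennreal N" by (rule divide_right_mono_ennreal)
    also have "ennreal (c * N) / ennreal N = ennreal c" using c N by (simp add: divide_ennreal)
    finally show "ennreal c \<le> ?J / ennreal (Lp_norm ?\<sigma> p f * Lp_norm ?\<sigma> p g)" by (simp only: N_def)
  qed
  moreover have "sphere_HLS_inf TYPE('n) \<gamma> p \<le> ennreal (S powr (-\<mu>) * G)"
  proof -
    let ?o = "\<lambda>_ :: complex ^ ('n option). 1 :: real"
    have "\<not> (AE x in ?\<sigma>. (1::real) = 0)"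
      using S total(1) by (simp add: AE_iff_null null_sets_def)
    then have o: "?o \<in> Lp_nonneg_nonzero ?\<sigma> p"
      by (simp add: Lp_nonneg_nonzero_def Lp_space_def)
    have norm1: "Lp_norm ?\<sigma> p ?o = S powr (1 + \<mu> / 2)"
      using total(2) by (simp add: Lp_norm_def ip space_sphere_measure)
    have "sphere_HLS_inf TYPE('n) \<gamma> p \<le> (\<integral>\<^sup>+\<xi>. (\<integral>\<^sup>+\<eta>. ennreal (?o \<xi> * ?o \<eta> * cmod (1 - cdot \<xi> \<eta>) powr \<gamma>) \<partial>?\<sigma>) \<partial>?\<sigma>)
        / ennreal (Lp_norm ?\<sigma> p ?o * Lp_norm ?\<sigma> p ?o)"
      unfolding sphere_HLS_inf_def Let_def by (rule INF_lower2[of "(?o, ?o)"]) (use o in auto)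
    also have "(\<integral>\<^sup>+\<xi>. (\<integral>\<^sup>+\<eta>. ennreal (?o \<xi> * ?o \<eta> * cmod (1 - cdot \<xi> \<eta>) powr \<gamma>) \<partial>?\<sigma>) \<partial>?\<sigma>) = (\<integral>\<^sup>+\<xi>. ennreal (S * G) \<partial>?\<sigma>)"
      by (rule nn_integral_cong) (use kernel_nn in \<open>simp add: space_sphere_measure\<close>)
    also have "\<dots> = ennreal (S * G * S)"
      using S G total(1) by (simp add: ennreal_mult)
    also have "Lp_norm ?\<sigma> p ?o * Lp_norm ?\<sigma> p ?o = S powr (2 + \<mu>)"
      unfolding norm1 by (simp flip: powr_add)
    also have "ennreal (S * G * S) / ennreal (S powr (2 + \<mu>)) = ennreal (S powr (-\<mu>) * G)"
      using S G by (simp add: divide_ennreal powr_add powr_minus power2_eq_square divide_simps)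
    finally show ?thesis .
  qed
  moreover have "S powr (-\<mu>) * G = measure ?\<sigma> (sphere 0 1) powr (1 - 2 / p) * (\<integral>\<eta>. cmod (1 - cdot \<xi> \<eta>) powr \<gamma> \<partial>?\<sigma>)"
    if "\<xi> \<in> sphere 0 1" for \<xi>
  proof -
    have "(\<integral>\<eta>. cmod (1 - cdot \<xi> \<eta>) powr \<gamma> \<partial>?\<sigma>) = enn2real (\<integral>\<^sup>+\<eta>. ennreal (cmod (1 - cdot \<xi> \<eta>) powr \<gamma>) \<partial>?\<sigma>)"
      by (rule integral_eq_nn_integral) auto
    also have "\<dots> = S * G" using kernel_nn[of \<xi>] that S G by simp
    finally have I: "(\<integral>\<eta>. cmod (1 - cdot \<xi> \<eta>) powr \<gamma> \<partial>?\<sigma>) = S * G" .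
    have "1 - 2 / p + 1 = -\<mu>" by (simp add: ip)
    then have "S powr (-\<mu>) = S powr (1 - 2 / p) * S"
      using S powr_add[of S "1 - 2 / p" 1] by simp
    then show ?thesis unfolding I total(2) by simp
  qed
  ultimately show ?thesis
    using c unfolding neg \<gamma>_def[symmetric] \<mu>_def[symmetric] S_def[symmetric] G_def[symmetric] B_def[symmetric] c_def[symmetric]
    by blast
qed

end
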